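(* Let $M$ be a nondegenerate real hypersurface in $\mathbb{C}^{n+1}$ defined by $\varrho=0$ with $d\varrho\neq0$ and $J(\varrho)\neq0$ on $M$. Assume $\varrho_w\neq0$, and let $\theta=\iota^*(i\bar\partial\varrho)$, where $\iota:M\to\mathbb{C}^{n+1}$ is the inclusion. Then, in the local frame $Z_\alpha=\partial_\alpha-(\varrho_\alpha/\varrho_w)\,\partial_w$, $\alpha=1,\dots,n$, the pseudohermitian curvature of $(M,\theta)$ is given by $$R_{\alpha\bar\beta\gamma\bar\sigma}=-\mathcal{R}^{\varrho}_{\alpha\bar\beta\gamma\bar\sigma}(\varrho)+h^{j\bar k}D^{\varrho}_{\alpha\gamma}(\varrho_{\bar k})D^{\varrho}_{\bar\beta\bar\sigma}(\varrho_j)+|\xi|^2\left(h_{\alpha\bar\beta}h_{\gamma\bar\sigma}+h_{\alpha\bar\sigma}h_{\gamma\bar\beta}\right)+h_{\bar\beta\bar\sigma}\xi^{\bar k}D^{\varrho}_{\alpha\gamma}(\varrho_{\bar k})+h_{\alpha\gamma}\xi^{j}D^{\varrho}_{\bar\beta\bar\sigma}(\varrho_j)-|\xi|^2h_{\alpha\gamma}h_{\bar\beta\bar\sigma},$$ and the Chern--Moser--Weyl tensor is given by $$\begin{aligned}S_{\alpha\bar\beta\gamma\bar\sigma}&=-\mathcal{R}^{\varrho}_{\alpha\bar\beta\gamma\bar\sigma}(\varrho)+h^{j\bar k}D^{\varrho}_{\alpha\gamma}(\varrho_{\bar k})D^{\varrho}_{\bar\beta\bar\sigma}(\varrho_j)+h_{\bar\beta\bar\sigma}\xi^{\bar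 k}D^{\varrho}_{\alpha\gamma}(\varrho_{\bar k})+h_{\alpha\gamma}\xi^{j}D^{\varrho}_{\bar\beta\bar\sigma}(\varrho_j)-|\xi|^2h_{\alpha\gamma}h_{\bar\beta\bar\sigma}\\&\quad+\frac{1}{n+2}\left(h_{\gamma\bar\sigma}D^{\varrho}_{\alpha\bar\beta}+h_{\gamma\bar\beta}D^{\varrho}_{\alpha\bar\sigma}+h_{\alpha\bar\beta}D^{\varrho}_{\gamma\bar\sigma}+h_{\alpha\bar\sigma}D^{\varrho}_{\gamma\bar\beta}\right)\log J(\varrho)\\&\quad-\frac{1}{(n+1)(n+2)}\left(h_{\alpha\bar\beta}h_{\gamma\bar\sigma}+h_{\alpha\bar\sigma}h_{\gamma\bar\beta}\right)h^{\epsilon\bar\delta}D^{\varrho}_{\epsilon\bar\delta}\log J(\varrho).\end{aligned}$$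
   Context: Coordinates on $\mathbb{C}^{n+1}$ are $(z_1,\dots,z_n,z_{n+1})$ with $w=z_{n+1}$. Greek indices run over $1,\dots,n$, lowercase Latin indices over $1,\dots,n+1$, and repeated indices are summed. $\varrho$ is smooth and real-valued; subscripts denote partial derivatives ($\varrho_j=\partial\varrho/\partial z_j$, $\varrho_{\bar k}=\partial\varrho/\partial\bar z_k$, $\varrho_{j\bar k}=\partial^2\varrho/\partial z_j\partial\bar z_k$, etc.). $Z_\alpha$ is a local frame of $T^{1,0}M$, $Z_{\bar\alpha}=\overline{Z_\alpha}$. All formulas hold at points of $M$. "Nondegenerate" means Levi-nondegenerate. Levi--Fefferman determinant: $J(\varrho)=-\det\begin{pmatrix}\varrho&\varrho_{\bar k}\\ \varrho_j&\varrho_{j\bar k}\end{pmatrix}$. Operators: $$D^{\varrho}_{\alpha\bar\beta}=\partial_\alpha\partial_{\bar\beta}-\frac{\varrho_\alpha}{\varrho_w}\partial_w\partial_{\bar\beta}-\frac{\varrho_{\bar\beta}}{\varrho_{\bar w}}\partial_{\bar w}\partial_\alpha+\frac{\varrho_\alpha\varrho_{\bar\beta}}{|\varrho_w|^2}\partial_w\partial_{\bar w},\qquad D^{\varrho}_{\alpha\beta}=\partial_\alpha\partial_\beta-\frac{\varrho_\alpha}{\varrho_w}\partial_w\partial_\beta-\frac{\varrho_\beta}{\varrho_w}\partial_w\partial_\alpha+\frac{\varrho_\alpha\varrho_\beta}{\varrho_w^2}\partial_w^2,$$ $D^{\varrho}_{\bar\alpha\bar\beta}$ is the complex conjugate of $D^{\varrho}_{\alpha\beta}$,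 and $\mathcal{R}^{\varrho}_{\alpha\bar\beta\gamma\bar\sigma}(\varphi)=\sum_{j,k,l,m=1}^{n+1}Z_\alpha^jZ_{\bar\beta}^{\bar k}Z_\gamma^lZ_{\bar\sigma}^{\bar m}\,\varphi_{j\bar kl\bar m}$, where $Z_\alpha=Z_\alpha^j\partial_j$ and $Z_{\bar\beta}=Z_{\bar\beta}^{\bar k}\partial_{\bar k}$ (the fourth order derivative of $\varphi$ evaluated on the frame vectors). Levi matrix: $h_{\alpha\bar\beta}=-i\,d\theta(Z_\alpha,Z_{\bar\beta})=D^{\varrho}_{\alpha\bar\beta}(\varrho)$, with inverse $h^{\alpha\bar\beta}$. Also $h_{\alpha\beta}=D^{\varrho}_{\alpha\beta}(\varrho)$ and $h_{\bar\beta\bar\sigma}=\overline{h_{\beta\sigma}}$. $\xi=\xi^j\partial_j$ is the $(1,0)$ vector field with $\xi\,\rfloor\,i\partial\bar\partial\varrho=ir\,\bar\partial\varrho$ and $\partial\varrho(\xi)=1$ (i.e. $\varrho_{j\bar k}\xi^j=r\varrho_{\bar k}$ and $\varrho_j\xi^j=1$) for a function $r$; $\xi^{\bar k}=\overline{\xi^k}$, and $|\xi|^2=r=\varrho_{j\bar k}\xi^j\xi^{\bar k}$. With $\psi_{j\bar k}=\varrho_{j\bar k}+(1-r)\varrho_j\varrho_{\bar k}$, which is invertible, and $\psi^{j\bar k}$ its inverse, put $h^{j\bar k}=\psi^{j\bar k}-\xi^j\xi^{\bar k}$ for Latin indices (its Greek block is the inverse of the Levi matrix). $T$ is the real vector field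 on $M$ with $\theta(T)=1$ and $T\,\rfloor\,d\theta=0$. The Tanaka--Webster connection $\nabla$ of $(M,\theta)$ is the unique linear connection that preserves $T^{1,0}M$, has $\theta$ and $d\theta$ parallel, and whose torsion $\mathbb{T}_\nabla(X,Y)=\nabla_XY-\nabla_YX-[X,Y]$ satisfies $\mathbb{T}_\nabla(Z_\alpha,Z_\beta)=0$, $\mathbb{T}_\nabla(Z_\alpha,Z_{\bar\beta})=ih_{\alpha\bar\beta}T$ and $\mathbb{T}_\nabla(T,Z_\alpha)\in T^{0,1}M$. With $R(X,Y)Z=\nabla_X\nabla_YZ-\nabla_Y\nabla_XZ-\nabla_{[X,Y]}Z$, the pseudohermitian curvature is $R_{\alpha\bar\beta\gamma\bar\sigma}=\langle R(Z_\alpha,Z_{\bar\beta})Z_\gamma,Z_{\bar\sigma}\rangle$, where $\langle Z_\alpha,Z_{\bar\beta}\rangle=h_{\alpha\bar\beta}$ (complex bilinear). Put $R_{\gamma\bar\sigma}=h^{\alpha\bar\beta}R_{\alpha\bar\beta\gamma\bar\sigma}$ and $R=h^{\gamma\bar\sigma}R_{\gamma\bar\sigma}$. The Chern--Moser--Weyl tensor is the completely tracefree part $$S_{\alpha\bar\beta\gamma\bar\sigma}=R_{\alpha\bar\beta\gamma\bar\sigma}-\frac{R_{\alpha\bar\beta}h_{\gamma\bar\sigma}+R_{\gamma\bar\beta}h_{\alpha\bar\sigma}+R_{\alpha\bar\sigma}h_{\gamma\bar\beta}+R_{\gamma\bar\sigma}h_{\alpha\bar\beta}}{n+2}+\frac{R\,(h_{\alpha\bar\beta}h_{\gamma\bar\sigma}+h_{\alpha\bar\sigma}h_{\gamma\bar\beta})}{(n+1)(n+2)}.$$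 *)

theory Defs
  imports "HOL-Analysis.Analysis"
begin

section \<open>Smoothness and Wirtinger derivatives\<close>

primrec Ck_on :: "nat \<Rightarrow> 'a::real_normed_vector set \<Rightarrow> ('a \<Rightarrow> 'b::real_normed_vector) \<Rightarrow> bool" where
  "Ck_on 0 S f \<longleftrightarrow> continuous_on S f"
| "Ck_on (Suc k) S f \<longleftrightarrow>
     (\<forall>x\<in>S. f differentiable (at x)) \<and> (\<forall>v. Ck_on k S (\<lambda>x. frechet_derivative f (at x) v))"

text \<open>Only meant for open \<open>S\<close>.\<close>
definition smooth_on :: "'a::real_normed_vector set \<Rightarrow> ('a \<Rightarrow> 'b::real_normed_vector) \<Rightarrow> bool" where
  "smooth_on S f \<longleftrightarrow> (\<forall>k. Ck_on k S f)"

definition smooth_near :: "'a::real_normed_vector set \<Rightarrow> ('a \<Rightarrow> 'b::real_normed_vector) \<Rightarrow> bool" where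
  "smooth_near M f \<longleftrightarrow> (\<exists>W. open W \<and> M \<subseteq> W \<and> smooth_on W f)"

text \<open>\<open>wd j\<close> is the derivative with respect to \<open>z\<^sub>j\<close>, and \<open>wdb j\<close> the one with respect
  to the conjugate of \<open>z\<^sub>j\<close>.\<close>

definition wd :: "'m \<Rightarrow> (complex^'m::finite \<Rightarrow> complex) \<Rightarrow> complex^'m \<Rightarrow> complex" where
  "wd j f z = (frechet_derivative f (at z) (axis j 1) - \<i> * frechet_derivative f (at z) (axis j \<i>)) / 2"

definition wdb :: "'m \<Rightarrow> (complex^'m::finite \<Rightarrow> complex) \<Rightarrow> complex^'m \<Rightarrow> complex" where
  "wdb j f z = (frechet_derivative f (at z) (axis j 1) + \<i> * frechet_derivative f (at z) (axis j \<i>)) / 2"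

abbreviation cplx :: "('a \<Rightarrow> real) \<Rightarrow> 'a \<Rightarrow> complex" where
  "cplx f \<equiv> (\<lambda>z. complex_of_real (f z))"

section \<open>Complexified vector fields and forms\<close>

text \<open>A complexified tangent vector at a point of the ambient space is a vector indexed by
  \<open>'m + 'm\<close>: the component \<open>Inl j\<close> is the coefficient of \<open>\<partial>/\<partial>z\<^sub>j\<close>, the component \<open>Inr j\<close> the
  coefficient of \<open>\<partial>/\<partial>z\<^sub>j\<close> barred. It is real iff it is fixed by \<open>vconj\<close>.\<close>

type_synonym 'm field = "complex^'m \<Rightarrow> complex^('m + 'm)"

fun pd :: "'m + 'm \<Rightarrow> (complex^'m::finite \<Rightarrow> complex) \<Rightarrow> complex^'m \<Rightarrow> complex" where
  "pd (Inl j) = wd j"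
| "pd (Inr j) = wdb j"

definition vconj :: "complex^('m::finite + 'm) \<Rightarrow> complex^('m + 'm)" where
  "vconj X = (\<chi> A. cnj (X $ (case A of Inl j \<Rightarrow> Inr j | Inr j \<Rightarrow> Inl j)))"

definition vderiv :: "'m::finite field \<Rightarrow> (complex^'m \<Rightarrow> complex) \<Rightarrow> complex^'m \<Rightarrow> complex" where
  "vderiv X f z = (\<Sum>A\<in>UNIV. X z $ A * pd A f z)"

definition bracket :: "'m::finite field \<Rightarrow> 'm field \<Rightarrow> 'm field" where
  "bracket X Y z = (\<chi> A. vderiv X (\<lambda>x. Y x $ A) z - vderiv Y (\<lambda>x. X x $ A) z)"

definition form_eval :: "('m + 'm \<Rightarrow> complex^'m::finite \<Rightarrow> complex) \<Rightarrow>
    complex^'m \<Rightarrow> complex^('m + 'm) \<Rightarrow> complex" where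
  "form_eval \<omega> z X = (\<Sum>A\<in>UNIV. \<omega> A z * X $ A)"

text \<open>Normalised so that \<open>d\<omega>(X,Y) = X \<omega>(Y) - Y \<omega>(X) - \<omega>([X,Y])\<close>.\<close>
definition ext_deriv :: "('m + 'm \<Rightarrow> complex^'m::finite \<Rightarrow> complex) \<Rightarrow>
    complex^'m \<Rightarrow> complex^('m + 'm) \<Rightarrow> complex^('m + 'm) \<Rightarrow> complex" where
  "ext_deriv \<omega> z X Y =
     (\<Sum>A\<in>UNIV. \<Sum>B\<in>UNIV. pd A (\<omega> B) z * (X $ A * Y $ B - X $ B * Y $ A))"

section \<open>The pseudohermitian structure of a hypersurface\<close>

text \<open>Throughout, \<open>\<rho>\<close> is the defining function of \<open>M\<close>. The forms below live on the ambient
  space; pulling back to \<open>M\<close> means evaluating them at points of \<open>M\<close> on vectors in \<open>ctangent\<close>,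
  the complexified tangent space of \<open>M\<close>.\<close>

definition ctangent :: "(complex^'m::finite \<Rightarrow> real) \<Rightarrow> complex^'m \<Rightarrow> (complex^('m + 'm)) set" where
  "ctangent \<rho> z = {X. (\<Sum>A\<in>UNIV. X $ A * pd A (cplx \<rho>) z) = 0}"

definition T10 :: "(complex^'m::finite \<Rightarrow> real) \<Rightarrow> complex^'m \<Rightarrow> (complex^('m + 'm)) set" where
  "T10 \<rho> z = {X \<in> ctangent \<rho> z. \<forall>k. X $ Inr k = 0}"

definition T01 :: "(complex^'m::finite \<Rightarrow> real) \<Rightarrow> complex^'m \<Rightarrow> (complex^('m + 'm)) set" where
  "T01 \<rho> z = {X \<in> ctangent \<rho> z. \<forall>k. X $ Inl k = 0}"

text \<open>The coefficients of \<open>\<i>\<close> times the \<open>(0,1)\<close>-part of \<open>d\<rho>\<close>.\<close>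
fun theta_coeff :: "(complex^'m::finite \<Rightarrow> real) \<Rightarrow> 'm + 'm \<Rightarrow> complex^'m \<Rightarrow> complex" where
  "theta_coeff \<rho> (Inl j) = (\<lambda>z. 0)"
| "theta_coeff \<rho> (Inr k) = (\<lambda>z. \<i> * wdb k (cplx \<rho>) z)"

definition theta :: "(complex^'m::finite \<Rightarrow> real) \<Rightarrow> complex^'m \<Rightarrow> complex^('m + 'm) \<Rightarrow> complex" where
  "theta \<rho> = form_eval (theta_coeff \<rho>)"

definition dtheta :: "(complex^'m::finite \<Rightarrow> real) \<Rightarrow>
    complex^'m \<Rightarrow> complex^('m + 'm) \<Rightarrow> complex^('m + 'm) \<Rightarrow> complex" where
  "dtheta \<rho> = ext_deriv (theta_coeff \<rho>)"

text \<open>The complex bilinear pairing of a \<open>(1,0)\<close> with a \<open>(0,1)\<close> vector.\<close>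
definition levi_form :: "(complex^'m::finite \<Rightarrow> real) \<Rightarrow>
    complex^'m \<Rightarrow> complex^('m + 'm) \<Rightarrow> complex^('m + 'm) \<Rightarrow> complex" where
  "levi_form \<rho> z X Y = - \<i> * dtheta \<rho> z X Y"

definition levi_nondegenerate :: "(complex^'m::finite \<Rightarrow> real) \<Rightarrow> (complex^'m) set \<Rightarrow> bool" where
  "levi_nondegenerate \<rho> M \<longleftrightarrow>
     (\<forall>z\<in>M. \<forall>X\<in>T10 \<rho> z. (\<forall>Y\<in>T10 \<rho> z. levi_form \<rho> z X (vconj Y) = 0) \<longrightarrow> X = 0)"

text \<open>Smooth complexified vector fields on \<open>M\<close>, represented by smooth extensions to
  neighbourhoods of \<open>M\<close>; two representatives agreeing on \<open>M\<close> are the same field on \<open>M\<close>. As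
  \<open>M\<close> is an embedded submanifold, every smooth field (or function) on \<open>M\<close> has such an extension,
  and derivatives at points of \<open>M\<close> in directions tangent to \<open>M\<close> do not depend on it.\<close>
definition vfields :: "(complex^'m::finite \<Rightarrow> real) \<Rightarrow> (complex^'m) set \<Rightarrow> 'm field set" where
  "vfields \<rho> M = {X. smooth_near M X \<and> (\<forall>z\<in>M. X z \<in> ctangent \<rho> z)}"

definition vfields10 :: "(complex^'m::finite \<Rightarrow> real) \<Rightarrow> (complex^'m) set \<Rightarrow> 'm field set" where
  "vfields10 \<rho> M = {X \<in> vfields \<rho> M. \<forall>z\<in>M. X z \<in> T10 \<rho> z}"

definition reeb_field :: "(complex^'m::finite \<Rightarrow> real) \<Rightarrow> (complex^'m) set \<Rightarrow> 'm field \<Rightarrow> bool" where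
  "reeb_field \<rho> M T \<longleftrightarrow> T \<in> vfields \<rho> M \<and>
     (\<forall>z\<in>M. vconj (T z) = T z \<and> theta \<rho> z (T z) = 1 \<and>
             (\<forall>X\<in>ctangent \<rho> z. dtheta \<rho> z (T z) X = 0))"

section \<open>The Tanaka--Webster connection\<close>

text \<open>A linear connection on \<open>TM\<close>, extended complex bilinearly: the values of \<open>nabla X Y\<close> on \<open>M\<close>
  depend only on the fields on \<open>M\<close>, and the last conjunct says that it is real.\<close>
definition linear_connection :: "(complex^'m::finite \<Rightarrow> real) \<Rightarrow> (complex^'m) set \<Rightarrow>
    ('m field \<Rightarrow> 'm field \<Rightarrow> 'm field) \<Rightarrow> bool" where
  "linear_connection \<rho> M nabla \<longleftrightarrow>
     (\<forall>X\<in>vfields \<rho> M. \<forall>Y\<in>vfields \<rho> M. nabla X Y \<in> vfields \<rho> M) \<and>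
     (\<forall>X\<in>vfields \<rho> M. \<forall>X'\<in>vfields \<rho> M. \<forall>Y\<in>vfields \<rho> M. \<forall>Y'\<in>vfields \<rho> M.
        (\<forall>z\<in>M. X z = X' z \<and> Y z = Y' z) \<longrightarrow> (\<forall>z\<in>M. nabla X Y z = nabla X' Y' z)) \<and>
     (\<forall>X\<in>vfields \<rho> M. \<forall>X'\<in>vfields \<rho> M. \<forall>Y\<in>vfields \<rho> M. \<forall>z\<in>M.
        nabla (\<lambda>x. X x + X' x) Y z = nabla X Y z + nabla X' Y z) \<and>
     (\<forall>f. smooth_near M f \<longrightarrow> (\<forall>X\<in>vfields \<rho> M. \<forall>Y\<in>vfields \<rho> M. \<forall>z\<in>M.
        nabla (\<lambda>x. f x *s X x) Y z = f z *s nabla X Y z)) \<and>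
     (\<forall>X\<in>vfields \<rho> M. \<forall>Y\<in>vfields \<rho> M. \<forall>Y'\<in>vfields \<rho> M. \<forall>z\<in>M.
        nabla X (\<lambda>x. Y x + Y' x) z = nabla X Y z + nabla X Y' z) \<and>
     (\<forall>f. smooth_near M f \<longrightarrow> (\<forall>X\<in>vfields \<rho> M. \<forall>Y\<in>vfields \<rho> M. \<forall>z\<in>M.
        nabla X (\<lambda>x. f x *s Y x) z = vderiv X f z *s Y z + f z *s nabla X Y z)) \<and>
     (\<forall>X\<in>vfields \<rho> M. \<forall>Y\<in>vfields \<rho> M. \<forall>z\<in>M.
        nabla (\<lambda>x. vconj (X x)) (\<lambda>x. vconj (Y x)) z = vconj (nabla X Y z))"

definition torsion :: "('m::finite field \<Rightarrow> 'm field \<Rightarrow> 'm field) \<Rightarrow> 'm field \<Rightarrow> 'm field \<Rightarrow> 'm field" where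
  "torsion nabla X Y z = nabla X Y z - nabla Y X z - bracket X Y z"

definition curv :: "('m::finite field \<Rightarrow> 'm field \<Rightarrow> 'm field) \<Rightarrow>
    'm field \<Rightarrow> 'm field \<Rightarrow> 'm field \<Rightarrow> 'm field" where
  "curv nabla X Y V z =
     nabla X (nabla Y V) z - nabla Y (nabla X V) z - nabla (bracket X Y) V z"

text \<open>The torsion is tensorial, so imposing the torsion conditions on all \<open>(1,0)\<close> fields is
  the same as imposing them on a frame of \<open>(1,0)\<close> fields.\<close>
definition tanaka_webster :: "(complex^'m::finite \<Rightarrow> real) \<Rightarrow> (complex^'m) set \<Rightarrow> 'm field \<Rightarrow>
    ('m field \<Rightarrow> 'm field \<Rightarrow> 'm field) \<Rightarrow> bool" where
  "tanaka_webster \<rho> M T nabla \<longleftrightarrow>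
     linear_connection \<rho> M nabla \<and>
     (\<forall>X\<in>vfields \<rho> M. \<forall>Z\<in>vfields10 \<rho> M. \<forall>z\<in>M. nabla X Z z \<in> T10 \<rho> z) \<and>
     (\<forall>X\<in>vfields \<rho> M. \<forall>Y\<in>vfields \<rho> M. \<forall>z\<in>M.
        vderiv X (\<lambda>x. theta \<rho> x (Y x)) z = theta \<rho> z (nabla X Y z)) \<and>
     (\<forall>X\<in>vfields \<rho> M. \<forall>Y\<in>vfields \<rho> M. \<forall>V\<in>vfields \<rho> M. \<forall>z\<in>M.
        vderiv X (\<lambda>x. dtheta \<rho> x (Y x) (V x)) z =
          dtheta \<rho> z (nabla X Y z) (V z) + dtheta \<rho> z (Y z) (nabla X V z)) \<and>
     (\<forall>Z\<in>vfields10 \<rho> M. \<forall>V\<in>vfields10 \<rho> M. \<forall>z\<in>M.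
        torsion nabla Z V z = 0 \<and>
        torsion nabla Z (\<lambda>x. vconj (V x)) z = (\<i> * levi_form \<rho> z (Z z) (vconj (V z))) *s T z \<and>
        torsion nabla T Z z \<in> T01 \<rho> z)"

section \<open>Coordinate expressions\<close>

text \<open>Latin indices range over \<open>'n option\<close> and Greek ones over \<open>'n\<close>: the coordinate
  \<open>w\<close> is the one indexed by \<open>None\<close>, and \<open>z\<^sub>\<alpha>\<close> is the one indexed by \<open>Some \<alpha>\<close>.\<close>

definition levi_fefferman :: "(complex^'m::finite \<Rightarrow> real) \<Rightarrow> complex^'m \<Rightarrow> complex" where
  "levi_fefferman \<rho> z = - det ((\<chi> a b.
     case a of
       None \<Rightarrow> (case b of None \<Rightarrow> cplx \<rho> z | Some k \<Rightarrow> wdb k (cplx \<rho>) z)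
     | Some j \<Rightarrow> (case b of None \<Rightarrow> wd j (cplx \<rho>) z | Some k \<Rightarrow> wd j (wdb k (cplx \<rho>)) z))
     :: complex^('m option)^('m option))"

text \<open>\<open>J(\<rho>)\<close> is real-valued but may be negative, depending on the signature of the Levi form; its
  logarithm, which is only ever differentiated, is the one of the absolute value.\<close>
definition log_levi_fefferman :: "(complex^'m::finite \<Rightarrow> real) \<Rightarrow> complex^'m \<Rightarrow> complex" where
  "log_levi_fefferman \<rho> z = complex_of_real (ln (cmod (levi_fefferman \<rho> z)))"

definition D_mixed :: "(complex^('n::finite option) \<Rightarrow> real) \<Rightarrow> 'n \<Rightarrow> 'n \<Rightarrow>
    (complex^('n option) \<Rightarrow> complex) \<Rightarrow> complex^('n option) \<Rightarrow> complex" where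
  "D_mixed \<rho> \<alpha> \<beta> f z =
     (let \<rho>\<alpha> = wd (Some \<alpha>) (cplx \<rho>) z; \<rho>w = wd None (cplx \<rho>) z;
          \<rho>\<beta>b = wdb (Some \<beta>) (cplx \<rho>) z; \<rho>wb = wdb None (cplx \<rho>) z
      in wd (Some \<alpha>) (wdb (Some \<beta>) f) z
         - \<rho>\<alpha> / \<rho>w * wd None (wdb (Some \<beta>) f) z
         - \<rho>\<beta>b / \<rho>wb * wdb None (wd (Some \<alpha>) f) z
         + \<rho>\<alpha> * \<rho>\<beta>b / complex_of_real ((cmod \<rho>w)\<^sup>2) * wd None (wdb None f) z)"

definition D_holo :: "(complex^('n::finite option) \<Rightarrow> real) \<Rightarrow> 'n \<Rightarrow> 'n \<Rightarrow>
    (complex^('n option) \<Rightarrow> complex) \<Rightarrow> complex^('n option) \<Rightarrow> complex" where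
  "D_holo \<rho> \<alpha> \<beta> f z =
     (let \<rho>\<alpha> = wd (Some \<alpha>) (cplx \<rho>) z; \<rho>\<beta> = wd (Some \<beta>) (cplx \<rho>) z; \<rho>w = wd None (cplx \<rho>) z
      in wd (Some \<alpha>) (wd (Some \<beta>) f) z
         - \<rho>\<alpha> / \<rho>w * wd None (wd (Some \<beta>) f) z
         - \<rho>\<beta> / \<rho>w * wd None (wd (Some \<alpha>) f) z
         + \<rho>\<alpha> * \<rho>\<beta> / \<rho>w\<^sup>2 * wd None (wd None f) z)"

text \<open>The complex conjugate operator of \<open>D_holo\<close>.\<close>
definition D_anti :: "(complex^('n::finite option) \<Rightarrow> real) \<Rightarrow> 'n \<Rightarrow> 'n \<Rightarrow>
    (complex^('n option) \<Rightarrow> complex) \<Rightarrow> complex^('n option) \<Rightarrow> complex" where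
  "D_anti \<rho> \<alpha> \<beta> f z = cnj (D_holo \<rho> \<alpha> \<beta> (\<lambda>x. cnj (f x)) z)"

definition frame :: "(complex^('n::finite option) \<Rightarrow> real) \<Rightarrow> 'n \<Rightarrow> 'n option field" where
  "frame \<rho> \<alpha> z = axis (Inl (Some \<alpha>)) 1
     - (wd (Some \<alpha>) (cplx \<rho>) z / wd None (cplx \<rho>) z) *s axis (Inl None) 1"

definition frameb :: "(complex^('n::finite option) \<Rightarrow> real) \<Rightarrow> 'n \<Rightarrow> 'n option field" where
  "frameb \<rho> \<alpha> z = vconj (frame \<rho> \<alpha> z)"

definition fourth_order :: "(complex^('n::finite option) \<Rightarrow> real) \<Rightarrow> 'n \<Rightarrow> 'n \<Rightarrow> 'n \<Rightarrow> 'n \<Rightarrow>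
    (complex^('n option) \<Rightarrow> complex) \<Rightarrow> complex^('n option) \<Rightarrow> complex" where
  "fourth_order \<rho> \<alpha> \<beta> \<gamma> \<sigma> \<phi> z =
     (\<Sum>j\<in>UNIV. \<Sum>k\<in>UNIV. \<Sum>l\<in>UNIV. \<Sum>m\<in>UNIV.
        frame \<rho> \<alpha> z $ Inl j * frameb \<rho> \<beta> z $ Inr k * frame \<rho> \<gamma> z $ Inl l * frameb \<rho> \<sigma> z $ Inr m
        * wd j (wdb k (wd l (wdb m \<phi>))) z)"

text \<open>\<open>upper H\<close> raises indices: \<open>upper H a b\<close> is \<open>h\<^sup>a\<^sup>b\<close> (second index barred), characterised by
  \<open>(\<Sum>b. upper H a b * H $ c $ b) = (if a = c then 1 else 0)\<close>; hence the transposition.\<close>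
definition upper :: "complex^'i^'i::finite \<Rightarrow> 'i \<Rightarrow> 'i \<Rightarrow> complex" where
  "upper H a b = matrix_inv H $ b $ a"

definition levi :: "(complex^('n::finite option) \<Rightarrow> real) \<Rightarrow> complex^('n option) \<Rightarrow> 'n \<Rightarrow> 'n \<Rightarrow> complex" where
  "levi \<rho> z \<alpha> \<beta> = levi_form \<rho> z (frame \<rho> \<alpha> z) (frameb \<rho> \<beta> z)"

definition levi_upper :: "(complex^('n::finite option) \<Rightarrow> real) \<Rightarrow> complex^('n option) \<Rightarrow> 'n \<Rightarrow> 'n \<Rightarrow> complex" where
  "levi_upper \<rho> z = upper (\<chi> \<alpha> \<beta>. levi \<rho> z \<alpha> \<beta>)"

definition h_holo :: "(complex^('n::finite option) \<Rightarrow> real) \<Rightarrow> complex^('n option) \<Rightarrow> 'n \<Rightarrow> 'n \<Rightarrow> complex" where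
  "h_holo \<rho> z \<alpha> \<beta> = D_holo \<rho> \<alpha> \<beta> (cplx \<rho>) z"

definition h_anti :: "(complex^('n::finite option) \<Rightarrow> real) \<Rightarrow> complex^('n option) \<Rightarrow> 'n \<Rightarrow> 'n \<Rightarrow> complex" where
  "h_anti \<rho> z \<alpha> \<beta> = cnj (h_holo \<rho> z \<alpha> \<beta>)"

definition transverse_field :: "(complex^'m::finite \<Rightarrow> real) \<Rightarrow> (complex^'m) set \<Rightarrow>
    (complex^'m \<Rightarrow> complex^'m) \<Rightarrow> (complex^'m \<Rightarrow> complex) \<Rightarrow> bool" where
  "transverse_field \<rho> M \<xi> r \<longleftrightarrow>
     (\<forall>z\<in>M. (\<forall>k. (\<Sum>j\<in>UNIV. wd j (wdb k (cplx \<rho>)) z * \<xi> z $ j) = r z * wdb k (cplx \<rho>) z) \<and>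
             (\<Sum>j\<in>UNIV. wd j (cplx \<rho>) z * \<xi> z $ j) = 1)"

definition xi_norm2 :: "(complex^'m::finite \<Rightarrow> real) \<Rightarrow> (complex^'m \<Rightarrow> complex^'m) \<Rightarrow> complex^'m \<Rightarrow> complex" where
  "xi_norm2 \<rho> \<xi> z =
     (\<Sum>j\<in>UNIV. \<Sum>k\<in>UNIV. wd j (wdb k (cplx \<rho>)) z * \<xi> z $ j * cnj (\<xi> z $ k))"

definition psi :: "(complex^'m::finite \<Rightarrow> real) \<Rightarrow> (complex^'m \<Rightarrow> complex) \<Rightarrow> complex^'m \<Rightarrow> complex^'m^'m" where
  "psi \<rho> r z = (\<chi> j k. wd j (wdb k (cplx \<rho>)) z
                        + (1 - r z) * wd j (cplx \<rho>) z * wdb k (cplx \<rho>) z)"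

definition h_latin :: "(complex^'m::finite \<Rightarrow> real) \<Rightarrow> (complex^'m \<Rightarrow> complex^'m) \<Rightarrow>
    (complex^'m \<Rightarrow> complex) \<Rightarrow> complex^'m \<Rightarrow> 'm \<Rightarrow> 'm \<Rightarrow> complex" where
  "h_latin \<rho> \<xi> r z j k = upper (psi \<rho> r z) j k - \<xi> z $ j * cnj (\<xi> z $ k)"

section \<open>Curvature tensors\<close>

definition psh_curvature :: "(complex^('n::finite option) \<Rightarrow> real) \<Rightarrow>
    ('n option field \<Rightarrow> 'n option field \<Rightarrow> 'n option field) \<Rightarrow>
    complex^('n option) \<Rightarrow> 'n \<Rightarrow> 'n \<Rightarrow> 'n \<Rightarrow> 'n \<Rightarrow> complex" where
  "psh_curvature \<rho> nabla z \<alpha> \<beta> \<gamma> \<sigma> =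
     levi_form \<rho> z (curv nabla (frame \<rho> \<alpha>) (frameb \<rho> \<beta>) (frame \<rho> \<gamma>) z) (frameb \<rho> \<sigma> z)"

definition psh_ricci :: "(complex^('n::finite option) \<Rightarrow> real) \<Rightarrow>
    ('n option field \<Rightarrow> 'n option field \<Rightarrow> 'n option field) \<Rightarrow>
    complex^('n option) \<Rightarrow> 'n \<Rightarrow> 'n \<Rightarrow> complex" where
  "psh_ricci \<rho> nabla z \<gamma> \<sigma> =
     (\<Sum>\<alpha>\<in>UNIV. \<Sum>\<beta>\<in>UNIV. levi_upper \<rho> z \<alpha> \<beta> * psh_curvature \<rho> nabla z \<alpha> \<beta> \<gamma> \<sigma>)"

definition psh_scalar :: "(complex^('n::finite option) \<Rightarrow> real) \<Rightarrow>
    ('n option field \<Rightarrow> 'n option field \<Rightarrow> 'n option field) \<Rightarrow> complex^('n option) \<Rightarrow> complex" where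
  "psh_scalar \<rho> nabla z =
     (\<Sum>\<gamma>\<in>UNIV. \<Sum>\<sigma>\<in>UNIV. levi_upper \<rho> z \<gamma> \<sigma> * psh_ricci \<rho> nabla z \<gamma> \<sigma>)"

definition chern_moser_weyl :: "(complex^('n::finite option) \<Rightarrow> real) \<Rightarrow>
    ('n option field \<Rightarrow> 'n option field \<Rightarrow> 'n option field) \<Rightarrow>
    complex^('n option) \<Rightarrow> 'n \<Rightarrow> 'n \<Rightarrow> 'n \<Rightarrow> 'n \<Rightarrow> complex" where
  "chern_moser_weyl \<rho> nabla z \<alpha> \<beta> \<gamma> \<sigma> =
     psh_curvature \<rho> nabla z \<alpha> \<beta> \<gamma> \<sigma>
     - (psh_ricci \<rho> nabla z \<alpha> \<beta> * levi \<rho> z \<gamma> \<sigma> + psh_ricci \<rho> nabla z \<gamma> \<beta> * levi \<rho> z \<alpha> \<sigma>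
        + psh_ricci \<rho> nabla z \<alpha> \<sigma> * levi \<rho> z \<gamma> \<beta> + psh_ricci \<rho> nabla z \<gamma> \<sigma> * levi \<rho> z \<alpha> \<beta>)
       / of_nat (CARD('n) + 2)
     + psh_scalar \<rho> nabla z * (levi \<rho> z \<alpha> \<beta> * levi \<rho> z \<gamma> \<sigma> + levi \<rho> z \<alpha> \<sigma> * levi \<rho> z \<gamma> \<beta>)
       / of_nat ((CARD('n) + 1) * (CARD('n) + 2))"

end

theory Submission
  imports Defs
begin

text \<open>
  At a point of \<open>M\<close> all quantities in the theorem are contractions of partial derivatives of the
  defining function \<open>\<rho>\<close> with the frame \<open>Z\<^sub>\<alpha>\<close> and with \<open>\<xi>\<close>. The defining properties of the
  Tanaka--Webster connection determine it on the frame. Put \<open>N = \<rho>\<^sub>w\<^sup>-\<^sup>1 \<partial>\<^sub>w\<close>, so that the bracket of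
  \<open>Z\<^sub>\<alpha>\<close> and the conjugate of \<open>Z\<^sub>\<beta>\<close> is the Levi form times the difference of \<open>N\<close> and its conjugate,
  and \<open>\<eta> = \<xi> - N\<close>, which is tangent to \<open>M\<close>; the Reeb field is \<open>\<i>\<close> times the difference of \<open>\<xi>\<close>
  and its conjugate.
  The mixed torsion gives the derivative of \<open>Z\<^sub>\<gamma>\<close> along the conjugate of \<open>Z\<^sub>\<beta>\<close> as a multiple of
  \<open>\<eta>\<close> (\<open>nabla_frameb_frame\<close>). Parallelism of the Levi form then gives the derivative along \<open>Z\<^sub>\<alpha>\<close>
  (\<open>nabla_frame_frame\<close>), and the torsion with the Reeb field gives the derivative along the Reeb
  field (\<open>nabla_T_frame\<close>).

  In the curvature the derivatives of these expressions produce the fourth order term and third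
  order terms; those involving \<open>N\<close> cancel against the bracket term or combine with \<open>\<eta>\<close> into
  contractions with \<open>\<xi>\<close>. What remains is the Levi pairing of the derivative of \<open>Z\<^sub>\<gamma>\<close> along
  \<open>Z\<^sub>\<alpha>\<close> with the conjugate of the derivative of \<open>Z\<^sub>\<sigma>\<close> along \<open>Z\<^sub>\<beta>\<close> (\<open>curvature_frame\<close>). Expanding
  it with the inverse Levi matrix gives the first formula (\<open>curvature_formula\<close>), because the
  ambient tensor with Latin indices is that inverse, written in coordinates (\<open>h_latin_eq\<close>).

  The Chern--Moser--Weyl tensor is obtained by subtracting traces, so the second formula is an
  algebraic consequence of the first and of the Ricci formula, by which the Ricci tensor equals
  \<open>(n + 1) |\<xi>|\<^sup>2\<close> times the Levi form minus the operator \<open>D\<close> applied to \<open>log |J|\<close>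
  (\<open>ricci_formula\<close>). Here \<open>J\<close> is, up to sign, the determinant of a bordered Hessian, and the second
  derivatives of \<open>log |det \<Phi>|\<close> are \<open>tr (\<Phi>\<^sup>-\<^sup>1 \<partial>\<partial>\<Phi>) - tr (\<Phi>\<^sup>-\<^sup>1 \<partial>\<Phi> \<Phi>\<^sup>-\<^sup>1 \<partial>\<Phi>)\<close>. On \<open>M\<close> the inverse of the
  bordered Hessian is explicit in terms of \<open>\<xi>\<close> and of the inverse Levi matrix (\<open>upper_Phi\<close>), and
  the resulting expression (\<open>D_log\<close>) is recognised in the trace of the curvature.

  Vector fields on \<open>M\<close> are given by extensions, and many identities hold on \<open>M\<close> only. They may be
  differentiated in tangential directions by \<open>vderiv_zero_set\<close>.
\<close>

section \<open>Smooth functions\<close>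

lemma Ck_on_Suc_imp: "Ck_on (Suc k) S f \<Longrightarrow> Ck_on k S f"
proof (induction k arbitrary: f)
  case 0
  then show ?case
    by (auto intro!: continuous_at_imp_continuous_on differentiable_imp_continuous_within)
qed auto

lemma Ck_on_subset: "Ck_on k S f \<Longrightarrow> S' \<subseteq> S \<Longrightarrow> Ck_on k S' f"
  by (induction k arbitrary: f) (auto intro: continuous_on_subset)

lemma frechet_eq: "(f has_derivative F) (at x) \<Longrightarrow> frechet_derivative f (at x) = F"
  using frechet_derivative_at by metis

lemma frechet_derivative_worksI: "f differentiable F \<Longrightarrow> (f has_derivative frechet_derivative f F) F"
  by (simp add: frechet_derivative_works)

lemma Ck_on_cong:
  assumes "open S" "Ck_on k S f" "\<And>x. x \<in> S \<Longrightarrow> f x = g x"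
  shows "Ck_on k S g"
  using assms(2,3)
proof (induction k arbitrary: f g)
  case 0
  then show ?case by (auto cong: continuous_on_cong)
next
  case (Suc k)
  have d: "f differentiable (at x)" if "x \<in> S" for x using Suc.prems that by auto
  have D: "(g has_derivative frechet_derivative f (at x)) (at x)" if "x \<in> S" for x
    using has_derivative_transform_within_open[OF frechet_derivative_worksI[OF d[OF that]] \<open>open S\<close> that]
      Suc.prems(2) by auto
  show ?case
    using Suc.IH[of "\<lambda>x. frechet_derivative f (at x) v" "\<lambda>x. frechet_derivative g (at x) v" for v]
      Suc.prems(1) frechet_eq[OF D] D
    by (auto simp: differentiable_def)
qed

text \<open>The closure properties of smooth functions are inductions on the order in which this rule is
  the step: the derivative computed by the usual rules is of one order less by the induction
  hypothesis.\<close>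
lemma Ck_on_SucI:
  assumes "open S" "\<And>x. x \<in> S \<Longrightarrow> (f has_derivative F x) (at x)" "\<And>v. Ck_on k S (\<lambda>x. F x v)"
  shows "Ck_on (Suc k) S f"
  using assms(2) frechet_eq[OF assms(2)]
  by (auto simp: differentiable_def intro!: Ck_on_cong[OF assms(1) assms(3)])

lemma Ck_on_const: "Ck_on k S (\<lambda>x. c)"
  by (induction k arbitrary: c) auto

lemma Ck_on_linear:
  assumes "bounded_linear L" "open S" "Ck_on k S f"
  shows "Ck_on k S (\<lambda>x. L (f x))"
  using assms(3)
proof (induction k arbitrary: f)
  case 0
  then show ?case using assms(1) by (auto intro: bounded_linear.continuous_on)
next
  case (Suc k)
  show ?case
    by (rule Ck_on_SucI[OF assms(2) bounded_linear.has_derivative[OF assms(1)]])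
      (use Suc in \<open>auto intro: frechet_derivative_worksI\<close>)
qed

lemma Ck_on_add:
  assumes "open S" "Ck_on k S f" "Ck_on k S g"
  shows "Ck_on k S (\<lambda>x. f x + g x)"
  using assms(2,3)
proof (induction k arbitrary: f g)
  case 0
  then show ?case by (auto intro: continuous_intros)
next
  case (Suc k)
  show ?case
    by (rule Ck_on_SucI[OF assms(1) has_derivative_add])
      (use Suc in \<open>auto intro: frechet_derivative_worksI\<close>)
qed

lemma Ck_on_bilinear:
  assumes "bounded_bilinear B" "open S" "Ck_on k S f" "Ck_on k S g"
  shows "Ck_on k S (\<lambda>x. B (f x) (g x))"
  using assms(3,4)
proof (induction k arbitrary: f g)
  case 0
  then show ?case using assms(1) by (auto intro: bounded_bilinear.continuous_on)
next
  case (Suc k)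
  have "Ck_on k S f" "Ck_on k S g" using Suc.prems Ck_on_Suc_imp by blast+
  then have "Ck_on k S (\<lambda>x. B (f x) (frechet_derivative g (at x) v) + B (frechet_derivative f (at x) v) (g x))" for v
    using Suc.prems by (intro Ck_on_add Suc.IH assms) auto
  then show ?case
    by (rule Ck_on_SucI[OF assms(2) bounded_bilinear.FDERIV[OF assms(1)], rotated 2])
      (use Suc.prems in \<open>auto intro: frechet_derivative_worksI\<close>)
qed

lemma Ck_on_inverse:
  fixes f :: "'a::real_normed_vector \<Rightarrow> complex"
  assumes "open S" "Ck_on k S f" "\<And>x. x \<in> S \<Longrightarrow> f x \<noteq> 0"
  shows "Ck_on k S (\<lambda>x. inverse (f x))"
  using assms(2)
proof (induction k)
  case 0
  then show ?case using assms(3) by (auto intro: continuous_intros)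
next
  case (Suc k)
  have i: "Ck_on k S (\<lambda>x. inverse (f x))" using Suc Ck_on_Suc_imp by blast
  have "Ck_on k S (\<lambda>x. - (inverse (f x) * frechet_derivative f (at x) v * inverse (f x)))" for v
    using Suc.prems i
    by (intro Ck_on_linear[OF bounded_linear_minus[OF bounded_linear_ident]]
        Ck_on_bilinear[OF bounded_bilinear_mult] assms) auto
  then show ?case
    by (rule Ck_on_SucI[OF assms(1) Deriv.has_derivative_inverse, rotated 2])
      (use Suc.prems assms(3) in \<open>auto intro: frechet_derivative_worksI\<close>)
qed

lemma smooth_on_subset: "smooth_on S f \<Longrightarrow> S' \<subseteq> S \<Longrightarrow> smooth_on S' f"
  unfolding smooth_on_def using Ck_on_subset by blast

lemma smooth_on_cong: "open S \<Longrightarrow> smooth_on S f \<Longrightarrow> (\<And>x. x \<in> S \<Longrightarrow> f x = g x) \<Longrightarrow> smooth_on S g"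
  unfolding smooth_on_def using Ck_on_cong by blast

lemma smooth_on_const [simp]: "smooth_on S (\<lambda>x. c)"
  unfolding smooth_on_def using Ck_on_const by blast

lemma smooth_on_add: "open S \<Longrightarrow> smooth_on S f \<Longrightarrow> smooth_on S g \<Longrightarrow> smooth_on S (\<lambda>x. f x + g x)"
  unfolding smooth_on_def using Ck_on_add by blast

lemma smooth_on_linear: "bounded_linear L \<Longrightarrow> open S \<Longrightarrow> smooth_on S f \<Longrightarrow> smooth_on S (\<lambda>x. L (f x))"
  unfolding smooth_on_def using Ck_on_linear by blast

lemma smooth_on_mult:
  fixes f g :: "'a::real_normed_vector \<Rightarrow> complex"
  shows "open S \<Longrightarrow> smooth_on S f \<Longrightarrow> smooth_on S g \<Longrightarrow> smooth_on S (\<lambda>x. f x * g x)"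
  unfolding smooth_on_def using Ck_on_bilinear[OF bounded_bilinear_mult] by blast

lemma smooth_on_minus: "open S \<Longrightarrow> smooth_on S f \<Longrightarrow> smooth_on S (\<lambda>x. - f x)"
  by (rule smooth_on_linear[OF bounded_linear_minus[OF bounded_linear_ident]])

lemma smooth_on_diff: "open S \<Longrightarrow> smooth_on S f \<Longrightarrow> smooth_on S g \<Longrightarrow> smooth_on S (\<lambda>x. f x - g x)"
  using smooth_on_add[OF _ _ smooth_on_minus, of S f g] by simp

lemma smooth_on_divide:
  fixes f g :: "'a::real_normed_vector \<Rightarrow> complex"
  assumes "open S" "smooth_on S f" "smooth_on S g" "\<And>x. x \<in> S \<Longrightarrow> g x \<noteq> 0"
  shows "smooth_on S (\<lambda>x. f x / g x)"
proof -
  have "smooth_on S (\<lambda>x. inverse (g x))"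
    using assms Ck_on_inverse unfolding smooth_on_def by blast
  from smooth_on_mult[OF assms(1,2) this] show ?thesis by (simp add: divide_inverse)
qed

lemma smooth_on_sum:
  "open S \<Longrightarrow> (\<And>i. i \<in> I \<Longrightarrow> smooth_on S (f i)) \<Longrightarrow> smooth_on S (\<lambda>x. \<Sum>i\<in>I. f i x)"
  by (induction I rule: infinite_finite_induct) (auto intro: smooth_on_add)

lemma smooth_on_prod:
  fixes f :: "'i \<Rightarrow> 'a::real_normed_vector \<Rightarrow> complex"
  shows "open S \<Longrightarrow> (\<And>i. i \<in> I \<Longrightarrow> smooth_on S (f i)) \<Longrightarrow> smooth_on S (\<lambda>x. \<Prod>i\<in>I. f i x)"
  by (induction I rule: infinite_finite_induct) (auto intro: smooth_on_mult)

lemma smooth_on_cnj: "open S \<Longrightarrow> smooth_on S f \<Longrightarrow> smooth_on S (\<lambda>x. cnj (f x))"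
  by (rule smooth_on_linear[OF bounded_linear_cnj])

lemma smooth_on_of_real: "open S \<Longrightarrow> smooth_on S f \<Longrightarrow> smooth_on S (\<lambda>x. complex_of_real (f x))"
  by (rule smooth_on_linear[OF bounded_linear_of_real])

lemma smooth_on_nth: "open S \<Longrightarrow> smooth_on S f \<Longrightarrow> smooth_on S (\<lambda>x. (f x :: complex^'k::finite) $ i)"
  by (rule smooth_on_linear[OF bounded_linear_vec_nth])

lemma bounded_linear_axis: "bounded_linear (axis i :: complex \<Rightarrow> complex^'k::finite)"
  by (auto simp: linear_conv_bounded_linear[symmetric] linear_iff vec_eq_iff axis_def)

lemma smooth_on_vec:
  assumes "open S" "\<And>i. smooth_on S (\<lambda>x. (f x :: complex^'k::finite) $ i)"
  shows "smooth_on S f"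
proof -
  have "f x = (\<Sum>i\<in>UNIV. axis i (f x $ i))" for x
    by (simp add: vec_eq_iff axis_def if_distrib cong: if_cong)
  moreover have "smooth_on S (\<lambda>x. \<Sum>i\<in>UNIV. axis i (f x $ i))"
    using assms by (intro smooth_on_sum smooth_on_linear[OF bounded_linear_axis]) auto
  ultimately show ?thesis by simp
qed

lemma smooth_on_frechet:
  assumes "smooth_on S f" shows "smooth_on S (\<lambda>x. frechet_derivative f (at x) v)"
proof -
  have "Ck_on (Suc k) S f" for k using assms by (simp only: smooth_on_def)
  then show ?thesis by (simp add: smooth_on_def)
qed

lemma smooth_on_differentiable:
  assumes "smooth_on S f" "x \<in> S" shows "f differentiable (at x)"
proof -
  have "Ck_on (Suc 0) S f" using assms(1) by (simp only: smooth_on_def)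
  then show ?thesis using assms(2) by simp
qed

lemma smooth_on_continuous: "smooth_on S f \<Longrightarrow> continuous_on S f"
  using Ck_on.simps(1) smooth_on_def by blast

section \<open>Wirtinger derivatives\<close>

text \<open>The Wirtinger derivatives are complex linear functionals of the real Frechet derivative,
  so they inherit its rules.\<close>
fun wirt :: "'m + 'm \<Rightarrow> (complex^'m::finite \<Rightarrow> complex) \<Rightarrow> complex" where
  "wirt (Inl j) F = (F (axis j 1) - \<i> * F (axis j \<i>)) / 2"
| "wirt (Inr j) F = (F (axis j 1) + \<i> * F (axis j \<i>)) / 2"

abbreviation (input) swap_sum :: "'m + 'm \<Rightarrow> 'm + 'm" where
  "swap_sum A \<equiv> (case A of Inl j \<Rightarrow> Inr j | Inr j \<Rightarrow> Inl j)"

lemma pd_eq_wirt: "pd A f z = wirt A (frechet_derivative f (at z))"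
  by (cases A) (auto simp: wd_def wdb_def)

lemma pd_has_derivative: "(f has_derivative F) (at z) \<Longrightarrow> pd A f z = wirt A F"
  by (simp add: pd_eq_wirt frechet_eq)

lemma pd_cong:
  assumes "open S" "z \<in> S" "\<And>x. x \<in> S \<Longrightarrow> f x = g x" "f differentiable at z"
  shows "pd A f z = pd A g z"
  unfolding pd_eq_wirt
  using frechet_derivative_transform_within_open[OF assms(4,1,2)] assms(3) by metis

lemma pd_const [simp]: "pd A (\<lambda>x. c) z = 0"
  unfolding pd_eq_wirt by (cases A) auto

lemma wirt_add: "wirt A (\<lambda>x. F x + G x) = wirt A F + wirt A G"
  and wirt_minus: "wirt A (\<lambda>x. - F x) = - wirt A F"
  and wirt_diff: "wirt A (\<lambda>x. F x - G x) = wirt A F - wirt A G"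
  and wirt_scale: "wirt A (\<lambda>x. c * F x) = c * wirt A F" "wirt A (\<lambda>x. F x * c) = wirt A F * c"
  by (cases A; simp add: field_simps)+

lemma pd_add:
  assumes "f differentiable at z" "g differentiable at z"
  shows "pd A (\<lambda>x. f x + g x) z = pd A f z + pd A g z"
  unfolding pd_has_derivative[OF has_derivative_add[OF assms[THEN frechet_derivative_worksI]]]
  unfolding wirt_add pd_eq_wirt ..

lemma pd_minus:
  assumes "f differentiable at z"
  shows "pd A (\<lambda>x. - f x) z = - pd A f z"
  unfolding pd_has_derivative[OF has_derivative_minus[OF assms[THEN frechet_derivative_worksI]]]
  unfolding wirt_minus pd_eq_wirt ..

lemma pd_diff:
  assumes "f differentiable at z" "g differentiable at z"
  shows "pd A (\<lambda>x. f x - g x) z = pd A f z - pd A g z"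
  unfolding pd_has_derivative[OF has_derivative_diff[OF assms[THEN frechet_derivative_worksI]]]
  unfolding wirt_diff pd_eq_wirt ..

lemma pd_mult:
  assumes "f differentiable at z" "g differentiable at z"
  shows "pd A (\<lambda>x. f x * g x) z = pd A f z * g z + f z * pd A g z"
  unfolding pd_has_derivative[OF has_derivative_mult[OF assms[THEN frechet_derivative_worksI]]]
  unfolding wirt_add wirt_scale pd_eq_wirt by simp

lemma pd_divide:
  assumes "f differentiable at z" "g differentiable at z" "g z \<noteq> 0"
  shows "pd A (\<lambda>x. f x / g x) z = pd A f z / g z - f z * pd A g z / (g z)\<^sup>2"
proof -
  have "pd A (\<lambda>x. f x / g x) z = wirt A (\<lambda>h. - f z * (inverse (g z) * frechet_derivative g (at z) h * inverse (g z))
      + frechet_derivative f (at z) h / g z)"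
    by (rule pd_has_derivative[OF has_derivative_divide[OF assms(1,2)[THEN frechet_derivative_worksI] assms(3)]])
  then show ?thesis
    using assms(3) by (simp only: pd_eq_wirt wirt_add wirt_scale divide_inverse) (simp add: field_simps power2_eq_square)
qed

lemma pd_sum:
  assumes "finite I" "\<And>i. i \<in> I \<Longrightarrow> f i differentiable at z"
  shows "pd A (\<lambda>x. \<Sum>i\<in>I. f i x) z = (\<Sum>i\<in>I. pd A (f i) z)"
  using assms by (induction I rule: finite_induct) (auto simp: pd_add differentiable_sum)

lemma pd_cnj:
  assumes "f differentiable at z"
  shows "pd A (\<lambda>x. cnj (f x)) z = cnj (pd (swap_sum A) f z)"
  unfolding pd_has_derivative[OF bounded_linear.has_derivative[OF bounded_linear_cnj assms[THEN frechet_derivative_worksI]]]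
  unfolding pd_eq_wirt
  by (cases A) simp_all

lemma pd_smooth_on:
  assumes "open S" "smooth_on S f" shows "smooth_on S (pd A f)"
proof -
  have F: "smooth_on S (\<lambda>x. frechet_derivative f (at x) v)" for v by (rule smooth_on_frechet[OF assms(2)])
  note I = smooth_on_divide smooth_on_add smooth_on_diff smooth_on_mult assms(1) F smooth_on_const
  show ?thesis
    by (cases A; simp add: wd_def[abs_def] wdb_def[abs_def]; intro I; simp)
qed

lemma smooth_on_wd: "open S \<Longrightarrow> smooth_on S f \<Longrightarrow> smooth_on S (wd j f)"
  using pd_smooth_on[of S f "Inl j"] by simp

lemma smooth_on_wdb: "open S \<Longrightarrow> smooth_on S f \<Longrightarrow> smooth_on S (wdb j f)"
  using pd_smooth_on[of S f "Inr j"] by simp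

text \<open>Schwarz's theorem. The second difference of \<open>f\<close> over a small parallelogram with sides
  \<open>h v\<close> and \<open>h w\<close> is, by the mean value theorem applied twice, \<open>h\<^sup>2\<close> times a value of either
  mixed derivative at a point of the parallelogram.\<close>
lemma mixed_difference_mvt:
  fixes f :: "'a::real_normed_vector \<Rightarrow> real"
  assumes "smooth_on S f" and h: "h > 0"
    and S: "\<And>s t. 0 \<le> s \<Longrightarrow> s \<le> h \<Longrightarrow> 0 \<le> t \<Longrightarrow> t \<le> h \<Longrightarrow> z + s *\<^sub>R v + t *\<^sub>R w \<in> S"
  obtains s t where "0 \<le> s" "s \<le> h" "0 \<le> t" "t \<le> h"
    "f (z + h *\<^sub>R v + h *\<^sub>R w) - f (z + h *\<^sub>R v) - f (z + h *\<^sub>R w) + f z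
      = h\<^sup>2 * frechet_derivative (\<lambda>x. frechet_derivative f (at x) v) (at (z + s *\<^sub>R v + t *\<^sub>R w)) w"
proof -
  define g where "g s = f (z + s *\<^sub>R v + h *\<^sub>R w) - f (z + s *\<^sub>R v)" for s
  define f1 where "f1 x = frechet_derivative f (at x) v" for x
  have f1: "smooth_on S f1" unfolding f1_def by (rule smooth_on_frechet[OF assms(1)])
  have line: "((\<lambda>s. k (a + s *\<^sub>R u)) has_real_derivative frechet_derivative k (at (a + s *\<^sub>R u)) u) (at s)"
    if "smooth_on S k" "a + s *\<^sub>R u \<in> S" for k :: "'a \<Rightarrow> real" and a u s
  proof -
    have d: "(k has_derivative frechet_derivative k (at (a + s *\<^sub>R u))) (at (a + s *\<^sub>R u))"
      by (rule frechet_derivative_worksI[OF smooth_on_differentiable[OF that]])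
    have lin: "linear (frechet_derivative k (at (a + s *\<^sub>R u)))"
      using d has_derivative_linear by blast
    have "((\<lambda>s. k (a + s *\<^sub>R u)) has_derivative (\<lambda>x. frechet_derivative k (at (a + s *\<^sub>R u)) (x *\<^sub>R u))) (at s)"
      by (rule has_derivative_compose[where f="\<lambda>s. a + s *\<^sub>R u" and g=k])
        (auto intro!: derivative_eq_intros d)
    then show ?thesis
      unfolding has_field_derivative_def by (rule has_derivative_eq_rhs) (simp add: fun_eq_iff linear_cmul[OF lin])
  qed
  have "\<exists>s. 0 < s \<and> s < h \<and> g h - g 0 = (h - 0) * (f1 (z + s *\<^sub>R v + h *\<^sub>R w) - f1 (z + s *\<^sub>R v))"
  proof (rule MVT2[OF h])
    fix s assume s: "0 \<le> s" "s \<le> h"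
    have 1: "(z + h *\<^sub>R w) + s *\<^sub>R v \<in> S" using S[of s h] s h by (simp add: algebra_simps)
    have 2: "z + s *\<^sub>R v \<in> S" using S[of s 0] s h by simp
    show "(g has_real_derivative f1 (z + s *\<^sub>R v + h *\<^sub>R w) - f1 (z + s *\<^sub>R v)) (at s)"
      using DERIV_diff[OF line[OF assms(1) 1] line[OF assms(1) 2]] unfolding g_def[abs_def] f1_def by (simp add: algebra_simps)
  qed
  then obtain s where s: "0 < s" "s < h"
    "g h - g 0 = h * (f1 (z + s *\<^sub>R v + h *\<^sub>R w) - f1 (z + s *\<^sub>R v))" by auto
  have "\<exists>t. 0 < t \<and> t < h \<and> f1 (z + s *\<^sub>R v + h *\<^sub>R w) - f1 (z + s *\<^sub>R v + 0 *\<^sub>R w)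
      = (h - 0) * frechet_derivative f1 (at (z + s *\<^sub>R v + t *\<^sub>R w)) w"
    by (rule MVT2[OF h]) (use S s in \<open>auto intro!: line f1\<close>)
  then obtain t where t: "0 < t" "t < h" "f1 (z + s *\<^sub>R v + h *\<^sub>R w) - f1 (z + s *\<^sub>R v)
      = h * frechet_derivative f1 (at (z + s *\<^sub>R v + t *\<^sub>R w)) w" by auto
  show ?thesis
    by (rule that[of s t]) (use s t in \<open>auto simp: g_def f1_def[abs_def] power2_eq_square\<close>)
qed

lemma frechet_derivative_symmetric_real:
  fixes f :: "'a::real_normed_vector \<Rightarrow> real"
  assumes "open S" "smooth_on S f" "z \<in> S"
  shows "frechet_derivative (\<lambda>x. frechet_derivative f (at x) v) (at z) w
       = frechet_derivative (\<lambda>x. frechet_derivative f (at x) w) (at z) v"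
    (is "?F z = ?G z")
proof -
  have "continuous_on S ?F" "continuous_on S ?G"
    by (simp_all add: smooth_on_continuous smooth_on_frechet assms(2))
  then have cont: "isCont ?F z" "isCont ?G z"
    using assms continuous_on_eq_continuous_at by blast+
  have "\<bar>?F z - ?G z\<bar> < e" if "e > 0" for e
  proof -
    obtain d1 where d1: "d1 > 0" "\<And>x. dist x z < d1 \<Longrightarrow> dist (?F x) (?F z) < e / 2"
      using cont(1)[unfolded continuous_at_eps_delta, rule_format, of "e / 2"] \<open>e > 0\<close> that by auto
    obtain d2 where d2: "d2 > 0" "\<And>x. dist x z < d2 \<Longrightarrow> dist (?G x) (?G z) < e / 2"
      using cont(2)[unfolded continuous_at_eps_delta, rule_format, of "e / 2"] \<open>e > 0\<close> that by auto
    obtain d3 where d3: "d3 > 0" "\<And>x. dist x z < d3 \<Longrightarrow> x \<in> S"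
      using assms open_dist by blast
    define d where "d = min d1 (min d2 d3)"
    define q where "q = norm v + norm w + 1"
    have pos: "q > 0" by (simp add: q_def add_nonneg_pos)
    define h where "h = d / (2 * q)"
    have d: "d > 0" using d1 d2 d3 by (simp add: d_def)
    then have h: "h > 0" using pos by (simp add: h_def)
    have near: "dist (z + s *\<^sub>R v + t *\<^sub>R w) z < d" if "0 \<le> s" "s \<le> h" "0 \<le> t" "t \<le> h" for s t
    proof -
      have "dist (z + s *\<^sub>R v + t *\<^sub>R w) z = norm (s *\<^sub>R v + t *\<^sub>R w)" by (simp add: dist_norm add.assoc)
      also have "\<dots> \<le> s * norm v + t * norm w" using norm_triangle_ineq[of "s *\<^sub>R v" "t *\<^sub>R w"] that by simp
      also have "\<dots> \<le> h * norm v + h * norm w" using that by (intro add_mono mult_right_mono) auto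
      also have "\<dots> \<le> h * q" using h by (simp add: q_def algebra_simps)
      also have "\<dots> = d / 2" using pos by (simp add: h_def)
      also have "\<dots> < d" using d by simp
      finally show ?thesis .
    qed
    have near': "dist (z + t *\<^sub>R w + s *\<^sub>R v) z < d" if "0 \<le> s" "s \<le> h" "0 \<le> t" "t \<le> h" for s t
      using near[OF that] by (simp add: algebra_simps)
    have in1: "z + s *\<^sub>R v + t *\<^sub>R w \<in> S" if "0 \<le> s" "s \<le> h" "0 \<le> t" "t \<le> h" for s t
      using near[OF that] by (intro d3) (simp add: d_def)
    have in2: "z + s *\<^sub>R w + t *\<^sub>R v \<in> S" if "0 \<le> s" "s \<le> h" "0 \<le> t" "t \<le> h" for s t
      using near'[OF that(3,4,1,2)] by (intro d3) (simp add: d_def)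
    obtain s t where st: "0 \<le> s" "s \<le> h" "0 \<le> t" "t \<le> h"
      "f (z + h *\<^sub>R v + h *\<^sub>R w) - f (z + h *\<^sub>R v) - f (z + h *\<^sub>R w) + f z = h\<^sup>2 * ?F (z + s *\<^sub>R v + t *\<^sub>R w)"
      by (rule mixed_difference_mvt[OF assms(2) h in1]) auto
    obtain s' t' where st': "0 \<le> s'" "s' \<le> h" "0 \<le> t'" "t' \<le> h"
      "f (z + h *\<^sub>R w + h *\<^sub>R v) - f (z + h *\<^sub>R w) - f (z + h *\<^sub>R v) + f z = h\<^sup>2 * ?G (z + s' *\<^sub>R w + t' *\<^sub>R v)"
      by (rule mixed_difference_mvt[OF assms(2) h in2]) auto
    have "f (z + h *\<^sub>R w + h *\<^sub>R v) = f (z + h *\<^sub>R v + h *\<^sub>R w)" by (simp add: algebra_simps)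
    then have "h\<^sup>2 * ?F (z + s *\<^sub>R v + t *\<^sub>R w) = h\<^sup>2 * ?G (z + s' *\<^sub>R w + t' *\<^sub>R v)"
      using st(5) st'(5) by linarith
    then have eq: "?F (z + s *\<^sub>R v + t *\<^sub>R w) = ?G (z + s' *\<^sub>R w + t' *\<^sub>R v)" using h by simp
    have "dist (?F (z + s *\<^sub>R v + t *\<^sub>R w)) (?F z) < e / 2"
      using near[OF st(1-4)] by (intro d1(2)) (simp add: d_def)
    moreover have "dist (?G (z + s' *\<^sub>R w + t' *\<^sub>R v)) (?G z) < e / 2"
      using near'[OF st'(3,4,1,2)] by (intro d2(2)) (simp add: d_def)
    ultimately show ?thesis unfolding dist_real_def eq by linarith
  qed
  then have "?F z - ?G z = 0" by (meson dense_eq0_I less_imp_le)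
  then show ?thesis by simp
qed

lemma frechet_derivative_symmetric:
  fixes f :: "'a::real_normed_vector \<Rightarrow> complex"
  assumes "open S" "smooth_on S f" "z \<in> S"
  shows "frechet_derivative (\<lambda>x. frechet_derivative f (at x) v) (at z) w
       = frechet_derivative (\<lambda>x. frechet_derivative f (at x) w) (at z) v"
proof -
  have L: "L (frechet_derivative (\<lambda>x. frechet_derivative f (at x) v) (at z) w)
       = frechet_derivative (\<lambda>x. frechet_derivative (\<lambda>y. L (f y)) (at x) v) (at z) w"
    if L: "bounded_linear L" for L :: "complex \<Rightarrow> real" and v w
  proof -
    have 1: "frechet_derivative (\<lambda>y. L (g y)) (at x) u = L (frechet_derivative g (at x) u)"
      if "smooth_on S g" "x \<in> S" for g :: "'a \<Rightarrow> complex" and x u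
      by (rule fun_cong[OF frechet_eq[OF bounded_linear.has_derivative[OF L
        frechet_derivative_worksI[OF smooth_on_differentiable[OF that]]]]])
    have s: "smooth_on S (\<lambda>x. frechet_derivative f (at x) v)" by (rule smooth_on_frechet[OF assms(2)])
    have "frechet_derivative (\<lambda>x. L (frechet_derivative f (at x) v)) (at z)
        = frechet_derivative (\<lambda>x. frechet_derivative (\<lambda>y. L (f y)) (at x) v) (at z)"
      by (rule frechet_derivative_transform_within_open[OF _ assms(1,3)])
        (use 1[OF assms(2)] smooth_on_differentiable[OF smooth_on_linear[OF L assms(1) s] assms(3)] in auto)
    with 1[OF s assms(3)] show ?thesis by simp
  qed
  show ?thesis
    by (rule complex_eqI)
      (simp_all add: L bounded_linear_Re bounded_linear_Im
        frechet_derivative_symmetric_real[OF assms(1) smooth_on_linear[OF _ assms(1,2)] assms(3)])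
qed

lemma pd_commute:
  assumes "open S" "smooth_on S f" "z \<in> S"
  shows "pd A (pd B f) z = pd B (pd A f) z"
proof -
  define D where "D v w = frechet_derivative (\<lambda>x. frechet_derivative f (at x) v) (at z) w" for v w
  have D: "((\<lambda>x. frechet_derivative f (at x) v) has_derivative D v) (at z)" for v
    unfolding D_def
    by (rule frechet_derivative_worksI[OF smooth_on_differentiable[OF smooth_on_frechet[OF assms(2)] assms(3)]])
  have "(pd B f has_derivative (\<lambda>w. wirt B (\<lambda>v. D v w))) (at z)" for B
    by (cases B) (auto simp: wd_def[abs_def] wdb_def[abs_def] intro!: derivative_eq_intros D)
  then have "pd A (pd B f) z = wirt A (\<lambda>w. wirt B (\<lambda>v. D v w))" for A B
    by (rule pd_has_derivative)
  moreover have sym: "D v w = D w v" for v w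
    unfolding D_def by (rule frechet_derivative_symmetric[OF assms])
  have "wirt A (\<lambda>w. wirt B (\<lambda>v. D v w)) = wirt B (\<lambda>v. wirt A (\<lambda>w. D v w))"
    by (cases A; cases B) (simp_all add: algebra_simps diff_divide_distrib add_divide_distrib)
  then have "wirt A (\<lambda>w. wirt B (\<lambda>v. D v w)) = wirt B (\<lambda>v. wirt A (\<lambda>w. D w v))"
    by (subst (asm) (2) sym)
  ultimately show ?thesis by simp
qed

section \<open>Derivatives along a level set\<close>

text \<open>Let \<open>v\<close> be tangent and \<open>u\<close> transversal to the zero set. For small \<open>t\<close> the intermediate
  value theorem yields \<open>s\<close>, small compared with \<open>t\<close>, such that \<open>z + t v + s u\<close> lies in the zero
  set; expanding \<open>f\<close> to first order there shows that its derivative along \<open>v\<close> vanishes.\<close>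
lemma derivative_along_zero_set:
  fixes \<rho> :: "'a::real_normed_vector \<Rightarrow> real" and f :: "'a \<Rightarrow> 'b::real_normed_vector"
  assumes U: "open U" "continuous_on U \<rho>" "z \<in> U" "\<rho> z = 0"
    and R: "(\<rho> has_derivative R) (at z)" and F: "(f has_derivative F) (at z)"
    and f: "\<And>x. x \<in> U \<Longrightarrow> \<rho> x = 0 \<Longrightarrow> f x = 0"
    and v: "R v = 0" and e: "R e \<noteq> 0"
  shows "F v = 0"
proof (rule ccontr)
  assume "F v \<noteq> 0"
  define c where "c = norm (F v)"
  have c: "c > 0" using \<open>F v \<noteq> 0\<close> by (simp add: c_def)
  interpret R: bounded_linear R using R by (rule has_derivative_bounded_linear)
  interpret F: bounded_linear F using F by (rule has_derivative_bounded_linear)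
  define u where "u = (1 / R e) *\<^sub>R e"
  have u: "R u = 1" using e by (simp add: u_def R.scaleR)
  define q where "q = norm (F u) + 1"
  have q: "q > 0" "norm (F u) \<le> q" by (simp_all add: q_def add_nonneg_pos)
  define \<epsilon> where "\<epsilon> = c / (4 * q)"
  have \<epsilon>: "\<epsilon> > 0" using c q by (simp add: \<epsilon>_def)
  have "\<epsilon> * norm (F u) \<le> \<epsilon> * q" using \<epsilon> q by simp
  then have \<epsilon>F: "\<epsilon> * norm (F u) \<le> c / 4" using q by (simp add: \<epsilon>_def)
  define K where "K = norm v + \<epsilon> * norm u + 1"
  have K: "K > 0" using \<epsilon> by (simp add: K_def add_nonneg_pos)
  obtain d1 where d1: "d1 > 0" "\<And>y. norm (y - z) < d1 \<Longrightarrow> norm (\<rho> y - \<rho> z - R (y - z)) \<le> \<epsilon> / (2 * K) * norm (y - z)"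
  proof -
    have "\<epsilon> / (2 * K) > 0" using \<epsilon> K by simp
    from conjunct2[OF R[unfolded has_derivative_at_alt], rule_format, OF this] that show ?thesis by blast
  qed
  obtain d2 where d2: "d2 > 0" "\<And>y. norm (y - z) < d2 \<Longrightarrow> norm (f y - f z - F (y - z)) \<le> c / (4 * K) * norm (y - z)"
  proof -
    have "c / (4 * K) > 0" using c K by simp
    from conjunct2[OF F[unfolded has_derivative_at_alt], rule_format, OF this] that show ?thesis by blast
  qed
  obtain d3 where d3: "d3 > 0" "\<And>y. dist y z < d3 \<Longrightarrow> y \<in> U"
    using U open_dist by blast
  define d where "d = min d1 (min d2 d3)"
  have d: "d > 0" using d1 d2 d3 by (simp add: d_def)
  define t where "t = d / K"
  have t: "t > 0" using d K by (simp add: t_def)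
  have tK: "t * K = d" using K by (simp add: t_def)
  define p where "p s = z + (t *\<^sub>R v + s *\<^sub>R u)" for s
  have pd: "norm (p s - z) < d" if "\<bar>s\<bar> \<le> \<epsilon> * t" for s
  proof -
    have "norm (p s - z) \<le> norm (t *\<^sub>R v) + norm (s *\<^sub>R u)" unfolding p_def by (simp only: add_diff_cancel_left' norm_triangle_ineq)
    also have "\<dots> \<le> t * norm v + (\<epsilon> * t) * norm u"
      using mult_right_mono[OF that norm_ge_zero[of u]] t by simp
    also have "\<dots> < t * K" using t by (simp add: K_def algebra_simps)
    finally show ?thesis by (simp add: tK)
  qed
  have Rp: "R (p s - z) = s" for s by (simp add: p_def R.add R.scaleR u v)
  have pU: "p s \<in> U" if "\<bar>s\<bar> \<le> \<epsilon> * t" for s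
    using pd[OF that] by (intro d3(2)) (simp add: d_def dist_norm)
  have est: "\<bar>\<rho> (p s) - s\<bar> \<le> \<epsilon> * t / 2" if "\<bar>s\<bar> \<le> \<epsilon> * t" for s
  proof -
    have "\<bar>\<rho> (p s) - s\<bar> \<le> \<epsilon> / (2 * K) * norm (p s - z)"
      using d1(2)[of "p s"] pd[OF that] by (simp add: Rp U(4) d_def)
    also have "\<dots> \<le> \<epsilon> / (2 * K) * (t * K)"
      using pd[OF that] \<epsilon> K tK by (intro mult_left_mono) auto
    also have "\<dots> = \<epsilon> * t / 2" using K by simp
    finally show ?thesis .
  qed
  have et: "\<epsilon> * t > 0" using \<epsilon> t by simp
  have "\<exists>s\<ge>- (\<epsilon> * t). s \<le> \<epsilon> * t \<and> \<rho> (p s) = 0"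
  proof (rule IVT')
    show "\<rho> (p (- (\<epsilon> * t))) \<le> 0" "0 \<le> \<rho> (p (\<epsilon> * t))"
      using est[of "- (\<epsilon> * t)"] est[of "\<epsilon> * t"] et by linarith+
    show "- (\<epsilon> * t) \<le> \<epsilon> * t" using et by simp
    show "continuous_on {- (\<epsilon> * t)..\<epsilon> * t} (\<lambda>s. \<rho> (p s))"
      by (rule continuous_on_compose2[OF U(2)])
        (use pU in \<open>auto simp: p_def intro!: continuous_intros\<close>)
  qed
  then obtain s where "- (\<epsilon> * t) \<le> s" "s \<le> \<epsilon> * t" and s0: "\<rho> (p s) = 0" by blast
  then have s: "\<bar>s\<bar> \<le> \<epsilon> * t" "\<rho> (p s) = 0" by linarith+
  have "norm (F (p s - z)) \<le> c / (4 * K) * norm (p s - z)"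
    using d2(2)[of "p s"] pd[OF s(1)] f[OF pU[OF s(1)] s(2)] f[OF U(3,4)] by (simp add: d_def)
  also have "\<dots> \<le> c / (4 * K) * (t * K)"
    using pd[OF s(1)] c K tK by (intro mult_left_mono) auto
  also have "\<dots> = c * t / 4" using K by simp
  finally have 1: "norm (F (p s - z)) \<le> c * t / 4" .
  have "t *\<^sub>R F v = F (p s - z) - s *\<^sub>R F u" by (simp add: p_def F.add F.scaleR)
  then have "t * c \<le> norm (F (p s - z)) + \<bar>s\<bar> * norm (F u)"
    using norm_triangle_ineq4[of "F (p s - z)" "s *\<^sub>R F u"] t
    by (metis abs_of_pos c_def norm_scaleR)
  moreover have "\<bar>s\<bar> * norm (F u) \<le> \<epsilon> * t * norm (F u)" using s(1) by (rule mult_right_mono) simp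
  moreover have "t * (\<epsilon> * norm (F u)) \<le> t * (c / 4)" using \<epsilon>F t by (intro mult_left_mono) auto
  moreover have "t * c > 0" using t c by simp
  ultimately show False using 1 by (simp add: mult_ac)
qed

text \<open>Hence the differential of \<open>f\<close> is a multiple of that of \<open>\<rho>\<close>, and complexified vectors that
  annihilate \<open>\<rho>\<close> annihilate \<open>f\<close>.\<close>
lemma vderiv_zero_set:
  fixes \<rho> :: "complex^'m::finite \<Rightarrow> real"
  assumes U: "open U" "smooth_on U \<rho>" "z \<in> U" "\<rho> z = 0"
    and f: "f differentiable (at z)" "\<And>x. x \<in> U \<Longrightarrow> \<rho> x = 0 \<Longrightarrow> f x = 0"
    and ne: "pd B (cplx \<rho>) z \<noteq> 0" and X: "X z \<in> ctangent \<rho> z"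
  shows "vderiv X f z = 0"
proof -
  define R where "R = frechet_derivative \<rho> (at z)"
  define F where "F = frechet_derivative f (at z)"
  have R: "(\<rho> has_derivative R) (at z)"
    unfolding R_def by (rule frechet_derivative_worksI[OF smooth_on_differentiable[OF U(2,3)]])
  have F: "(f has_derivative F) (at z)"
    unfolding F_def by (rule frechet_derivative_worksI[OF f(1)])
  interpret R: bounded_linear R using R by (rule has_derivative_bounded_linear)
  interpret F: bounded_linear F using F by (rule has_derivative_bounded_linear)
  have pdR: "pd A (cplx \<rho>) z = wirt A (\<lambda>v. complex_of_real (R v))" for A
    by (rule pd_has_derivative[OF bounded_linear.has_derivative[OF bounded_linear_of_real R]])
  obtain e where e: "R e \<noteq> 0"
  proof -
    have "wirt B (\<lambda>v. complex_of_real (R v)) = 0" if "\<And>e. R e = 0" using that by (cases B) simp_all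
    then show ?thesis using ne that unfolding pdR by blast
  qed
  define \<mu> where "\<mu> = F e / complex_of_real (R e)"
  have "F v = \<mu> * complex_of_real (R v)" for v
  proof -
    have "F (v - (R v / R e) *\<^sub>R e) = 0"
      by (rule derivative_along_zero_set[OF U(1) smooth_on_continuous[OF U(2)] U(3,4) R F f(2) _ e])
        (use e in \<open>auto simp: R.diff R.scaleR\<close>)
    then have "F v = (R v / R e) *\<^sub>R F e" by (simp add: F.diff F.scaleR)
    then show ?thesis by (simp add: \<mu>_def scaleR_conv_of_real)
  qed
  then have "F = (\<lambda>v. \<mu> * complex_of_real (R v))" by (rule ext)
  then have "pd A f z = \<mu> * pd A (cplx \<rho>) z" for A
    unfolding pdR pd_has_derivative[OF F] wirt_scale(1)[symmetric] by (rule arg_cong)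
  then have "vderiv X f z = \<mu> * (\<Sum>A\<in>UNIV. X z $ A * pd A (cplx \<rho>) z)"
    by (simp add: vderiv_def sum_distrib_left mult_ac)
  then show ?thesis using X by (simp add: ctangent_def)
qed

lemma vderiv_eq_on_zero_set:
  fixes \<rho> :: "complex^'m::finite \<Rightarrow> real"
  assumes U: "open U" "smooth_on U \<rho>" "z \<in> U" "\<rho> z = 0"
    and fg: "f differentiable (at z)" "g differentiable (at z)" "\<And>x. x \<in> U \<Longrightarrow> \<rho> x = 0 \<Longrightarrow> f x = g x"
    and ne: "pd B (cplx \<rho>) z \<noteq> 0" and X: "X z \<in> ctangent \<rho> z"
  shows "vderiv X f z = vderiv X g z"
proof -
  have "vderiv X (\<lambda>x. f x - g x) z = 0"
    by (rule vderiv_zero_set[where X=X and z=z, OF U _ _ ne X]) (use fg in \<open>auto intro: differentiable_diff\<close>)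
  then show ?thesis
    using fg by (simp add: vderiv_def pd_diff algebra_simps sum_subtractf)
qed

section \<open>Derivations and frames\<close>

lemma vderiv_const [simp]: "vderiv X (\<lambda>x. c) z = 0"
  by (simp add: vderiv_def)

lemma vderiv_add:
  "f differentiable at z \<Longrightarrow> g differentiable at z \<Longrightarrow>
    vderiv X (\<lambda>x. f x + g x) z = vderiv X f z + vderiv X g z"
  by (simp add: vderiv_def pd_add algebra_simps sum.distrib)

lemma vderiv_diff:
  "f differentiable at z \<Longrightarrow> g differentiable at z \<Longrightarrow>
    vderiv X (\<lambda>x. f x - g x) z = vderiv X f z - vderiv X g z"
  by (simp add: vderiv_def pd_diff algebra_simps sum_subtractf)

lemma vderiv_minus:
  "f differentiable at z \<Longrightarrow> vderiv X (\<lambda>x. - f x) z = - vderiv X f z"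
  by (simp add: vderiv_def pd_minus sum_negf)

lemma vderiv_mult:
  "f differentiable at z \<Longrightarrow> g differentiable at z \<Longrightarrow>
    vderiv X (\<lambda>x. f x * g x) z = vderiv X f z * g z + f z * vderiv X g z"
  by (simp add: vderiv_def pd_mult algebra_simps sum.distrib sum_distrib_left)

lemma vderiv_divide:
  assumes "f differentiable at z" "g differentiable at z" "g z \<noteq> 0"
  shows "vderiv X (\<lambda>x. f x / g x) z = (vderiv X f z - f z / g z * vderiv X g z) / g z"
proof -
  have "vderiv X (\<lambda>x. f x / g x) z = (\<Sum>A\<in>UNIV. X z $ A * (pd A f z - f z / g z * pd A g z) / g z)"
    unfolding vderiv_def using assms
    by (intro sum.cong) (simp_all add: pd_divide power2_eq_square field_simps)
  also have "\<dots> = (vderiv X f z - f z / g z * vderiv X g z) / g z"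
    by (simp add: vderiv_def sum_divide_distrib[symmetric] right_diff_distrib sum_subtractf sum_distrib_left mult_ac)
  finally show ?thesis .
qed

lemma vderiv_sum:
  assumes "finite I" "\<And>i. i \<in> I \<Longrightarrow> f i differentiable at z"
  shows "vderiv X (\<lambda>x. \<Sum>i\<in>I. f i x) z = (\<Sum>i\<in>I. vderiv X (f i) z)"
  using assms by (induction I rule: finite_induct) (auto simp: vderiv_add differentiable_sum)

lemma vderiv_cong_open:
  assumes "open S" "z \<in> S" "\<And>x. x \<in> S \<Longrightarrow> f x = g x" "f differentiable at z"
  shows "vderiv X f z = vderiv X g z"
  unfolding vderiv_def using pd_cong[OF assms] by simp

lemma sum_sum_type: "(\<Sum>A\<in>UNIV. f A) = (\<Sum>j\<in>UNIV. f (Inl j)) + (\<Sum>j\<in>UNIV. f (Inr j))"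
  for f :: "'a::finite + 'b::finite \<Rightarrow> 'c::comm_monoid_add"
  using sum.Plus[of "UNIV :: 'a set" "UNIV :: 'b set" f] by (simp add: UNIV_Plus_UNIV)

lemma sum_option: "(\<Sum>j\<in>UNIV. f j) = f None + (\<Sum>\<mu>\<in>UNIV. f (Some \<mu>))"
  for f :: "'a::finite option \<Rightarrow> 'c::comm_monoid_add"
  by (simp add: UNIV_option_conv sum.reindex)

lemma if_one_mult: "(if P then 1 else 0) * c = (if P then c else (0::complex))"
  "c * (if P then 1 else 0) = (if P then c else (0::complex))"
  by simp_all

lemma vderiv_split:
  "vderiv X f z = (\<Sum>j\<in>UNIV. X z $ Inl j * wd j f z) + (\<Sum>j\<in>UNIV. X z $ Inr j * wdb j f z)"
  by (simp add: vderiv_def sum_sum_type)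

lemma vconj_nth [simp]:
  "vconj X $ Inl j = cnj (X $ Inr j)" "vconj X $ Inr j = cnj (X $ Inl j)"
  by (simp_all add: vconj_def)

lemma vconj_vconj [simp]: "vconj (vconj X) = X"
  by (simp add: vec_eq_iff vconj_def split: sum.split)

lemma vconj_add: "vconj (X + Y) = vconj X + vconj Y"
  and vconj_scale: "vconj (c *s X) = cnj c *s vconj X"
  and vconj_zero [simp]: "vconj 0 = 0"
  by (simp_all add: vec_eq_iff vconj_def)

lemma vconj_sum: "vconj (\<Sum>i\<in>I. f i) = (\<Sum>i\<in>I. vconj (f i))"
  by (induction I rule: infinite_finite_induct) (auto simp: vconj_add)

lemma vec_eq_sum_iff: "X = Y \<longleftrightarrow> (\<forall>j. X $ Inl j = Y $ Inl j) \<and> (\<forall>j. X $ Inr j = Y $ Inr j)"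
  unfolding vec_eq_iff by (metis sum.exhaust)

locale hypersurface =
  fixes \<rho> :: "complex^('n::finite option) \<Rightarrow> real"
    and U M :: "(complex^('n option)) set"
  assumes open_U: "open U" and smooth_\<rho>: "smooth_on U \<rho>"
    and M_eq: "M = {z \<in> U. \<rho> z = 0}"
    and nondegenerate: "levi_nondegenerate \<rho> M"
    and w_nonzero: "\<forall>z\<in>M. wd None (cplx \<rho>) z \<noteq> 0"
begin

abbreviation "R \<equiv> cplx \<rho>"
abbreviation "Z \<equiv> frame \<rho>"
abbreviation "Zb \<equiv> frameb \<rho>"
abbreviation "h \<equiv> levi \<rho>"
abbreviation "logJ \<equiv> log_levi_fefferman \<rho>"

text \<open>The frame is defined and smooth on this neighbourhood of \<open>M\<close>.\<close>
definition W where "W = {z \<in> U. wd None R z \<noteq> 0}"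

lemma smooth_R: "smooth_on U R"
  by (rule smooth_on_of_real[OF open_U smooth_\<rho>])

lemma open_W: "open W"
proof -
  have "continuous_on U (wd None R)"
    by (rule smooth_on_continuous[OF smooth_on_wd[OF open_U smooth_R]])
  then have "open (wd None R -` (- {0}) \<inter> U)"
    using continuous_on_open_vimage[OF open_U] by blast
  moreover have "W = wd None R -` (- {0}) \<inter> U" by (auto simp: W_def)
  ultimately show ?thesis by simp
qed

lemma W_sub_U: "W \<subseteq> U" and M_sub_W: "M \<subseteq> W"
  using w_nonzero by (auto simp: W_def M_eq)

lemma M_W: "z \<in> M \<Longrightarrow> z \<in> W"
  using M_sub_W by auto

lemma Rw_nz: "z \<in> W \<Longrightarrow> wd None R z \<noteq> 0"
  by (simp add: W_def)

lemma smooth_R_W: "smooth_on W R"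
  using smooth_on_subset[OF smooth_R W_sub_U] .

lemmas smooth_intros = smooth_R_W smooth_on_wd smooth_on_wdb open_W smooth_on_const smooth_on_add smooth_on_diff smooth_on_mult
  smooth_on_minus smooth_on_sum smooth_on_cnj

lemma diffW: "smooth_on W f \<Longrightarrow> z \<in> W \<Longrightarrow> f differentiable at z"
  by (rule smooth_on_differentiable)

lemma cnj_wd: "f differentiable at z \<Longrightarrow> cnj (wd j f z) = wdb j (\<lambda>x. cnj (f x)) z"
  and cnj_wdb: "f differentiable at z \<Longrightarrow> cnj (wdb j f z) = wd j (\<lambda>x. cnj (f x)) z"
  using pd_cnj[of f z "Inr j"] pd_cnj[of f z "Inl j"] by simp_all

lemma pd_congW:
  assumes "z \<in> W" "smooth_on W f" "\<And>x. x \<in> W \<Longrightarrow> f x = g x"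
  shows "pd A f z = pd A g z"
  by (rule pd_cong[OF open_W assms(1,3) diffW[OF assms(2,1)]])

lemmas wd_congW = pd_congW[where A="Inl j" for j, unfolded pd.simps]
  and wdb_congW = pd_congW[where A="Inr j" for j, unfolded pd.simps]

lemma cnj_wd_R: "z \<in> W \<Longrightarrow> cnj (wd j R z) = wdb j R z"
  and cnj_wdb_R: "z \<in> W \<Longrightarrow> cnj (wdb j R z) = wd j R z"
  by (simp_all add: cnj_wd cnj_wdb diffW[OF smooth_R_W])

lemma wd_wdb_commute: "smooth_on W f \<Longrightarrow> z \<in> W \<Longrightarrow> wdb k (wd j f) z = wd j (wdb k f) z"
  and wd_wd_commute: "smooth_on W f \<Longrightarrow> z \<in> W \<Longrightarrow> wd i (wd j f) z = wd j (wd i f) z"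
  and wdb_wdb_commute: "smooth_on W f \<Longrightarrow> z \<in> W \<Longrightarrow> wdb k (wdb l f) z = wdb l (wdb k f) z"
  using pd_commute[OF open_W, of f z "Inr k" "Inl j"] pd_commute[OF open_W, of f z "Inl i" "Inl j"]
    pd_commute[OF open_W, of f z "Inr k" "Inr l"] by simp_all

lemma Rwb_nz: "z \<in> W \<Longrightarrow> wdb None R z \<noteq> 0"
  using Rw_nz cnj_wd_R by (metis complex_cnj_zero_iff)

lemma cnj_R2:
  assumes "z \<in> W"
  shows "cnj (wd j (wdb k R) z) = wd k (wdb j R) z"
    and "cnj (wd i (wd j R) z) = wdb i (wdb j R) z"
    and "cnj (wdb i (wdb j R) z) = wd i (wd j R) z"
proof -
  note S = smooth_on_wd[OF open_W smooth_R_W] smooth_on_wdb[OF open_W smooth_R_W]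
  have "cnj (wd j (wdb k R) z) = wdb j (\<lambda>x. cnj (wdb k R x)) z"
    by (rule cnj_wd[OF diffW[OF S(2) assms]])
  also have "\<dots> = wdb j (wd k R) z"
    by (rule wdb_congW[OF assms]) (auto intro!: smooth_intros simp: cnj_wdb_R)
  also have "\<dots> = wd k (wdb j R) z" by (rule wd_wdb_commute[OF smooth_R_W assms])
  finally show "cnj (wd j (wdb k R) z) = wd k (wdb j R) z" .
  have "cnj (wd i (wd j R) z) = wdb i (\<lambda>x. cnj (wd j R x)) z"
    by (rule cnj_wd[OF diffW[OF S(1) assms]])
  also have "\<dots> = wdb i (wdb j R) z"
    by (rule wdb_congW[OF assms]) (auto intro!: smooth_intros simp: cnj_wd_R)
  finally show "cnj (wd i (wd j R) z) = wdb i (wdb j R) z" .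
  have "cnj (wdb i (wdb j R) z) = wd i (\<lambda>x. cnj (wdb j R x)) z"
    by (rule cnj_wdb[OF diffW[OF S(2) assms]])
  also have "\<dots> = wd i (wd j R) z"
    by (rule wd_congW[OF assms]) (auto intro!: smooth_intros simp: cnj_wdb_R)
  finally show "cnj (wdb i (wdb j R) z) = wd i (wd j R) z" .
qed

lemma cnj_R3:
  assumes "z \<in> W"
  shows "cnj (wd i (wd j (wdb k R)) z) = wdb i (wdb j (wd k R)) z"
proof -
  have "cnj (wd i (wd j (wdb k R)) z) = wdb i (\<lambda>x. cnj (wd j (wdb k R) x)) z"
    by (rule cnj_wd[OF diffW[OF _ assms]]) (intro smooth_intros)
  also have "\<dots> = wdb i (wdb j (wd k R)) z"
    by (rule wdb_congW[OF assms])
      (auto intro!: smooth_intros simp: cnj_R2 wd_wdb_commute[OF smooth_R_W])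
  finally show ?thesis .
qed

subsection \<open>The frame\<close>

text \<open>\<open>Z\<^sub>\<alpha> = \<partial>\<^sub>\<alpha> - slope\<^sub>\<alpha> \<partial>\<^sub>w\<close>.\<close>
definition slope where "slope \<alpha> z = wd (Some \<alpha>) R z / wd None R z"

text \<open>The contraction of a covector with \<open>Z\<^sub>\<alpha>\<close>, and with its conjugate. Tensors are contracted index
  by index, so that every tensor in the frame is an iterated \<open>ct\<close> and \<open>ctb\<close> of partial derivatives.\<close>
definition ct where "ct \<alpha> z f = f (Some \<alpha>) - slope \<alpha> z * f None" for f :: "'n option \<Rightarrow> complex"
definition ctb where "ctb \<alpha> z f = f (Some \<alpha>) - cnj (slope \<alpha> z) * f None" for f :: "'n option \<Rightarrow> complex"

lemma smooth_slope: "smooth_on W (slope \<alpha>)"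
  unfolding slope_def[abs_def] using Rw_nz by (intro smooth_on_divide smooth_intros)

lemma smooth_ct: "(\<And>j. smooth_on W (F j)) \<Longrightarrow> smooth_on W (\<lambda>x. ct \<alpha> x (\<lambda>j. F j x))"
  and smooth_ctb: "(\<And>j. smooth_on W (F j)) \<Longrightarrow> smooth_on W (\<lambda>x. ctb \<alpha> x (\<lambda>j. F j x))"
  unfolding ct_def ctb_def by (intro smooth_intros smooth_slope; assumption)+

lemma ct_linear:
  "ct \<alpha> z (\<lambda>j. f j + g j) = ct \<alpha> z f + ct \<alpha> z g"
  "ct \<alpha> z (\<lambda>j. f j - g j) = ct \<alpha> z f - ct \<alpha> z g"
  "ct \<alpha> z (\<lambda>j. c * f j) = c * ct \<alpha> z f"
  "ct \<alpha> z (\<lambda>j. f j * c) = ct \<alpha> z f * c"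
  "ct \<alpha> z (\<lambda>j. f j / c) = ct \<alpha> z f / c"
  "ct \<alpha> z (\<lambda>j. - f j) = - ct \<alpha> z f"
  by (simp_all add: ct_def algebra_simps diff_divide_distrib)

lemma ctb_linear:
  "ctb \<alpha> z (\<lambda>j. f j + g j) = ctb \<alpha> z f + ctb \<alpha> z g"
  "ctb \<alpha> z (\<lambda>j. f j - g j) = ctb \<alpha> z f - ctb \<alpha> z g"
  "ctb \<alpha> z (\<lambda>j. c * f j) = c * ctb \<alpha> z f"
  "ctb \<alpha> z (\<lambda>j. f j * c) = ctb \<alpha> z f * c"
  "ctb \<alpha> z (\<lambda>j. f j / c) = ctb \<alpha> z f / c"
  "ctb \<alpha> z (\<lambda>j. - f j) = - ctb \<alpha> z f"
  by (simp_all add: ctb_def algebra_simps diff_divide_distrib)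

lemma ct_sum: "ct \<alpha> z (\<lambda>j. \<Sum>i\<in>I. f i j) = (\<Sum>i\<in>I. ct \<alpha> z (f i))"
  and ctb_sum: "ctb \<alpha> z (\<lambda>j. \<Sum>i\<in>I. f i j) = (\<Sum>i\<in>I. ctb \<alpha> z (f i))"
  by (simp_all add: ct_def ctb_def sum_subtractf sum_distrib_left)

lemma ct_ctb_swap: "ctb \<beta> z (\<lambda>k. ct \<alpha> z (\<lambda>j. f j k)) = ct \<alpha> z (\<lambda>j. ctb \<beta> z (\<lambda>k. f j k))"
  and ct_ct_swap: "ct \<beta> z (\<lambda>k. ct \<alpha> z (\<lambda>j. f j k)) = ct \<alpha> z (\<lambda>j. ct \<beta> z (\<lambda>k. f j k))"
  and ctb_ctb_swap: "ctb \<beta> z (\<lambda>k. ctb \<alpha> z (\<lambda>j. f j k)) = ctb \<alpha> z (\<lambda>j. ctb \<beta> z (\<lambda>k. f j k))"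
  by (simp_all add: ct_def ctb_def algebra_simps)

lemma cnj_ct: "cnj (ct \<alpha> z f) = ctb \<alpha> z (\<lambda>j. cnj (f j))"
  and cnj_ctb: "cnj (ctb \<alpha> z f) = ct \<alpha> z (\<lambda>j. cnj (f j))"
  by (simp_all add: ct_def ctb_def)

lemma ct_dR: "z \<in> W \<Longrightarrow> ct \<alpha> z (\<lambda>j. wd j R z) = 0"
  by (simp add: ct_def slope_def Rw_nz)

lemma ctb_dR: "z \<in> W \<Longrightarrow> ctb \<alpha> z (\<lambda>j. wdb j R z) = 0"
  by (simp add: ctb_def slope_def Rwb_nz cnj_wd_R)

lemma frame_nth [simp]:
  "Z \<alpha> z $ Inl (Some \<mu>) = (if \<mu> = \<alpha> then 1 else 0)"
  "Z \<alpha> z $ Inl None = - slope \<alpha> z"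
  "Z \<alpha> z $ Inr j = 0"
  by (auto simp: frame_def axis_def slope_def)

lemma frameb_nth [simp]:
  "Zb \<alpha> z $ Inr (Some \<mu>) = (if \<mu> = \<alpha> then 1 else 0)"
  "Zb \<alpha> z $ Inr None = - cnj (slope \<alpha> z)"
  "Zb \<alpha> z $ Inl j = 0"
  by (auto simp: frameb_def)

lemma sum_frame: "(\<Sum>j\<in>UNIV. Z \<alpha> z $ Inl j * f j) = ct \<alpha> z f"
  and sum_frameb: "(\<Sum>j\<in>UNIV. Zb \<alpha> z $ Inr j * f j) = ctb \<alpha> z f"
  by (simp_all add: sum_option ct_def ctb_def if_one_mult)

lemma vderiv_frame: "vderiv (Z \<alpha>) f z = ct \<alpha> z (\<lambda>j. wd j f z)"
  and vderiv_frameb: "vderiv (Zb \<alpha>) f z = ctb \<alpha> z (\<lambda>j. wdb j f z)"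
  by (simp_all add: vderiv_split sum_frame sum_frameb)

text \<open>Differentiating a contraction differentiates the covector and the frame; only the component of
  \<open>Z\<^sub>\<alpha>\<close> along \<open>\<partial>\<^sub>w\<close> varies.\<close>
lemma vderiv_ct:
  assumes "z \<in> W" "\<And>j. smooth_on W (F j)"
  shows "vderiv X (\<lambda>x. ct \<alpha> x (\<lambda>j. F j x)) z
    = ct \<alpha> z (\<lambda>j. vderiv X (F j) z) - vderiv X (slope \<alpha>) z * F None z"
  unfolding ct_def using assms smooth_slope
  by (simp add: vderiv_diff vderiv_mult diffW differentiable_mult)

lemma vderiv_ctb:
  assumes "z \<in> W" "\<And>j. smooth_on W (F j)"
  shows "vderiv X (\<lambda>x. ctb \<alpha> x (\<lambda>j. F j x)) z
    = ctb \<alpha> z (\<lambda>j. vderiv X (F j) z) - vderiv X (\<lambda>x. cnj (slope \<alpha> x)) z * F None z"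
  unfolding ctb_def using assms smooth_slope smooth_on_cnj[OF open_W smooth_slope]
  by (simp add: vderiv_diff vderiv_mult diffW differentiable_mult)

lemma vderiv_slope:
  assumes "z \<in> W"
  shows "vderiv X (slope \<alpha>) z = ct \<alpha> z (\<lambda>j. vderiv X (wd j R) z) / wd None R z"
proof -
  have "wd j R differentiable at z" for j
    by (rule diffW[OF _ assms]) (intro smooth_intros)
  then show ?thesis
    unfolding slope_def[abs_def] by (simp add: vderiv_divide Rw_nz[OF assms] ct_def slope_def)
qed

lemma vderiv_cnj_slope:
  assumes "z \<in> W"
  shows "vderiv X (\<lambda>x. cnj (slope \<alpha> x)) z = ctb \<alpha> z (\<lambda>j. vderiv X (wdb j R) z) / wdb None R z"
proof -
  have d: "wdb j R differentiable at z" for j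
    by (rule diffW[OF _ assms]) (intro smooth_intros)
  have "vderiv X (\<lambda>x. cnj (slope \<alpha> x)) z = vderiv X (\<lambda>x. wdb (Some \<alpha>) R x / wdb None R x) z"
    by (rule vderiv_cong_open[OF open_W assms _ diffW[OF smooth_on_cnj[OF open_W smooth_slope] assms]])
      (simp add: slope_def cnj_wd_R)
  then show ?thesis
    using assms d by (simp add: vderiv_divide Rwb_nz ctb_def slope_def cnj_wd_R)
qed

lemma ctangent_iff:
  "X \<in> ctangent \<rho> z \<longleftrightarrow> (\<Sum>j\<in>UNIV. X $ Inl j * wd j R z) + (\<Sum>j\<in>UNIV. X $ Inr j * wdb j R z) = 0"
  by (simp add: ctangent_def sum_sum_type)

lemma T10_iff: "X \<in> T10 \<rho> z \<longleftrightarrow> (\<Sum>j\<in>UNIV. X $ Inl j * wd j R z) = 0 \<and> (\<forall>j. X $ Inr j = 0)"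
  and T01_iff: "X \<in> T01 \<rho> z \<longleftrightarrow> (\<Sum>j\<in>UNIV. X $ Inr j * wdb j R z) = 0 \<and> (\<forall>j. X $ Inl j = 0)"
  by (auto simp: T10_def T01_def ctangent_iff)

lemma frame_T10: "z \<in> W \<Longrightarrow> Z \<alpha> z \<in> T10 \<rho> z"
  by (simp add: T10_iff sum_frame ct_dR)

lemma frameb_T01: "z \<in> W \<Longrightarrow> Zb \<alpha> z \<in> T01 \<rho> z"
  by (simp add: T01_iff sum_frameb ctb_dR)

text \<open>The component along \<open>\<partial>\<^sub>w\<close> of a \<open>(1,0)\<close> vector tangent to \<open>M\<close> is determined by the others, as
  \<open>\<rho>\<^sub>w \<noteq> 0\<close>; hence the \<open>Z\<^sub>\<alpha>\<close> form a frame.\<close>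
lemma T10_expand:
  assumes z: "z \<in> W" and X: "X \<in> T10 \<rho> z"
  shows "X = (\<Sum>\<mu>\<in>UNIV. X $ Inl (Some \<mu>) *s Z \<mu> z)"
proof -
  have "X $ Inl None = - (\<Sum>\<mu>\<in>UNIV. X $ Inl (Some \<mu>) * slope \<mu> z)"
  proof -
    have "X $ Inl None * wd None R z + (\<Sum>\<mu>\<in>UNIV. X $ Inl (Some \<mu>) * wd (Some \<mu>) R z) = 0"
      using X by (simp add: T10_iff sum_option)
    moreover have "(\<Sum>\<mu>\<in>UNIV. X $ Inl (Some \<mu>) * wd (Some \<mu>) R z) = (\<Sum>\<mu>\<in>UNIV. X $ Inl (Some \<mu>) * slope \<mu> z) * wd None R z"
      using Rw_nz[OF z] by (simp add: slope_def sum_distrib_right)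
    ultimately have "(X $ Inl None + (\<Sum>\<mu>\<in>UNIV. X $ Inl (Some \<mu>) * slope \<mu> z)) * wd None R z = 0"
      by (simp add: distrib_right)
    then show ?thesis using Rw_nz[OF z] by (simp add: eq_neg_iff_add_eq_0)
  qed
  then have "X $ Inl j = (\<Sum>\<mu>\<in>UNIV. X $ Inl (Some \<mu>) *s Z \<mu> z) $ Inl j" for j
    by (cases j) (simp_all add: sum_negf if_one_mult)
  moreover have "X $ Inr j = (\<Sum>\<mu>\<in>UNIV. X $ Inl (Some \<mu>) *s Z \<mu> z) $ Inr j" for j
    using X by (simp add: T10_iff)
  ultimately show ?thesis unfolding vec_eq_sum_iff by blast
qed

subsection \<open>The Levi form\<close>

text \<open>Since the coefficients of \<open>\<theta>\<close> are of type \<open>(0,1)\<close> and the second barred derivatives of \<open>\<rho>\<close> are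
  symmetric, only the mixed second derivatives survive the antisymmetrisation.\<close>
lemma levi_form_eq:
  assumes "z \<in> W"
  shows "levi_form \<rho> z X Y =
    (\<Sum>j\<in>UNIV. \<Sum>k\<in>UNIV. wd j (wdb k R) z * (X $ Inl j * Y $ Inr k - X $ Inr k * Y $ Inl j))"
proof -
  have c: "wd j (\<lambda>x. \<i> * wdb k R x) z = \<i> * wd j (wdb k R) z"
          "wdb j (\<lambda>x. \<i> * wdb k R x) z = \<i> * wdb j (wdb k R) z" for j k
    using pd_mult[of "\<lambda>x. \<i>" z "wdb k R" "Inl j"] pd_mult[of "\<lambda>x. \<i>" z "wdb k R" "Inr j"]
      diffW[OF smooth_on_wdb[OF open_W smooth_R_W] assms] pd_const[of "Inl j"] pd_const[of "Inr j"] by simp_all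
  have 0: "wd j (\<lambda>x. 0) z = 0" "wdb j (\<lambda>x. 0) z = 0" for j
    using pd_const[of "Inl j" 0 z] pd_const[of "Inr j" 0 z] by simp_all
  define S where "S = (\<Sum>l\<in>UNIV. \<Sum>k\<in>UNIV. wdb l (wdb k R) z * (X $ Inr l * Y $ Inr k - X $ Inr k * Y $ Inr l))"
  have "S = (\<Sum>l\<in>UNIV. \<Sum>k\<in>UNIV. wdb k (wdb l R) z * (X $ Inr k * Y $ Inr l - X $ Inr l * Y $ Inr k))"
    unfolding S_def by (rule sum.swap)
  also have "\<dots> = - S"
    unfolding S_def sum_negf[symmetric]
    by (intro sum.cong refl) (simp add: wdb_wdb_commute[OF smooth_R_W assms] algebra_simps)
  finally have "S = 0" by simp
  have "levi_form \<rho> z X Y = - \<i> * (\<i> * (\<Sum>j\<in>UNIV. \<Sum>k\<in>UNIV. wd j (wdb k R) z * (X $ Inl j * Y $ Inr k - X $ Inr k * Y $ Inl j)) + \<i> * S)"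
    unfolding levi_form_def dtheta_def ext_deriv_def S_def
    by (simp add: sum_sum_type c 0 sum_distrib_left mult.assoc)
  then show ?thesis using \<open>S = 0\<close> by (simp add: mult.assoc[symmetric])
qed

lemma levi_form_add: "levi_form \<rho> z (X + Y) V = levi_form \<rho> z X V + levi_form \<rho> z Y V"
  and levi_form_add2: "levi_form \<rho> z V (X + Y) = levi_form \<rho> z V X + levi_form \<rho> z V Y"
  and levi_form_scale: "levi_form \<rho> z (c *s X) V = c * levi_form \<rho> z X V"
  and levi_form_scale2: "levi_form \<rho> z V (c *s X) = c * levi_form \<rho> z V X"
  by (simp_all add: levi_form_def dtheta_def ext_deriv_def sum_distrib_left algebra_simps flip: sum.distrib)

lemma levi_form_diff: "levi_form \<rho> z (X - Y) V = levi_form \<rho> z X V - levi_form \<rho> z Y V"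
  using levi_form_add[of z X "(-1) *s Y" V] levi_form_scale[of z "-1" Y V] by simp

lemma levi_form_zero: "levi_form \<rho> z 0 V = 0" "levi_form \<rho> z V 0 = 0"
  by (simp_all add: levi_form_def dtheta_def ext_deriv_def)

lemma levi_form_sum: "levi_form \<rho> z (\<Sum>i\<in>I. f i) V = (\<Sum>i\<in>I. levi_form \<rho> z (f i) V)"
  and levi_form_sum2: "levi_form \<rho> z V (\<Sum>i\<in>I. f i) = (\<Sum>i\<in>I. levi_form \<rho> z V (f i))"
  by (induction I rule: infinite_finite_induct) (auto simp: levi_form_zero levi_form_add levi_form_add2)

lemma levi_form_frameb:
  assumes "z \<in> W"
  shows "levi_form \<rho> z X (Zb \<sigma> z) = (\<Sum>j\<in>UNIV. X $ Inl j * ctb \<sigma> z (\<lambda>k. wd j (wdb k R) z))"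
  unfolding levi_form_eq[OF assms] sum_frameb[symmetric]
  by (simp add: sum_distrib_left mult_ac)

lemma levi_eq: "z \<in> W \<Longrightarrow> h z \<alpha> \<beta> = ct \<alpha> z (\<lambda>j. ctb \<beta> z (\<lambda>k. wd j (wdb k R) z))"
  by (simp add: levi_def levi_form_frameb sum_frame)

lemma levi_form_cnj:
  assumes "z \<in> W" "\<forall>j. X $ Inr j = 0" "\<forall>j. Y $ Inl j = 0"
  shows "cnj (levi_form \<rho> z X Y) = levi_form \<rho> z (vconj Y) (vconj X)"
  using assms by (simp add: levi_form_eq cnj_R2) (subst sum.swap, simp add: mult_ac)

lemma cnj_levi: "z \<in> W \<Longrightarrow> cnj (h z \<alpha> \<beta>) = h z \<beta> \<alpha>"
  unfolding levi_def by (subst levi_form_cnj) (simp_all add: frameb_def)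

lemma smooth_levi: "smooth_on W (\<lambda>z. h z \<alpha> \<beta>)"
  by (rule smooth_on_cong[OF open_W, where f="\<lambda>z. ct \<alpha> z (\<lambda>j. ctb \<beta> z (\<lambda>k. wd j (wdb k R) z))"])
    (auto intro!: smooth_ct smooth_ctb smooth_intros simp: levi_eq)

text \<open>Nondegeneracy, tested against the frame.\<close>
lemma T10_zero:
  assumes z: "z \<in> M" and X: "X \<in> T10 \<rho> z" and 0: "\<And>\<sigma>. levi_form \<rho> z X (Zb \<sigma> z) = 0"
  shows "X = 0"
proof -
  have "levi_form \<rho> z X (vconj Y) = 0" if "Y \<in> T10 \<rho> z" for Y
  proof -
    have "vconj Y = (\<Sum>\<mu>\<in>UNIV. cnj (Y $ Inl (Some \<mu>)) *s Zb \<mu> z)"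
      by (subst T10_expand[OF M_W[OF z] that]) (simp add: vconj_sum vconj_scale frameb_def)
    then show ?thesis by (simp add: levi_form_sum2 levi_form_scale2 0)
  qed
  then show ?thesis using nondegenerate z X unfolding levi_nondegenerate_def by blast
qed

end

section \<open>Fields that are smooth near the hypersurface\<close>

lemma smooth_nearI: "open W \<Longrightarrow> M \<subseteq> W \<Longrightarrow> smooth_on W f \<Longrightarrow> smooth_near M f"
  unfolding smooth_near_def by blast

lemma smooth_near_common:
  assumes "smooth_near M f" "smooth_near M g"
  obtains W where "open W" "M \<subseteq> W" "smooth_on W f" "smooth_on W g"
proof -
  obtain W1 W2 where "open W1" "M \<subseteq> W1" "smooth_on W1 f" "open W2" "M \<subseteq> W2" "smooth_on W2 g"
    using assms unfolding smooth_near_def by blast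
  then show ?thesis
    by (intro that[of "W1 \<inter> W2"]) (auto intro: smooth_on_subset)
qed

lemma smooth_near_binary:
  assumes "smooth_near M f" "smooth_near M g"
    and "\<And>W. open W \<Longrightarrow> smooth_on W f \<Longrightarrow> smooth_on W g \<Longrightarrow> smooth_on W h"
  shows "smooth_near M h"
proof -
  obtain W where "open W" "M \<subseteq> W" "smooth_on W f" "smooth_on W g"
    using smooth_near_common[OF assms(1,2)] .
  then show ?thesis by (intro smooth_nearI[of W] assms(3))
qed

lemma smooth_near_const [simp]: "smooth_near M (\<lambda>x. c)"
  by (rule smooth_nearI[of UNIV]) auto

lemma smooth_near_add: "smooth_near M f \<Longrightarrow> smooth_near M g \<Longrightarrow> smooth_near M (\<lambda>x. f x + g x)"
  by (rule smooth_near_binary[OF _ _ smooth_on_add])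

lemma smooth_near_diff: "smooth_near M f \<Longrightarrow> smooth_near M g \<Longrightarrow> smooth_near M (\<lambda>x. f x - g x)"
  by (rule smooth_near_binary[OF _ _ smooth_on_diff])

lemma smooth_near_mult: "smooth_near M f \<Longrightarrow> smooth_near M g \<Longrightarrow> smooth_near M (\<lambda>x. f x * g x :: complex)"
  by (rule smooth_near_binary[OF _ _ smooth_on_mult])

lemma smooth_near_cnj: "smooth_near M f \<Longrightarrow> smooth_near M (\<lambda>x. cnj (f x))"
  unfolding smooth_near_def using smooth_on_cnj by blast

lemma smooth_near_sum:
  "(\<And>i. i \<in> I \<Longrightarrow> smooth_near M (f i)) \<Longrightarrow> smooth_near M (\<lambda>x. \<Sum>i\<in>I. f i x)"
  by (induction I rule: infinite_finite_induct) (auto intro: smooth_near_add)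

lemma smooth_near_nth: "smooth_near M f \<Longrightarrow> smooth_near M (\<lambda>x. (f x :: complex^'k::finite) $ i)"
  unfolding smooth_near_def using smooth_on_nth by blast

lemma smooth_near_vec:
  assumes "\<And>i. smooth_near M (\<lambda>x. (f x :: complex^'k::finite) $ i)"
  shows "smooth_near M f"
proof -
  obtain W where W: "\<And>i. open (W i) \<and> M \<subseteq> W i \<and> smooth_on (W i) (\<lambda>x. f x $ i)"
    using assms unfolding smooth_near_def by metis
  have "open (\<Inter>i. W i)" using W by (intro open_INT) auto
  moreover have "smooth_on (\<Inter>i. W i) (\<lambda>x. f x $ i)" for i
    by (rule smooth_on_subset[of "W i"]) (use W in auto)
  ultimately show ?thesis
    using W by (intro smooth_nearI[of "\<Inter>i. W i"] smooth_on_vec) auto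
qed

lemma smooth_near_scale: "smooth_near M f \<Longrightarrow> smooth_near M X \<Longrightarrow> smooth_near M (\<lambda>x. f x *s (X x :: complex^'k::finite))"
  by (intro smooth_near_vec) (simp add: smooth_near_mult smooth_near_nth)

lemma smooth_near_vconj: "smooth_near M X \<Longrightarrow> smooth_near M (\<lambda>x. vconj (X x))"
  by (intro smooth_near_vec) (simp add: vconj_def smooth_near_cnj smooth_near_nth)

lemma smooth_near_differentiable: "smooth_near M f \<Longrightarrow> z \<in> M \<Longrightarrow> f differentiable at z"
  unfolding smooth_near_def using smooth_on_differentiable by blast

lemma smooth_near_pd: "smooth_near M f \<Longrightarrow> smooth_near M (pd A f)"
  unfolding smooth_near_def using pd_smooth_on by blast

lemma smooth_near_vderiv: "smooth_near M X \<Longrightarrow> smooth_near M f \<Longrightarrow> smooth_near M (vderiv X f)"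
  unfolding vderiv_def[abs_def] by (intro smooth_near_sum smooth_near_mult smooth_near_nth smooth_near_pd)

lemma smooth_near_bracket: "smooth_near M X \<Longrightarrow> smooth_near M Y \<Longrightarrow> smooth_near M (bracket X Y)"
  by (intro smooth_near_vec) (simp add: bracket_def smooth_near_diff smooth_near_vderiv smooth_near_nth)

context hypersurface
begin

lemma smooth_near_W: "smooth_on W f \<Longrightarrow> smooth_near M f"
  by (rule smooth_nearI[OF open_W M_sub_W])

lemma vderiv_eq_on_M:
  assumes "z \<in> M" "f differentiable at z" "g differentiable at z" "\<And>x. x \<in> M \<Longrightarrow> f x = g x" "X z \<in> ctangent \<rho> z"
  shows "vderiv X f z = vderiv X g z"
proof (rule vderiv_eq_on_zero_set[OF open_U smooth_\<rho>])
  show "pd (Inl None) R z \<noteq> 0" using Rw_nz[OF M_W[OF assms(1)]] by simp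
qed (use assms M_eq in auto)

lemma vfieldsD: "X \<in> vfields \<rho> M \<Longrightarrow> smooth_near M X" "X \<in> vfields \<rho> M \<Longrightarrow> z \<in> M \<Longrightarrow> X z \<in> ctangent \<rho> z"
  by (auto simp: vfields_def)

lemma vfields10D: "X \<in> vfields10 \<rho> M \<Longrightarrow> X \<in> vfields \<rho> M" "X \<in> vfields10 \<rho> M \<Longrightarrow> z \<in> M \<Longrightarrow> X z \<in> T10 \<rho> z"
  by (auto simp: vfields10_def)

lemma T10_ctangent: "X \<in> T10 \<rho> z \<Longrightarrow> X \<in> ctangent \<rho> z" and T01_ctangent: "X \<in> T01 \<rho> z \<Longrightarrow> X \<in> ctangent \<rho> z"
  by (auto simp: T10_def T01_def)

lemma ctangent_add: "X \<in> ctangent \<rho> z \<Longrightarrow> Y \<in> ctangent \<rho> z \<Longrightarrow> X + Y \<in> ctangent \<rho> z"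
  and ctangent_scale: "X \<in> ctangent \<rho> z \<Longrightarrow> c *s X \<in> ctangent \<rho> z"
  and ctangent_zero: "0 \<in> ctangent \<rho> z"
  by (simp_all add: ctangent_def distrib_right sum.distrib mult.assoc flip: sum_distrib_left)

lemma vconj_ctangent:
  assumes z: "z \<in> W" and X: "X \<in> ctangent \<rho> z" shows "vconj X \<in> ctangent \<rho> z"
proof -
  have "(\<Sum>j\<in>UNIV. vconj X $ Inl j * wd j R z) + (\<Sum>j\<in>UNIV. vconj X $ Inr j * wdb j R z)
      = cnj ((\<Sum>j\<in>UNIV. X $ Inl j * wd j R z) + (\<Sum>j\<in>UNIV. X $ Inr j * wdb j R z))"
    by (simp add: cnj_wd_R[OF z] cnj_wdb_R[OF z])
  also have "\<dots> = 0" using X by (simp only: ctangent_iff complex_cnj_zero)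
  finally show ?thesis by (simp only: ctangent_iff)
qed

lemma vfields_add: "X \<in> vfields \<rho> M \<Longrightarrow> Y \<in> vfields \<rho> M \<Longrightarrow> (\<lambda>x. X x + Y x) \<in> vfields \<rho> M"
  and vfields_scale: "smooth_near M f \<Longrightarrow> X \<in> vfields \<rho> M \<Longrightarrow> (\<lambda>x. f x *s X x) \<in> vfields \<rho> M"
  and vfields_vconj: "X \<in> vfields \<rho> M \<Longrightarrow> (\<lambda>x. vconj (X x)) \<in> vfields \<rho> M"
  and vfields_zero: "(\<lambda>x. 0) \<in> vfields \<rho> M"
  by (auto simp: vfields_def intro: smooth_near_add smooth_near_scale smooth_near_vconj
      ctangent_add ctangent_scale ctangent_zero vconj_ctangent M_W)

lemma vfields_sum: "(\<And>i. i \<in> I \<Longrightarrow> X i \<in> vfields \<rho> M) \<Longrightarrow> (\<lambda>x. \<Sum>i\<in>I. X i x) \<in> vfields \<rho> M"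
  by (induction I rule: infinite_finite_induct) (auto intro: vfields_add vfields_zero)

lemma frame_vfields10: "Z \<alpha> \<in> vfields10 \<rho> M"
proof -
  have "smooth_near M (Z \<alpha>)"
  proof (rule smooth_near_vec)
    fix A :: "'n option + 'n option"
    consider \<mu> where "A = Inl (Some \<mu>)" | "A = Inl None" | j where "A = Inr j"
      by (metis option.exhaust sum.exhaust)
    then show "smooth_near M (\<lambda>x. Z \<alpha> x $ A)"
      by cases (simp_all add: smooth_near_W smooth_on_minus[OF open_W smooth_slope])
  qed
  then show ?thesis
    by (auto simp: vfields10_def vfields_def intro: frame_T10 M_W T10_ctangent)
qed

lemma frameb_eq: "Zb \<alpha> = (\<lambda>x. vconj (Z \<alpha> x))"
  and frame_eq: "Z \<alpha> = (\<lambda>x. vconj (Zb \<alpha> x))"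
  by (simp_all add: fun_eq_iff frameb_def)

lemma frame_vfields: "Z \<alpha> \<in> vfields \<rho> M" and frameb_vfields: "Zb \<alpha> \<in> vfields \<rho> M"
  using vfields10D(1)[OF frame_vfields10] vfields_vconj by (auto simp: frameb_eq)

lemma smooth_near_levi_form:
  assumes "smooth_near M X" "smooth_near M Y"
  shows "smooth_near M (\<lambda>x. levi_form \<rho> x (X x) (Y x))"
proof -
  obtain V where V: "open V" "M \<subseteq> V" "smooth_on V X" "smooth_on V Y"
    using smooth_near_common[OF assms] .
  have o: "open (V \<inter> W)" using V open_W by auto
  have s: "smooth_on (V \<inter> W) X" "smooth_on (V \<inter> W) Y" "smooth_on (V \<inter> W) (wd j (wdb k R))" for j k
    using V smooth_on_wd[OF open_W smooth_on_wdb[OF open_W smooth_R_W]] by (auto intro: smooth_on_subset)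
  have "smooth_on (V \<inter> W) (\<lambda>x. \<Sum>j\<in>UNIV. \<Sum>k\<in>UNIV. wd j (wdb k R) x * (X x $ Inl j * Y x $ Inr k - X x $ Inr k * Y x $ Inl j))"
    by (intro smooth_on_sum smooth_on_mult smooth_on_diff smooth_on_nth o s)
  then have "smooth_on (V \<inter> W) (\<lambda>x. levi_form \<rho> x (X x) (Y x))"
    by (rule smooth_on_cong[OF o]) (simp add: levi_form_eq)
  then show ?thesis by (rule smooth_nearI[OF o, rotated]) (use V M_sub_W in auto)
qed

end

section \<open>Derivatives of the Levi form in the frame\<close>

context hypersurface
begin

text \<open>In the names below \<open>N\<close> stands for the vector \<open>\<rho>\<^sub>w\<^sup>-\<^sup>1 \<partial>\<^sub>w\<close>, and \<open>Nb\<close> for its conjugate, in one of the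
  slots: \<open>hN\<close> and \<open>rNN\<close> are second derivatives of \<open>\<rho>\<close>, \<open>t3N\<close> and \<open>t3Nb\<close> third derivatives. On \<open>M\<close>,
  \<open>q\<close> is the Levi pairing of \<open>\<eta> = \<xi> - N\<close> with the conjugate frame (\<open>levi_eta\<close>).\<close>

definition hh where "hh \<alpha> \<gamma> z = ct \<alpha> z (\<lambda>i. ct \<gamma> z (\<lambda>j. wd i (wd j R) z))"

definition q where "q \<sigma> z = - ctb \<sigma> z (\<lambda>k. wd None (wdb k R) z) / wd None R z"

abbreviation "R3 i j k z \<equiv> wd i (wd j (wdb k R)) z"

definition t3 where "t3 \<alpha> \<gamma> \<sigma> z = ct \<alpha> z (\<lambda>i. ct \<gamma> z (\<lambda>j. ctb \<sigma> z (\<lambda>k. R3 i j k z)))"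
definition t3N where "t3N \<gamma> \<sigma> z = ct \<gamma> z (\<lambda>j. ctb \<sigma> z (\<lambda>k. R3 None j k z)) / wd None R z"
definition t3Nb where "t3Nb \<alpha> \<gamma> z = ct \<alpha> z (\<lambda>i. ct \<gamma> z (\<lambda>j. R3 i j None z)) / wdb None R z"
definition hN where "hN \<gamma> z = ct \<gamma> z (\<lambda>j. wd None (wd j R) z) / wd None R z"
definition rNN where "rNN z = wd None (wdb None R) z / (wd None R z * wdb None R z)"
definition t4 where "t4 \<alpha> \<beta> \<gamma> \<sigma> z =
  ct \<alpha> z (\<lambda>i. ctb \<beta> z (\<lambda>m. ct \<gamma> z (\<lambda>j. ctb \<sigma> z (\<lambda>k. wd i (wdb m (wd j (wdb k R))) z))))"

lemma smooth_R3: "smooth_on W (wd j (wdb k R))" "smooth_on W (wd i (wd j R))" "smooth_on W (wd i (wd j (wdb k R)))"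
  by (intro smooth_intros)+

lemma hh_sym: "z \<in> W \<Longrightarrow> hh \<alpha> \<gamma> z = hh \<gamma> \<alpha> z"
  unfolding hh_def by (subst ct_ct_swap) (simp add: wd_wd_commute[OF smooth_R_W])

lemma R3_sym: "z \<in> W \<Longrightarrow> R3 i j k z = R3 j i k z"
  by (rule wd_wd_commute[OF smooth_on_wdb[OF open_W smooth_R_W]])

lemma slope_frame: "z \<in> W \<Longrightarrow> vderiv (Z \<alpha>) (slope \<gamma>) z = hh \<alpha> \<gamma> z / wd None R z"
  by (subst vderiv_slope) (simp_all add: vderiv_frame hh_def ct_ct_swap[of \<alpha>])

lemma slope_frameb: "z \<in> W \<Longrightarrow> vderiv (Zb \<beta>) (slope \<gamma>) z = h z \<gamma> \<beta> / wd None R z"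
  by (subst vderiv_slope) (simp_all add: vderiv_frameb levi_eq wd_wdb_commute[OF smooth_R_W])

lemma cnj_slope_frame: "z \<in> W \<Longrightarrow> vderiv (Z \<alpha>) (\<lambda>x. cnj (slope \<sigma> x)) z = h z \<alpha> \<sigma> / wdb None R z"
  by (subst vderiv_cnj_slope) (simp_all add: vderiv_frame levi_eq ct_ctb_swap)

lemma cnj_hh: "z \<in> W \<Longrightarrow> cnj (hh \<alpha> \<gamma> z) = ctb \<alpha> z (\<lambda>i. ctb \<gamma> z (\<lambda>j. wdb i (wdb j R) z))"
  by (simp add: hh_def cnj_ct cnj_R2)

lemma cnj_slope_frameb: "z \<in> W \<Longrightarrow> vderiv (Zb \<beta>) (\<lambda>x. cnj (slope \<sigma> x)) z = cnj (hh \<beta> \<sigma> z) / wdb None R z"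
  by (subst vderiv_cnj_slope) (simp_all add: vderiv_frameb cnj_hh ctb_ctb_swap[of \<beta>])

lemma cnj_q: "z \<in> W \<Longrightarrow> cnj (q \<gamma> z) = - ct \<gamma> z (\<lambda>j. wd j (wdb None R) z) / wdb None R z"
  by (simp add: q_def cnj_ctb cnj_R2 cnj_wd_R)

lemma q_alt: "z \<in> W \<Longrightarrow> ctb \<sigma> z (\<lambda>k. wd None (wdb k R) z) = - q \<sigma> z * wd None R z"
  by (simp add: q_def Rw_nz)

lemma cnj_q_alt: "z \<in> W \<Longrightarrow> ct \<gamma> z (\<lambda>j. wd j (wdb None R) z) = - cnj (q \<gamma> z) * wdb None R z"
  by (simp add: cnj_q Rwb_nz)

text \<open>This lemma and the next four differentiate the Levi form and the ingredients of the Christoffel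
  symbols. In each of them, apart from the derivative of the contracted tensor, there are terms
  from the slopes of the contracted frame vectors and, for \<open>q\<close>, from the factor \<open>\<rho>\<^sub>w\<close>.\<close>
lemma frame_levi:
  assumes z: "z \<in> W"
  shows "vderiv (Z \<alpha>) (\<lambda>x. h x \<gamma> \<sigma>) z = t3 \<alpha> \<gamma> \<sigma> z + hh \<alpha> \<gamma> z * q \<sigma> z + h z \<alpha> \<sigma> * cnj (q \<gamma> z)"
proof -
  have "vderiv (Z \<alpha>) (\<lambda>x. h x \<gamma> \<sigma>) z
      = vderiv (Z \<alpha>) (\<lambda>x. ct \<gamma> x (\<lambda>j. ctb \<sigma> x (\<lambda>k. wd j (wdb k R) x))) z"
    by (rule vderiv_cong_open[OF open_W z _ diffW[OF smooth_levi z]]) (simp add: levi_eq)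
  also have "\<dots> = ct \<gamma> z (\<lambda>j. vderiv (Z \<alpha>) (\<lambda>x. ctb \<sigma> x (\<lambda>k. wd j (wdb k R) x)) z)
      - hh \<alpha> \<gamma> z / wd None R z * ctb \<sigma> z (\<lambda>k. wd None (wdb k R) z)"
    by (subst vderiv_ct[OF z]) (simp_all add: smooth_ctb smooth_R3 slope_frame[OF z])
  also have "(\<lambda>j. vderiv (Z \<alpha>) (\<lambda>x. ctb \<sigma> x (\<lambda>k. wd j (wdb k R) x)) z)
      = (\<lambda>j. ctb \<sigma> z (\<lambda>k. ct \<alpha> z (\<lambda>i. R3 i j k z)) - h z \<alpha> \<sigma> / wdb None R z * wd j (wdb None R) z)"
    by (subst vderiv_ctb[OF z]) (simp_all add: smooth_R3 vderiv_frame cnj_slope_frame[unfolded vderiv_frame] z)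
  also have "ct \<gamma> z \<dots> = t3 \<alpha> \<gamma> \<sigma> z + h z \<alpha> \<sigma> * cnj (q \<gamma> z)"
    using Rwb_nz[OF z] by (simp add: ct_linear cnj_q_alt[OF z] t3_def ct_ct_swap[of \<alpha>] ct_ctb_swap)
  finally show ?thesis using Rw_nz[OF z] by (simp add: q_alt[OF z])
qed

lemma frame_q:
  assumes z: "z \<in> W"
  shows "vderiv (Z \<alpha>) (q \<sigma>) z = - t3N \<alpha> \<sigma> z + h z \<alpha> \<sigma> * rNN z - q \<sigma> z * hN \<alpha> z"
proof -
  have s: "smooth_on W (\<lambda>x. ctb \<sigma> x (\<lambda>k. wd None (wdb k R) x))" "smooth_on W (wd None R)"
    by (intro smooth_ctb smooth_R3 smooth_intros)+
  have 1: "vderiv (Z \<alpha>) (\<lambda>x. ctb \<sigma> x (\<lambda>k. wd None (wdb k R) x)) z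
      = ctb \<sigma> z (\<lambda>k. ct \<alpha> z (\<lambda>i. R3 None i k z)) - h z \<alpha> \<sigma> / wdb None R z * wd None (wdb None R) z"
    by (subst vderiv_ctb[OF z])
      (simp_all add: smooth_R3 vderiv_frame cnj_slope_frame[unfolded vderiv_frame] z R3_sym[OF z, of _ None])
  have "vderiv (Z \<alpha>) (q \<sigma>) z = (- vderiv (Z \<alpha>) (\<lambda>x. ctb \<sigma> x (\<lambda>k. wd None (wdb k R) x)) z
      - q \<sigma> z * vderiv (Z \<alpha>) (wd None R) z) / wd None R z"
    unfolding q_def[abs_def]
    using diffW[OF s(1) z] diffW[OF s(2) z] Rw_nz[OF z]
    by (subst vderiv_divide) (simp_all add: vderiv_minus)
  also have "vderiv (Z \<alpha>) (wd None R) z = hN \<alpha> z * wd None R z"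
    using Rw_nz[OF z] by (simp add: vderiv_frame hN_def wd_wd_commute[OF smooth_R_W z, of None])
  finally show ?thesis
    unfolding 1 t3N_def rNN_def using Rw_nz[OF z] Rwb_nz[OF z]
    by (simp add: ct_ctb_swap field_simps)
qed

lemma frameb_q:
  assumes z: "z \<in> W"
  shows "vderiv (Zb \<beta>) (q \<sigma>) z = - cnj (t3Nb \<beta> \<sigma> z) + cnj (hh \<beta> \<sigma> z) * rNN z + q \<sigma> z * q \<beta> z"
proof -
  have s: "smooth_on W (\<lambda>x. ctb \<sigma> x (\<lambda>k. wd None (wdb k R) x))" "smooth_on W (wd None R)"
    by (intro smooth_ctb smooth_R3 smooth_intros)+
  have c: "wdb m (wd None (wdb k R)) z = cnj (R3 m k None z)" for m k
  proof -
    have "cnj (R3 m k None z) = wdb m (wdb k (wd None R)) z" by (rule cnj_R3[OF z])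
    also have "\<dots> = wdb m (wd None (wdb k R)) z"
      by (rule wdb_congW[OF z]) (auto intro!: smooth_intros wd_wdb_commute)
    finally show ?thesis ..
  qed
  have 1: "vderiv (Zb \<beta>) (\<lambda>x. ctb \<sigma> x (\<lambda>k. wd None (wdb k R) x)) z
      = cnj (t3Nb \<beta> \<sigma> z * wdb None R z) - cnj (hh \<beta> \<sigma> z) / wdb None R z * wd None (wdb None R) z"
    using Rwb_nz[OF z]
    by (subst vderiv_ctb[OF z])
      (simp_all add: smooth_R3 vderiv_frameb cnj_slope_frameb[unfolded vderiv_frameb] z c t3Nb_def cnj_ct ctb_ctb_swap[of \<beta>])
  have "vderiv (Zb \<beta>) (q \<sigma>) z = (- vderiv (Zb \<beta>) (\<lambda>x. ctb \<sigma> x (\<lambda>k. wd None (wdb k R) x)) z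
      - q \<sigma> z * vderiv (Zb \<beta>) (wd None R) z) / wd None R z"
    unfolding q_def[abs_def]
    using diffW[OF s(1) z] diffW[OF s(2) z] Rw_nz[OF z]
    by (subst vderiv_divide) (simp_all add: vderiv_minus)
  also have "vderiv (Zb \<beta>) (wd None R) z = - q \<beta> z * wd None R z"
    by (simp add: vderiv_frameb wd_wdb_commute[OF smooth_R_W z] q_alt[OF z])
  finally show ?thesis
    unfolding 1 rNN_def using Rw_nz[OF z] Rwb_nz[OF z] cnj_wdb_R[OF z, of None]
    by (simp add: field_simps)
qed

lemma frameb_hh:
  assumes z: "z \<in> W"
  shows "vderiv (Zb \<beta>) (hh \<alpha> \<gamma>) z = t3 \<alpha> \<gamma> \<beta> z - h z \<alpha> \<beta> * hN \<gamma> z - h z \<gamma> \<beta> * hN \<alpha> z"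
proof -
  have c: "wdb m (wd i (wd j R)) z = R3 i j m z" for i j m
  proof -
    have "wdb m (wd i (wd j R)) z = wd i (wdb m (wd j R)) z"
      by (rule wd_wdb_commute[OF _ z]) (intro smooth_intros)
    also have "\<dots> = R3 i j m z"
      by (rule wd_congW[OF z]) (auto intro!: smooth_intros wd_wdb_commute)
    finally show ?thesis .
  qed
  have "vderiv (Zb \<beta>) (hh \<alpha> \<gamma>) z
      = ct \<alpha> z (\<lambda>i. vderiv (Zb \<beta>) (\<lambda>x. ct \<gamma> x (\<lambda>j. wd i (wd j R) x)) z)
      - h z \<alpha> \<beta> / wd None R z * ct \<gamma> z (\<lambda>j. wd None (wd j R) z)"
    unfolding hh_def[abs_def]
    by (subst vderiv_ct[OF z]) (simp_all add: smooth_ct smooth_R3 slope_frameb[OF z])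
  also have "(\<lambda>i. vderiv (Zb \<beta>) (\<lambda>x. ct \<gamma> x (\<lambda>j. wd i (wd j R) x)) z)
      = (\<lambda>i. ct \<gamma> z (\<lambda>j. ctb \<beta> z (\<lambda>k. R3 i j k z)) - h z \<gamma> \<beta> / wd None R z * wd None (wd i R) z)"
    by (subst vderiv_ct[OF z])
      (simp_all add: smooth_R3 vderiv_frameb slope_frameb[unfolded vderiv_frameb] z c wd_wd_commute[OF smooth_R_W z, of _ None])
  finally show ?thesis
    using Rw_nz[OF z] by (simp add: ct_linear t3_def hN_def algebra_simps)
qed

lemma frameb_t3:
  assumes z: "z \<in> W"
  shows "vderiv (Zb \<beta>) (t3 \<alpha> \<gamma> \<sigma>) z = t4 \<alpha> \<beta> \<gamma> \<sigma> z
    - h z \<alpha> \<beta> * t3N \<gamma> \<sigma> z - h z \<gamma> \<beta> * t3N \<alpha> \<sigma> z - cnj (hh \<beta> \<sigma> z) * t3Nb \<alpha> \<gamma> z"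
proof -
  have c: "wdb m (wd i (wd j (wdb k R))) z = wd i (wdb m (wd j (wdb k R))) z" for i j k m
    by (rule wd_wdb_commute[OF _ z]) (intro smooth_intros)
  have "vderiv (Zb \<beta>) (t3 \<alpha> \<gamma> \<sigma>) z
      = ct \<alpha> z (\<lambda>i. vderiv (Zb \<beta>) (\<lambda>x. ct \<gamma> x (\<lambda>j. ctb \<sigma> x (\<lambda>k. R3 i j k x))) z)
      - h z \<alpha> \<beta> * t3N \<gamma> \<sigma> z"
    unfolding t3_def[abs_def] t3N_def
    by (subst vderiv_ct[OF z]) (simp_all add: smooth_ct smooth_ctb smooth_R3 slope_frameb[OF z])
  also have "(\<lambda>i. vderiv (Zb \<beta>) (\<lambda>x. ct \<gamma> x (\<lambda>j. ctb \<sigma> x (\<lambda>k. R3 i j k x))) z)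
      = (\<lambda>i. ct \<gamma> z (\<lambda>j. vderiv (Zb \<beta>) (\<lambda>x. ctb \<sigma> x (\<lambda>k. R3 i j k x)) z)
         - h z \<gamma> \<beta> / wd None R z * ctb \<sigma> z (\<lambda>k. R3 None i k z))"
    by (subst vderiv_ct[OF z])
      (simp_all add: smooth_ctb smooth_R3 slope_frameb[OF z] z R3_sym[OF z, of _ None])
  also have "(\<lambda>i. ct \<gamma> z (\<lambda>j. vderiv (Zb \<beta>) (\<lambda>x. ctb \<sigma> x (\<lambda>k. R3 i j k x)) z)
         - h z \<gamma> \<beta> / wd None R z * ctb \<sigma> z (\<lambda>k. R3 None i k z))
      = (\<lambda>i. ct \<gamma> z (\<lambda>j. ctb \<sigma> z (\<lambda>k. ctb \<beta> z (\<lambda>m. wd i (wdb m (wd j (wdb k R))) z))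
           - cnj (hh \<beta> \<sigma> z) / wdb None R z * R3 i j None z)
         - h z \<gamma> \<beta> / wd None R z * ctb \<sigma> z (\<lambda>k. R3 None i k z))"
    by (subst vderiv_ctb[OF z])
      (simp_all add: smooth_R3 vderiv_frameb cnj_slope_frameb[unfolded vderiv_frameb] z c)
  finally show ?thesis
    by (simp add: ct_linear t4_def t3N_def t3Nb_def ctb_ctb_swap[of \<sigma>] ct_ctb_swap algebra_simps)
qed

end

section \<open>The Tanaka--Webster connection in the frame\<close>

locale webster_connection = hypersurface \<rho> U M
  for \<rho> :: "complex^('n::finite option) \<Rightarrow> real" and U M :: "(complex^('n option)) set" +
  fixes T :: "'n option field" and nabla :: "'n option field \<Rightarrow> 'n option field \<Rightarrow> 'n option field"
  assumes reeb: "reeb_field \<rho> M T" and tw: "tanaka_webster \<rho> M T nabla"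
begin

lemmas connection = conjunct1[OF tw[unfolded tanaka_webster_def], unfolded linear_connection_def]
  and webster = conjunct2[OF tw[unfolded tanaka_webster_def]]

lemmas nabla_vfields = connection[THEN conjunct1, rule_format]
  and nabla_add = connection[THEN conjunct2, THEN conjunct2, THEN conjunct1, rule_format]
  and nabla_scale = connection[THEN conjunct2, THEN conjunct2, THEN conjunct2, THEN conjunct1, rule_format]
  and nabla_vconj = connection[THEN conjunct2, THEN conjunct2, THEN conjunct2, THEN conjunct2, THEN conjunct2, THEN conjunct2, rule_format]
  and nabla_T10 = webster[THEN conjunct1, rule_format]
  and nabla_theta = webster[THEN conjunct2, THEN conjunct1, rule_format, symmetric]
  and nabla_dtheta = webster[THEN conjunct2, THEN conjunct2, THEN conjunct1, rule_format]
  and torsion_frame = webster[THEN conjunct2, THEN conjunct2, THEN conjunct2, rule_format, THEN conjunct2, THEN conjunct1]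
    webster[THEN conjunct2, THEN conjunct2, THEN conjunct2, rule_format, THEN conjunct2, THEN conjunct2]

lemma nabla_cong:
  assumes "X \<in> vfields \<rho> M" "X' \<in> vfields \<rho> M" "Y \<in> vfields \<rho> M" "\<And>x. x \<in> M \<Longrightarrow> X x = X' x" "z \<in> M"
  shows "nabla X Y z = nabla X' Y z"
  by (rule connection[THEN conjunct2, THEN conjunct1, rule_format]) (use assms in auto)

text \<open>Parallelism of \<open>d\<theta>\<close>, solved for the term that is to be computed.\<close>
lemma nabla_levi_form:
  assumes X: "X \<in> vfields \<rho> M" and Y: "Y \<in> vfields \<rho> M" and V: "V \<in> vfields \<rho> M" and z: "z \<in> M"
  shows "levi_form \<rho> z (nabla X Y z) (V z)
    = vderiv X (\<lambda>x. levi_form \<rho> x (Y x) (V x)) z - levi_form \<rho> z (Y z) (nabla X V z)"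
proof -
  have d: "(\<lambda>x. levi_form \<rho> x (Y x) (V x)) differentiable at z"
    by (rule smooth_near_differentiable[OF smooth_near_levi_form[OF vfieldsD(1)[OF Y] vfieldsD(1)[OF V]] z])
  have e: "dtheta \<rho> x A B = \<i> * levi_form \<rho> x A B" for x A B by (simp add: levi_form_def)
  have "vderiv X (\<lambda>x. dtheta \<rho> x (Y x) (V x)) z
      = dtheta \<rho> z (nabla X Y z) (V z) + dtheta \<rho> z (Y z) (nabla X V z)"
    by (rule nabla_dtheta[OF X Y V z])
  then have "\<i> * vderiv X (\<lambda>x. levi_form \<rho> x (Y x) (V x)) z
      = \<i> * (levi_form \<rho> z (nabla X Y z) (V z) + levi_form \<rho> z (Y z) (nabla X V z))"
    unfolding e using vderiv_mult[OF differentiable_const d, of X \<i>] by (simp add: distrib_left)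
  then show ?thesis by simp
qed

lemma nabla_zero: "Y \<in> vfields \<rho> M \<Longrightarrow> z \<in> M \<Longrightarrow> nabla (\<lambda>x. 0) Y z = 0"
  using nabla_scale[OF smooth_near_const vfields_zero, of Y z 0] by simp

lemma nabla_sum:
  assumes "\<And>i. i \<in> I \<Longrightarrow> smooth_near M (f i)" "\<And>i. i \<in> I \<Longrightarrow> X i \<in> vfields \<rho> M" "Y \<in> vfields \<rho> M" "z \<in> M" "finite I"
  shows "nabla (\<lambda>x. \<Sum>i\<in>I. f i x *s X i x) Y z = (\<Sum>i\<in>I. f i z *s nabla (X i) Y z)"
  using assms(5,1,2)
proof (induction I rule: finite_induct)
  case empty
  then show ?case using assms by (simp add: nabla_zero)
next
  case (insert i I)
  then have 1: "(\<lambda>x. f i x *s X i x) \<in> vfields \<rho> M" "(\<lambda>x. \<Sum>i\<in>I. f i x *s X i x) \<in> vfields \<rho> M"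
    by (auto intro!: vfields_sum vfields_scale)
  show ?case
    using insert nabla_add[OF 1 assms(3,4)] nabla_scale[of "f i" "X i" Y z] assms by simp
qed

subsection \<open>The Reeb field and the transverse field\<close>

lemma T_vfields: "T \<in> vfields \<rho> M"
  using reeb unfolding reeb_field_def by blast

text \<open>The \<open>(1,0)\<close> part of the Reeb field, times \<open>- \<i>\<close>. It satisfies the equations of the transverse
  field and is smooth, so it can be differentiated; \<open>transverse_unique\<close> identifies it with the field
  \<open>\<xi>\<close> of the theorem.\<close>
definition xi where "xi z j = - \<i> * T z $ Inl j"

lemma T_Inl: "T z $ Inl j = \<i> * xi z j"
  by (simp add: xi_def)

lemma T_Inr:
  assumes "z \<in> M" shows "T z $ Inr k = - \<i> * cnj (xi z k)"
proof -
  have "vconj (T z) = T z" using reeb assms unfolding reeb_field_def by blast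
  then have "T z $ Inr k = vconj (T z) $ Inr k" by simp
  then show ?thesis by (simp add: T_Inl)
qed

lemma smooth_near_xi: "smooth_near M (\<lambda>x. xi x j)"
  unfolding xi_def by (intro smooth_near_mult smooth_near_nth vfieldsD(1)[OF T_vfields]) simp

lemma xi_dR:
  assumes z: "z \<in> M" shows "(\<Sum>j\<in>UNIV. xi z j * wd j R z) = 1"
proof -
  have "theta \<rho> z (T z) = 1" using reeb z unfolding reeb_field_def by blast
  then have "(\<Sum>k\<in>UNIV. cnj (xi z k) * wdb k R z) = 1"
    by (simp add: theta_def form_eval_def sum_sum_type T_Inr[OF z] mult_ac)
  then have "cnj (\<Sum>k\<in>UNIV. cnj (xi z k) * wdb k R z) = 1" by simp
  then show ?thesis by (simp add: cnj_wdb_R[OF M_W[OF z]])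
qed

text \<open>This is \<open>|\<xi>|\<^sup>2\<close>.\<close>
definition rr where "rr z = (\<Sum>j\<in>UNIV. \<Sum>k\<in>UNIV. wd j (wdb k R) z * xi z j * cnj (xi z k))"

text \<open>As the Reeb field annihilates \<open>d\<theta>\<close>, the covector on the left vanishes on the conjugate frame,
  hence is a multiple of the \<open>(0,1)\<close> part of \<open>d\<rho>\<close>. Evaluation on the conjugate of \<open>\<xi>\<close> gives the
  factor.\<close>
lemma xi_R2:
  assumes z: "z \<in> M"
  shows "(\<Sum>j\<in>UNIV. xi z j * wd j (wdb k R) z) = rr z * wdb k R z"
proof -
  note zW = M_W[OF z]
  define v where "v k = (\<Sum>j\<in>UNIV. xi z j * wd j (wdb k R) z)" for k
  define \<mu> where "\<mu> = v None / wdb None R z"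
  have "ctb \<sigma> z v = 0" for \<sigma>
  proof -
    have "dtheta \<rho> z (T z) (Zb \<sigma> z) = 0"
      using reeb z T01_ctangent[OF frameb_T01[OF zW]] unfolding reeb_field_def by blast
    then have "levi_form \<rho> z (T z) (Zb \<sigma> z) = 0" by (simp add: levi_form_def)
    then have "(\<Sum>j\<in>UNIV. xi z j * ctb \<sigma> z (\<lambda>k. wd j (wdb k R) z)) = 0"
      by (simp add: levi_form_frameb[OF zW] T_Inl mult.assoc flip: sum_distrib_left)
    then show ?thesis unfolding v_def by (simp add: ctb_sum ctb_linear)
  qed
  then have v: "v k = \<mu> * wdb k R z" for k
    using Rwb_nz[OF zW] by (cases k) (auto simp: ctb_def \<mu>_def slope_def cnj_wd_R[OF zW])
  have "rr z = (\<Sum>k\<in>UNIV. v k * cnj (xi z k))"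
    unfolding rr_def v_def by (subst sum.swap) (simp add: sum_distrib_right sum_distrib_left mult_ac)
  also have "\<dots> = \<mu> * cnj (\<Sum>k\<in>UNIV. xi z k * wd k R z)"
    by (simp add: v sum_distrib_left mult_ac cnj_wd_R[OF zW])
  finally have "rr z = \<mu>" by (simp add: xi_dR[OF z])
  then show ?thesis using v[of k] by (simp add: v_def)
qed

lemma cnj_rr: "z \<in> M \<Longrightarrow> cnj (rr z) = rr z"
  unfolding rr_def by (subst sum.swap) (simp add: cnj_R2[OF M_W] mult_ac)

lemma cnj_xi_R2:
  assumes z: "z \<in> M"
  shows "(\<Sum>k\<in>UNIV. cnj (xi z k) * wd j (wdb k R) z) = rr z * wd j R z"
proof -
  have "(\<Sum>k\<in>UNIV. cnj (xi z k) * wd j (wdb k R) z) = cnj (\<Sum>k\<in>UNIV. xi z k * wd k (wdb j R) z)"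
    by (simp add: cnj_R2[OF M_W[OF z]])
  also have "\<dots> = rr z * wd j R z"
    by (simp add: xi_R2[OF z] cnj_rr[OF z] cnj_wdb_R[OF M_W[OF z]])
  finally show ?thesis .
qed

text \<open>The tangential vector with the same Greek components as \<open>\<xi>\<close>; it is \<open>\<xi> - N\<close> by \<open>eta_Inl\<close>.\<close>
definition eta where "eta z = (\<Sum>\<mu>\<in>UNIV. xi z (Some \<mu>) *s Z \<mu> z)"

lemma eta_vfields: "eta \<in> vfields \<rho> M"
  unfolding eta_def[abs_def] by (intro vfields_sum vfields_scale smooth_near_xi frame_vfields)

text \<open>The decomposition \<open>\<xi> = \<eta> + N\<close>, applied to a covector.\<close>
lemma xi_contract:
  assumes z: "z \<in> M"
  shows "(\<Sum>\<mu>\<in>UNIV. xi z (Some \<mu>) * ct \<mu> z f) = (\<Sum>j\<in>UNIV. xi z j * f j) - f None / wd None R z"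
proof -
  note zW = M_W[OF z]
  have "(\<Sum>\<mu>\<in>UNIV. xi z (Some \<mu>) * slope \<mu> z) * wd None R z = 1 - xi z None * wd None R z"
    using xi_dR[OF z] Rw_nz[OF zW] by (simp add: sum_option sum_distrib_right slope_def eq_diff_eq add.commute)
  then have "(\<Sum>\<mu>\<in>UNIV. xi z (Some \<mu>) * slope \<mu> z) = 1 / wd None R z - xi z None"
    using Rw_nz[OF zW] by (simp add: field_simps)
  moreover have "(\<Sum>\<mu>\<in>UNIV. xi z (Some \<mu>) * ct \<mu> z f)
      = (\<Sum>\<mu>\<in>UNIV. xi z (Some \<mu>) * f (Some \<mu>)) - (\<Sum>\<mu>\<in>UNIV. xi z (Some \<mu>) * slope \<mu> z) * f None"
    by (simp add: ct_def right_diff_distrib sum_subtractf sum_distrib_right mult.assoc)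
  ultimately show ?thesis by (simp add: sum_option left_diff_distrib)
qed

lemma eta_Inr [simp]: "eta z $ Inr k = 0"
  by (simp add: eta_def)

lemma eta_Inl:
  assumes z: "z \<in> M"
  shows "eta z $ Inl j = xi z j - (if j = None then 1 / wd None R z else 0)"
proof -
  have "eta z $ Inl j = (\<Sum>\<mu>\<in>UNIV. xi z (Some \<mu>) * ct \<mu> z (\<lambda>i. if i = j then 1 else 0))"
    by (simp add: eta_def ct_def) (cases j; simp add: if_one_mult)
  then show ?thesis by (auto simp: xi_contract[OF z] if_one_mult)
qed

lemma levi_eta:
  assumes z: "z \<in> M" shows "levi_form \<rho> z (eta z) (Zb \<sigma> z) = q \<sigma> z"
proof -
  note zW = M_W[OF z]
  have "levi_form \<rho> z (eta z) (Zb \<sigma> z)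
      = (\<Sum>\<mu>\<in>UNIV. xi z (Some \<mu>) * ct \<mu> z (\<lambda>j. ctb \<sigma> z (\<lambda>k. wd j (wdb k R) z)))"
    by (simp add: eta_def levi_form_sum levi_form_scale levi_def[symmetric] levi_eq[OF zW])
  also have "\<dots> = ctb \<sigma> z (\<lambda>k. \<Sum>j\<in>UNIV. xi z j * wd j (wdb k R) z) + q \<sigma> z"
    using Rw_nz[OF zW] by (simp add: xi_contract[OF z] q_alt[OF zW] ctb_sum ctb_linear)
  finally show ?thesis by (simp add: xi_R2[OF z] ctb_linear ctb_dR[OF zW])
qed

lemma levi_cnj_eta:
  assumes z: "z \<in> M" shows "levi_form \<rho> z (Z \<gamma> z) (vconj (eta z)) = cnj (q \<gamma> z)"
  using levi_form_cnj[OF M_W[OF z], of "eta z" "Zb \<gamma> z"] levi_eta[OF z, of \<gamma>]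
  by (simp add: frame_eq[symmetric] frameb_eq)

lemma levi_eta_eta:
  assumes z: "z \<in> M" shows "levi_form \<rho> z (eta z) (vconj (eta z)) = rNN z - rr z"
proof -
  note zW = M_W[OF z]
  have "levi_form \<rho> z (eta z) (vconj (eta z)) = (\<Sum>\<mu>\<in>UNIV. xi z (Some \<mu>) * cnj (q \<mu> z))"
    by (subst eta_def) (simp add: levi_form_sum levi_form_scale levi_cnj_eta[OF z])
  also have "\<dots> = (\<Sum>\<mu>\<in>UNIV. xi z (Some \<mu>) * ct \<mu> z (\<lambda>j. wd j (wdb None R) z * (- 1 / wdb None R z)))"
    by (simp only: ct_linear cnj_q[OF zW]) simp
  also have "\<dots> = (\<Sum>j\<in>UNIV. xi z j * wd j (wdb None R) z) * (- 1 / wdb None R z) + rNN z"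
    unfolding xi_contract[OF z] sum_distrib_right by (simp add: rNN_def mult.assoc)
  also have "\<dots> = rNN z - rr z"
    using Rwb_nz[OF zW] by (simp add: xi_R2[OF z])
  finally show ?thesis .
qed

subsection \<open>Covariant derivatives of the frame\<close>

lemma bracket_frame_Inl:
  assumes z: "z \<in> W"
  shows "bracket (Z \<gamma>) (Zb \<beta>) z $ Inl j = (if j = None then h z \<gamma> \<beta> / wd None R z else 0)"
proof -
  have "slope \<gamma> differentiable at z" by (rule diffW[OF smooth_slope z])
  then show ?thesis
    by (cases j) (simp_all add: bracket_def vderiv_minus slope_frameb[OF z])
qed

lemma bracket_frame_Inr:
  assumes z: "z \<in> W"
  shows "bracket (Z \<gamma>) (Zb \<beta>) z $ Inr j = (if j = None then - h z \<gamma> \<beta> / wdb None R z else 0)"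
proof -
  have "(\<lambda>x. cnj (slope \<beta> x)) differentiable at z" by (rule diffW[OF smooth_on_cnj[OF open_W smooth_slope] z])
  then show ?thesis
    by (cases j) (simp_all add: bracket_def vderiv_minus cnj_slope_frame[OF z])
qed

text \<open>The \<open>(1,0)\<close> part of the mixed torsion equation: the derivative of the conjugate frame is of type
  \<open>(0,1)\<close> and drops out, so that the bracket and the Reeb field determine the result.\<close>
lemma nabla_frameb_frame:
  assumes z: "z \<in> M"
  shows "nabla (Zb \<beta>) (Z \<gamma>) z = h z \<gamma> \<beta> *s eta z"
proof -
  note zW = M_W[OF z]
  have "nabla (Zb \<beta>) (Z \<gamma>) z $ Inl j = h z \<gamma> \<beta> * eta z $ Inl j" for j
  proof -
    have "nabla (Z \<gamma>) (Zb \<beta>) z = vconj (nabla (Zb \<gamma>) (Z \<beta>) z)"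
      using nabla_vconj[OF frameb_vfields frame_vfields z] by (simp flip: frame_eq frameb_eq)
    moreover have "nabla (Zb \<gamma>) (Z \<beta>) z \<in> T10 \<rho> z"
      by (rule nabla_T10[OF frameb_vfields frame_vfields10 z])
    ultimately have 0: "nabla (Z \<gamma>) (Zb \<beta>) z $ Inl j = 0" by (simp add: T10_iff)
    have "torsion nabla (Z \<gamma>) (Zb \<beta>) z = (\<i> * h z \<gamma> \<beta>) *s T z"
      using torsion_frame(1)[OF frame_vfields10 frame_vfields10 z, of \<gamma> \<beta>] by (simp add: levi_def frameb_def flip: frameb_eq)
    then have "torsion nabla (Z \<gamma>) (Zb \<beta>) z $ Inl j = \<i> * h z \<gamma> \<beta> * T z $ Inl j" by simp
    then show ?thesis
      by (simp add: torsion_def 0 bracket_frame_Inl[OF zW] T_Inl eta_Inl[OF z] algebra_simps)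
  qed
  moreover have "nabla (Zb \<beta>) (Z \<gamma>) z $ Inr j = 0" for j
    using nabla_T10[OF frameb_vfields frame_vfields10 z] by (simp add: T10_iff)
  ultimately show ?thesis by (simp add: vec_eq_sum_iff)
qed

lemma nabla_frame_frameb:
  assumes z: "z \<in> M"
  shows "nabla (Z \<alpha>) (Zb \<sigma>) z = h z \<alpha> \<sigma> *s vconj (eta z)"
  using nabla_vconj[OF frameb_vfields frame_vfields z, of \<alpha> \<sigma>]
  by (simp add: nabla_frameb_frame[OF z] vconj_scale cnj_levi[OF M_W[OF z]] flip: frame_eq frameb_eq)

lemma nabla_frame_frame:
  assumes z: "z \<in> M"
  shows "levi_form \<rho> z (nabla (Z \<alpha>) (Z \<gamma>) z) (Zb \<sigma> z) = t3 \<alpha> \<gamma> \<sigma> z + hh \<alpha> \<gamma> z * q \<sigma> z"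
  unfolding nabla_levi_form[OF frame_vfields frame_vfields frameb_vfields z] nabla_frame_frameb[OF z]
    levi_form_scale2 levi_cnj_eta[OF z] levi_def[symmetric] frame_levi[OF M_W[OF z]]
  by simp

text \<open>The Reeb field is parallel, since it is determined by \<open>\<theta>\<close> and \<open>d\<theta>\<close>, which are.\<close>
lemma nabla_T:
  assumes z: "z \<in> M" and X: "X \<in> vfields \<rho> M"
  shows "nabla X T z $ Inl j = 0"
proof -
  note zW = M_W[OF z] and T = T_vfields
  define Y where "Y = nabla X T z"
  have Y: "Y \<in> ctangent \<rho> z" unfolding Y_def by (rule vfieldsD(2)[OF nabla_vfields[OF X T] z])
  have s: "smooth_near M (\<lambda>x. theta_coeff \<rho> A x)" for A
    by (cases A) (auto intro!: smooth_near_mult smooth_near_W smooth_intros)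
  have "vderiv X (\<lambda>x. theta \<rho> x (T x)) z = vderiv X (\<lambda>x. 1) z"
  proof (rule vderiv_eq_on_M[OF z])
    show "(\<lambda>x. theta \<rho> x (T x)) differentiable at z"
      unfolding theta_def form_eval_def
      by (intro smooth_near_differentiable[OF _ z] smooth_near_sum smooth_near_mult smooth_near_nth s vfieldsD(1)[OF T])
    show "theta \<rho> x (T x) = 1" if "x \<in> M" for x using reeb that unfolding reeb_field_def by blast
    show "X z \<in> ctangent \<rho> z" by (rule vfieldsD(2)[OF X z])
  qed auto
  then have "theta \<rho> z Y = 0" unfolding Y_def by (simp add: nabla_theta[OF X T z])
  then have "\<i> * (\<Sum>k\<in>UNIV. Y $ Inr k * wdb k R z) = 0"
    by (simp add: theta_def form_eval_def sum_sum_type sum_distrib_left mult_ac)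
  then have "(\<Sum>k\<in>UNIV. Y $ Inr k * wdb k R z) = 0" by simp
  then have 1: "(\<Sum>j\<in>UNIV. Y $ Inl j * wd j R z) = 0" using Y by (simp add: ctangent_iff)
  define Y' :: "complex^('n option + 'n option)" where "Y' = (\<chi> A. case A of Inl j \<Rightarrow> Y $ Inl j | Inr j \<Rightarrow> 0)"
  have "levi_form \<rho> z Y (Zb \<sigma> z) = 0" for \<sigma>
  proof -
    have 0: "levi_form \<rho> x (T x) V = 0" if "x \<in> M" "V \<in> ctangent \<rho> x" for x V
      using reeb that unfolding reeb_field_def levi_form_def by simp
    have "vderiv X (\<lambda>x. levi_form \<rho> x (T x) (Zb \<sigma> x)) z = vderiv X (\<lambda>x. 0) z"
    proof (rule vderiv_eq_on_M[OF z])
      show "(\<lambda>x. levi_form \<rho> x (T x) (Zb \<sigma> x)) differentiable at z"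
        by (intro smooth_near_differentiable[OF _ z] smooth_near_levi_form vfieldsD(1) T frameb_vfields)
      show "levi_form \<rho> x (T x) (Zb \<sigma> x) = 0" if "x \<in> M" for x
        by (intro 0 that vfieldsD(2) frameb_vfields)
    qed (auto intro: vfieldsD(2)[OF X z])
    moreover have "levi_form \<rho> z (T z) (nabla X (Zb \<sigma>) z) = 0"
      by (intro 0 z vfieldsD(2) nabla_vfields X frameb_vfields)
    ultimately show ?thesis
      unfolding Y_def nabla_levi_form[OF X T frameb_vfields z] by simp
  qed
  then have "levi_form \<rho> z Y' (Zb \<sigma> z) = 0" for \<sigma>
    by (simp add: levi_form_frameb[OF zW] Y'_def)
  moreover have "Y' \<in> T10 \<rho> z" using 1 by (simp add: T10_iff Y'_def)
  ultimately have "Y' = 0" by (intro T10_zero[OF z])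
  then have "Y' $ Inl j = 0" by simp
  then show ?thesis by (simp add: Y'_def Y_def)
qed

text \<open>By the torsion condition, the \<open>(1,0)\<close> part of the bracket of the Reeb field with \<open>Z\<^sub>\<gamma>\<close> is the
  covariant derivative. The derivatives of \<open>\<xi>\<close> that occur in it are eliminated by differentiating
  \<open>xi_R2\<close> along \<open>Z\<^sub>\<gamma>\<close>.\<close>
lemma nabla_T_frame:
  assumes z: "z \<in> M"
  shows "levi_form \<rho> z (nabla T (Z \<gamma>) z) (Zb \<sigma> z)
    = \<i> * (q \<sigma> z * (\<Sum>i\<in>UNIV. xi z i * ct \<gamma> z (\<lambda>j. wd i (wd j R) z))
      + (\<Sum>i\<in>UNIV. xi z i * ct \<gamma> z (\<lambda>j. ctb \<sigma> z (\<lambda>k. R3 i j k z))) - rr z * h z \<gamma> \<sigma>)"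
proof -
  note zW = M_W[OF z] and T = T_vfields
  have Tj: "smooth_near M (\<lambda>x. T x $ A)" for A by (rule smooth_near_nth[OF vfieldsD(1)[OF T]])
  have comp: "nabla T (Z \<gamma>) z $ Inl j
      = (if j = None then - vderiv T (slope \<gamma>) z else 0) - vderiv (Z \<gamma>) (\<lambda>x. T x $ Inl j) z" for j
  proof -
    have "torsion nabla T (Z \<gamma>) z $ Inl j = 0"
      using torsion_frame(2)[OF frame_vfields10 frame_vfields10 z] by (simp add: T01_iff)
    then show ?thesis using diffW[OF smooth_slope zW, of \<gamma>]
      by (cases j) (simp_all add: torsion_def nabla_T[OF z frame_vfields] bracket_def vderiv_minus eq_neg_iff_add_eq_0)
  qed
  have slope: "vderiv T (slope \<gamma>) z * wd None R z = \<i> * (\<Sum>i\<in>UNIV. xi z i * ct \<gamma> z (\<lambda>j. wd i (wd j R) z))"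
  proof -
    have "vderiv T (slope \<gamma>) z * wd None R z = ct \<gamma> z (\<lambda>j. vderiv T (wd j R) z)"
      using Rw_nz[OF zW] by (simp add: vderiv_slope[OF zW])
    also have "\<dots> = ct \<gamma> z (\<lambda>j. \<i> * (\<Sum>i\<in>UNIV. xi z i * wd i (wd j R) z) - \<i> * (rr z * wd j R z))"
      by (simp add: vderiv_split T_Inl T_Inr[OF z] wd_wdb_commute[OF smooth_R_W zW] mult.assoc
          cnj_xi_R2[OF z] sum_negf flip: sum_distrib_left)
    finally show ?thesis by (simp add: ct_linear ct_dR[OF zW] ct_sum)
  qed
  have dT: "(\<Sum>j\<in>UNIV. vderiv (Z \<gamma>) (\<lambda>x. T x $ Inl j) z * ctb \<sigma> z (\<lambda>k. wd j (wdb k R) z))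
      = \<i> * (rr z * h z \<gamma> \<sigma> - (\<Sum>i\<in>UNIV. xi z i * ct \<gamma> z (\<lambda>j. ctb \<sigma> z (\<lambda>k. R3 i j k z))))"
  proof -
    define f where "f j x = ctb \<sigma> x (\<lambda>k. wd j (wdb k R) x)" for j x
    have f: "smooth_on W (f j)" for j unfolding f_def by (intro smooth_ctb smooth_R3)
    have df: "vderiv (Z \<gamma>) (f j) z = ct \<gamma> z (\<lambda>i. ctb \<sigma> z (\<lambda>k. R3 j i k z)) - h z \<gamma> \<sigma> / wdb None R z * wd j (wdb None R) z" for j
      unfolding f_def
      by (subst vderiv_ctb[OF zW])
        (simp_all add: smooth_R3 vderiv_frame cnj_slope_frame[unfolded vderiv_frame] zW ct_ctb_swap R3_sym[OF zW, of _ j])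
    have "vderiv (Z \<gamma>) (\<lambda>x. \<Sum>j\<in>UNIV. T x $ Inl j * f j x) z = vderiv (Z \<gamma>) (\<lambda>x. 0) z"
    proof (rule vderiv_eq_on_M[OF z])
      show "(\<lambda>x. \<Sum>j\<in>UNIV. T x $ Inl j * f j x) differentiable at z"
        by (intro smooth_near_differentiable[OF _ z] smooth_near_sum smooth_near_mult Tj smooth_near_W f)
      show "(\<Sum>j\<in>UNIV. T x $ Inl j * f j x) = 0" if "x \<in> M" for x
      proof -
        have "(\<Sum>j\<in>UNIV. T x $ Inl j * f j x) = \<i> * ctb \<sigma> x (\<lambda>k. \<Sum>j\<in>UNIV. xi x j * wd j (wdb k R) x)"
          by (simp add: f_def T_Inl ctb_sum ctb_linear mult.assoc flip: sum_distrib_left)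
        then show ?thesis by (simp add: xi_R2[OF that] ctb_linear ctb_dR M_W[OF that])
      qed
    qed (auto intro: T10_ctangent frame_T10 zW)
    then have "(\<Sum>j\<in>UNIV. vderiv (Z \<gamma>) (\<lambda>x. T x $ Inl j * f j x) z) = 0"
      by (simp add: vderiv_sum differentiable_mult smooth_near_differentiable[OF Tj z] diffW[OF f zW])
    then have "(\<Sum>j\<in>UNIV. vderiv (Z \<gamma>) (\<lambda>x. T x $ Inl j) z * f j z + T z $ Inl j * vderiv (Z \<gamma>) (f j) z) = 0"
      by (simp add: vderiv_mult smooth_near_differentiable[OF Tj z] diffW[OF f zW])
    then have "(\<Sum>j\<in>UNIV. vderiv (Z \<gamma>) (\<lambda>x. T x $ Inl j) z * f j z) = - (\<Sum>j\<in>UNIV. T z $ Inl j * vderiv (Z \<gamma>) (f j) z)"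
      by (simp add: sum.distrib eq_neg_iff_add_eq_0)
    also have "(\<Sum>j\<in>UNIV. T z $ Inl j * vderiv (Z \<gamma>) (f j) z)
        = \<i> * ((\<Sum>j\<in>UNIV. xi z j * ct \<gamma> z (\<lambda>i. ctb \<sigma> z (\<lambda>k. R3 j i k z)))
          - h z \<gamma> \<sigma> / wdb None R z * (\<Sum>j\<in>UNIV. xi z j * wd j (wdb None R) z))"
      unfolding df T_Inl by (simp add: right_diff_distrib sum_subtractf sum_distrib_left mult_ac)
    finally show ?thesis
      using Rwb_nz[OF zW] by (simp add: f_def xi_R2[OF z] algebra_simps)
  qed
  have "levi_form \<rho> z (nabla T (Z \<gamma>) z) (Zb \<sigma> z)
      = - vderiv T (slope \<gamma>) z * ctb \<sigma> z (\<lambda>k. wd None (wdb k R) z)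
        - (\<Sum>j\<in>UNIV. vderiv (Z \<gamma>) (\<lambda>x. T x $ Inl j) z * ctb \<sigma> z (\<lambda>k. wd j (wdb k R) z))"
    unfolding levi_form_frameb[OF zW] comp by (simp add: left_diff_distrib sum_subtractf sum_option)
  also have "- vderiv T (slope \<gamma>) z * ctb \<sigma> z (\<lambda>k. wd None (wdb k R) z) = q \<sigma> z * (vderiv T (slope \<gamma>) z * wd None R z)"
    by (simp add: q_alt[OF zW])
  finally show ?thesis unfolding slope dT by (simp add: algebra_simps)
qed

subsection \<open>The curvature\<close>

text \<open>The bracket is the Levi form times the difference of \<open>N\<close> and its conjugate; here \<open>N = \<xi> - \<eta>\<close> expresses it through
  fields along which the covariant derivatives are known.\<close>
lemma bracket_frame_eq:
  assumes z: "z \<in> M"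
  shows "bracket (Z \<alpha>) (Zb \<beta>) z
    = h z \<alpha> \<beta> *s ((- \<i>) *s T z + ((- 1) *s eta z + vconj (eta z)))"
  unfolding vec_eq_sum_iff
  by (auto simp: bracket_frame_Inl[OF M_W[OF z]] bracket_frame_Inr[OF M_W[OF z]] T_Inl T_Inr[OF z] eta_Inl[OF z]
      algebra_simps cnj_wd_R[OF M_W[OF z]])

lemma nabla_bracket_frame:
  assumes z: "z \<in> M"
  shows "levi_form \<rho> z (nabla (bracket (Z \<alpha>) (Zb \<beta>)) (Z \<gamma>) z) (Zb \<sigma> z)
    = h z \<alpha> \<beta> * (t3N \<gamma> \<sigma> z + hN \<gamma> z * q \<sigma> z - rr z * h z \<gamma> \<sigma> + q \<sigma> z * cnj (q \<gamma> z))"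
proof -
  note zW = M_W[OF z] and F = frame_vfields[of \<gamma>]
  have v: "(\<lambda>x. (- \<i>) *s T x) \<in> vfields \<rho> M" "(\<lambda>x. (- 1) *s eta x) \<in> vfields \<rho> M" "(\<lambda>x. vconj (eta x)) \<in> vfields \<rho> M"
    by (intro vfields_scale vfields_vconj smooth_near_const T_vfields eta_vfields)+
  have s: "smooth_near M (\<lambda>x. h x \<alpha> \<beta>)" by (rule smooth_near_W[OF smooth_levi])
  define B where "B x = h x \<alpha> \<beta> *s ((- \<i>) *s T x + ((- 1) *s eta x + vconj (eta x)))" for x
  have B: "B \<in> vfields \<rho> M" unfolding B_def by (intro vfields_scale vfields_add v s)
  have "bracket (Z \<alpha>) (Zb \<beta>) \<in> vfields \<rho> M"
    using smooth_near_bracket[OF vfieldsD(1)[OF frame_vfields] vfieldsD(1)[OF frameb_vfields]] vfieldsD(2)[OF B]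
    by (auto simp: vfields_def B_def bracket_frame_eq)
  then have "nabla (bracket (Z \<alpha>) (Zb \<beta>)) (Z \<gamma>) z = nabla B (Z \<gamma>) z"
    by (rule nabla_cong[OF _ B F _ z]) (simp add: B_def bracket_frame_eq)
  also have "\<dots> = h z \<alpha> \<beta> *s ((- \<i>) *s nabla T (Z \<gamma>) z
      + ((- 1) *s nabla eta (Z \<gamma>) z + nabla (\<lambda>x. vconj (eta x)) (Z \<gamma>) z))"
    unfolding B_def[abs_def]
    by (simp only: nabla_scale[OF s vfields_add[OF v(1) vfields_add[OF v(2,3)]] F z] nabla_add[OF v(1) vfields_add[OF v(2,3)] F z]
        nabla_add[OF v(2,3) F z] nabla_scale[OF smooth_near_const T_vfields F z] nabla_scale[OF smooth_near_const eta_vfields F z])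
  finally have 1: "levi_form \<rho> z (nabla (bracket (Z \<alpha>) (Zb \<beta>)) (Z \<gamma>) z) (Zb \<sigma> z)
    = h z \<alpha> \<beta> * (- \<i> * levi_form \<rho> z (nabla T (Z \<gamma>) z) (Zb \<sigma> z)
      + (- levi_form \<rho> z (nabla eta (Z \<gamma>) z) (Zb \<sigma> z)
         + levi_form \<rho> z (nabla (\<lambda>x. vconj (eta x)) (Z \<gamma>) z) (Zb \<sigma> z)))"
    by (simp only: levi_form_scale levi_form_add) simp
  have "nabla eta (Z \<gamma>) z = (\<Sum>\<mu>\<in>UNIV. xi z (Some \<mu>) *s nabla (Z \<mu>) (Z \<gamma>) z)"
    unfolding eta_def[abs_def] by (rule nabla_sum[OF smooth_near_xi frame_vfields F z]) simp
  then have "levi_form \<rho> z (nabla eta (Z \<gamma>) z) (Zb \<sigma> z)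
      = (\<Sum>\<mu>\<in>UNIV. xi z (Some \<mu>) * (t3 \<mu> \<gamma> \<sigma> z + hh \<mu> \<gamma> z * q \<sigma> z))"
    by (simp add: levi_form_sum levi_form_scale nabla_frame_frame[OF z])
  also have "\<dots> = (\<Sum>\<mu>\<in>UNIV. xi z (Some \<mu>) * ct \<mu> z (\<lambda>i. ct \<gamma> z (\<lambda>j. ctb \<sigma> z (\<lambda>k. R3 i j k z)) + ct \<gamma> z (\<lambda>j. wd i (wd j R) z) * q \<sigma> z))"
    by (simp only: ct_linear t3_def hh_def)
  also have "\<dots> = (\<Sum>i\<in>UNIV. xi z i * ct \<gamma> z (\<lambda>j. ctb \<sigma> z (\<lambda>k. R3 i j k z)))
      + q \<sigma> z * (\<Sum>i\<in>UNIV. xi z i * ct \<gamma> z (\<lambda>j. wd i (wd j R) z)) - (t3N \<gamma> \<sigma> z + hN \<gamma> z * q \<sigma> z)"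
    unfolding xi_contract[OF z] t3N_def hN_def
    by (simp add: distrib_left sum.distrib sum_distrib_left add_divide_distrib mult_ac)
  finally have 2: "levi_form \<rho> z (nabla eta (Z \<gamma>) z) (Zb \<sigma> z) = (\<Sum>i\<in>UNIV. xi z i * ct \<gamma> z (\<lambda>j. ctb \<sigma> z (\<lambda>k. R3 i j k z)))
      + q \<sigma> z * (\<Sum>i\<in>UNIV. xi z i * ct \<gamma> z (\<lambda>j. wd i (wd j R) z)) - (t3N \<gamma> \<sigma> z + hN \<gamma> z * q \<sigma> z)" .
  have "(\<lambda>x. vconj (eta x)) = (\<lambda>x. \<Sum>\<mu>\<in>UNIV. cnj (xi x (Some \<mu>)) *s Zb \<mu> x)"
    by (simp add: eta_def vconj_sum vconj_scale frameb_def)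
  then have "nabla (\<lambda>x. vconj (eta x)) (Z \<gamma>) z = (\<Sum>\<mu>\<in>UNIV. cnj (xi z (Some \<mu>)) *s nabla (Zb \<mu>) (Z \<gamma>) z)"
    using nabla_sum[OF smooth_near_cnj[OF smooth_near_xi] frameb_vfields F z finite, where I=UNIV] by simp
  then have "levi_form \<rho> z (nabla (\<lambda>x. vconj (eta x)) (Z \<gamma>) z) (Zb \<sigma> z)
      = (\<Sum>\<mu>\<in>UNIV. cnj (xi z (Some \<mu>)) * h z \<gamma> \<mu>) * q \<sigma> z"
    by (simp add: levi_form_sum levi_form_scale nabla_frameb_frame[OF z] levi_eta[OF z] sum_distrib_right mult.assoc)
  also have "(\<Sum>\<mu>\<in>UNIV. cnj (xi z (Some \<mu>)) * h z \<gamma> \<mu>) = levi_form \<rho> z (Z \<gamma> z) (vconj (eta z))"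
    by (simp add: eta_def vconj_sum vconj_scale levi_form_sum2 levi_form_scale2 levi_def frameb_def)
  finally have 3: "levi_form \<rho> z (nabla (\<lambda>x. vconj (eta x)) (Z \<gamma>) z) (Zb \<sigma> z) = cnj (q \<gamma> z) * q \<sigma> z"
    by (simp add: levi_cnj_eta[OF z])
  show ?thesis
    unfolding 1 2 3 nabla_T_frame[OF z] by (simp add: algebra_simps)
qed

text \<open>Each of the three terms of the curvature is paired with the conjugate frame, and the outer
  covariant derivatives are removed by \<open>nabla_levi_form\<close>. The third order terms in \<open>N\<close> then cancel
  in pairs.\<close>
lemma curvature_frame:
  assumes z: "z \<in> M"
  shows "psh_curvature \<rho> nabla z \<alpha> \<beta> \<gamma> \<sigma> = - t4 \<alpha> \<beta> \<gamma> \<sigma> z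
    + rr z * (h z \<alpha> \<beta> * h z \<gamma> \<sigma> + h z \<alpha> \<sigma> * h z \<gamma> \<beta>)
    + cnj (hh \<beta> \<sigma> z) * t3Nb \<alpha> \<gamma> z + hh \<alpha> \<gamma> z * cnj (t3Nb \<beta> \<sigma> z) - hh \<alpha> \<gamma> z * cnj (hh \<beta> \<sigma> z) * rNN z
    + levi_form \<rho> z (nabla (Z \<alpha>) (Z \<gamma>) z) (vconj (nabla (Z \<beta>) (Z \<sigma>) z))"
    (is "_ = _ + ?E")
proof -
  note zW = M_W[OF z]
  define V1 where "V1 = nabla (Zb \<beta>) (Z \<gamma>)"
  define V2 where "V2 = nabla (Z \<alpha>) (Z \<gamma>)"
  have V1: "V1 \<in> vfields \<rho> M" and V2: "V2 \<in> vfields \<rho> M"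
    unfolding V1_def V2_def by (intro nabla_vfields frame_vfields frameb_vfields)+
  have sq: "smooth_on W (q \<sigma>)"
    unfolding q_def[abs_def] using Rw_nz by (intro smooth_on_divide smooth_on_minus smooth_ctb smooth_intros)
  have st: "smooth_on W (t3 \<alpha> \<gamma> \<sigma>)" "smooth_on W (hh \<alpha> \<gamma>)"
    unfolding t3_def[abs_def] hh_def[abs_def] by (intro smooth_ct smooth_ctb smooth_R3)+
  have d: "q \<sigma> differentiable at z" "t3 \<alpha> \<gamma> \<sigma> differentiable at z" "hh \<alpha> \<gamma> differentiable at z"
    "(\<lambda>x. h x \<gamma> \<beta>) differentiable at z"
    by (rule diffW[OF _ zW]; rule sq st smooth_levi)+
  have dV: "(\<lambda>x. levi_form \<rho> x (nabla X (Z \<gamma>) x) (Zb \<sigma> x)) differentiable at z"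
    if "X \<in> vfields \<rho> M" for X
    by (intro smooth_near_differentiable[OF smooth_near_levi_form z] vfieldsD(1) nabla_vfields that frame_vfields frameb_vfields)
  have "vderiv (Z \<alpha>) (\<lambda>x. levi_form \<rho> x (V1 x) (Zb \<sigma> x)) z = vderiv (Z \<alpha>) (\<lambda>x. h x \<gamma> \<beta> * q \<sigma> x) z"
    by (rule vderiv_eq_on_M[OF z])
      (auto intro!: dV frame_vfields frameb_vfields differentiable_mult d T10_ctangent frame_T10 zW simp: V1_def nabla_frameb_frame levi_form_scale levi_eta)
  then have 1: "levi_form \<rho> z (nabla (Z \<alpha>) V1 z) (Zb \<sigma> z)
      = (t3 \<alpha> \<gamma> \<beta> z + hh \<alpha> \<gamma> z * q \<beta> z + h z \<alpha> \<beta> * cnj (q \<gamma> z)) * q \<sigma> z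
        + h z \<gamma> \<beta> * (- t3N \<alpha> \<sigma> z + h z \<alpha> \<sigma> * rNN z - q \<sigma> z * hN \<alpha> z)
        - h z \<gamma> \<beta> * h z \<alpha> \<sigma> * (rNN z - rr z)"
    unfolding nabla_levi_form[OF frame_vfields V1 frameb_vfields z]
    by (simp add: vderiv_mult d frame_levi[OF zW] frame_q[OF zW] nabla_frame_frameb[OF z] V1_def nabla_frameb_frame[OF z]
        levi_form_scale levi_form_scale2 levi_eta_eta[OF z])
  have "vderiv (Zb \<beta>) (\<lambda>x. levi_form \<rho> x (V2 x) (Zb \<sigma> x)) z = vderiv (Zb \<beta>) (\<lambda>x. t3 \<alpha> \<gamma> \<sigma> x + hh \<alpha> \<gamma> x * q \<sigma> x) z"
    by (rule vderiv_eq_on_M[OF z])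
      (auto intro!: dV frame_vfields frameb_vfields differentiable_add differentiable_mult d T01_ctangent frameb_T01 zW simp: V2_def nabla_frame_frame)
  moreover have "nabla (Zb \<beta>) (Zb \<sigma>) z = vconj (nabla (Z \<beta>) (Z \<sigma>) z)"
    using nabla_vconj[OF frame_vfields frame_vfields z, of \<beta> \<sigma>] by (simp flip: frameb_eq)
  ultimately have 2: "levi_form \<rho> z (nabla (Zb \<beta>) V2 z) (Zb \<sigma> z)
      = t4 \<alpha> \<beta> \<gamma> \<sigma> z - h z \<alpha> \<beta> * t3N \<gamma> \<sigma> z - h z \<gamma> \<beta> * t3N \<alpha> \<sigma> z - cnj (hh \<beta> \<sigma> z) * t3Nb \<alpha> \<gamma> z
        + ((t3 \<alpha> \<gamma> \<beta> z - h z \<alpha> \<beta> * hN \<gamma> z - h z \<gamma> \<beta> * hN \<alpha> z) * q \<sigma> z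
          + hh \<alpha> \<gamma> z * (- cnj (t3Nb \<beta> \<sigma> z) + cnj (hh \<beta> \<sigma> z) * rNN z + q \<sigma> z * q \<beta> z)) - ?E"
    unfolding nabla_levi_form[OF frameb_vfields V2 frameb_vfields z]
    by (simp add: vderiv_add vderiv_mult differentiable_mult d frameb_t3[OF zW] frameb_hh[OF zW] frameb_q[OF zW] V2_def)
  have "psh_curvature \<rho> nabla z \<alpha> \<beta> \<gamma> \<sigma> = levi_form \<rho> z (nabla (Z \<alpha>) V1 z) (Zb \<sigma> z)
      - levi_form \<rho> z (nabla (Zb \<beta>) V2 z) (Zb \<sigma> z)
      - levi_form \<rho> z (nabla (bracket (Z \<alpha>) (Zb \<beta>)) (Z \<gamma>) z) (Zb \<sigma> z)"
    by (simp add: psh_curvature_def curv_def levi_form_diff V1_def V2_def)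
  then show ?thesis
    unfolding 1 2 nabla_bracket_frame[OF z] by (simp add: algebra_simps)
qed

end

section \<open>The inverse Levi form\<close>

lemma sum_delta_mult: "(\<Sum>i\<in>UNIV. (if i = a then 1 else 0) * f i) = (f a :: complex)"
  "(\<Sum>i\<in>UNIV. (if a = i then 1 else 0) * f i) = (f a :: complex)"
  for a :: "'i::finite"
  by (simp_all add: if_one_mult)

lemma matrix_inv_both:
  assumes "invertible H" shows "H ** matrix_inv H = mat 1 \<and> matrix_inv H ** H = mat 1"
  using assms unfolding invertible_def matrix_inv_def by (rule someI_ex)

lemma upper_inverse:
  fixes H :: "complex^'i^'i::finite"
  assumes "invertible H"
  shows "(\<Sum>b\<in>UNIV. upper H a b * H $ c $ b) = (if c = a then 1 else 0)"
    and "(\<Sum>a\<in>UNIV. upper H a b * H $ a $ c) = (if b = c then 1 else 0)"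
proof -
  have "(H ** matrix_inv H) $ c $ a = (mat 1 :: complex^'i^'i) $ c $ a" "(matrix_inv H ** H) $ b $ c = (mat 1 :: complex^'i^'i) $ b $ c"
    using matrix_inv_both[OF assms] by simp_all
  then show "(\<Sum>b\<in>UNIV. upper H a b * H $ c $ b) = (if c = a then 1 else 0)"
    "(\<Sum>a\<in>UNIV. upper H a b * H $ a $ c) = (if b = c then 1 else 0)"
    by (simp_all add: matrix_matrix_mult_def mat_def upper_def mult.commute)
qed

lemma upper_unique:
  fixes H :: "complex^'i^'i::finite"
  assumes "\<And>a c. (\<Sum>b\<in>UNIV. K a b * H $ c $ b) = (if c = a then 1 else 0)"
  shows "invertible H" "upper H a b = K a b"
proof -
  define N :: "complex^'i^'i" where "N = (\<chi> b a. K a b)"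
  have HN: "H ** N = mat 1"
    using assms by (simp add: vec_eq_iff matrix_matrix_mult_def mat_def N_def mult.commute)
  then show inv: "invertible H" using invertible_right_inverse by blast
  have "matrix_inv H = matrix_inv H ** (H ** N)" by (simp add: HN)
  also have "\<dots> = N" using matrix_inv_both[OF inv] by (simp add: matrix_mul_assoc)
  finally show "upper H a b = K a b" by (simp add: upper_def N_def)
qed

context hypersurface
begin

text \<open>A vector in the kernel is the component vector of a null vector of the Levi form.\<close>
lemma invertible_levi:
  assumes z: "z \<in> M"
  shows "invertible (\<chi> \<alpha> \<beta>. h z \<alpha> \<beta>)"
proof -
  let ?H = "(\<chi> \<alpha> \<beta>. h z \<alpha> \<beta>) :: complex^'n^'n"
  have "x = 0" if x: "transpose ?H *v x = 0" for x
  proof -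
    define X where "X = (\<Sum>\<mu>\<in>UNIV. x $ \<mu> *s Z \<mu> z)"
    have "levi_form \<rho> z X (Zb \<sigma> z) = (transpose ?H *v x) $ \<sigma>" for \<sigma>
      by (simp add: X_def levi_form_sum levi_form_scale matrix_vector_mult_def transpose_def mult.commute flip: levi_def)
    moreover have "X \<in> T10 \<rho> z"
    proof -
      have "(\<Sum>j\<in>UNIV. X $ Inl j * wd j R z) = (\<Sum>\<mu>\<in>UNIV. \<Sum>j\<in>UNIV. x $ \<mu> * (Z \<mu> z $ Inl j * wd j R z))"
        by (subst sum.swap) (simp add: X_def sum_distrib_right mult.assoc)
      then show ?thesis
        by (simp add: T10_iff X_def sum_frame ct_dR[OF M_W[OF z]] flip: sum_distrib_left)
    qed
    ultimately have "X = 0" using x by (intro T10_zero[OF z]) auto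
    then have "X $ Inl (Some \<mu>) = 0" for \<mu> by simp
    then have "x $ \<mu> = 0" for \<mu> by (simp add: X_def if_one_mult)
    then show ?thesis by (simp add: vec_eq_iff)
  qed
  then have "invertible (transpose ?H)"
    using matrix_left_invertible_ker[of "transpose ?H"] invertible_left_inverse by blast
  then show ?thesis by (simp add: invertible_det_nz)
qed

lemma levi_upper_inverse:
  assumes "z \<in> M"
  shows "(\<Sum>\<nu>\<in>UNIV. levi_upper \<rho> z \<mu> \<nu> * h z \<kappa> \<nu>) = (if \<kappa> = \<mu> then 1 else 0)"
    and "(\<Sum>\<mu>\<in>UNIV. levi_upper \<rho> z \<mu> \<nu> * h z \<mu> \<kappa>) = (if \<nu> = \<kappa> then 1 else 0)"
  using upper_inverse[OF invertible_levi[OF assms]] by (simp_all add: levi_upper_def)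

definition levi_trace where "levi_trace z f = (\<Sum>\<mu>\<in>UNIV. \<Sum>\<nu>\<in>UNIV. levi_upper \<rho> z \<mu> \<nu> * f \<mu> \<nu>)" for f :: "'n \<Rightarrow> 'n \<Rightarrow> complex"

lemma levi_trace_linear:
  "levi_trace z (\<lambda>\<mu> \<nu>. f \<mu> \<nu> + g \<mu> \<nu>) = levi_trace z f + levi_trace z g"
  "levi_trace z (\<lambda>\<mu> \<nu>. f \<mu> \<nu> - g \<mu> \<nu>) = levi_trace z f - levi_trace z g"
  "levi_trace z (\<lambda>\<mu> \<nu>. c * f \<mu> \<nu>) = c * levi_trace z f"
  "levi_trace z (\<lambda>\<mu> \<nu>. f \<mu> \<nu> * c) = levi_trace z f * c"
  "levi_trace z (\<lambda>\<mu> \<nu>. - f \<mu> \<nu>) = - levi_trace z f"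
  by (simp_all add: levi_trace_def distrib_left right_diff_distrib sum.distrib sum_subtractf sum_negf
      sum_distrib_left sum_distrib_right mult_ac)

lemma levi_trace_sum: "levi_trace z (\<lambda>\<mu> \<nu>. \<Sum>i\<in>I. f i \<mu> \<nu>) = (\<Sum>i\<in>I. levi_trace z (f i))"
proof (induction I rule: infinite_finite_induct)
  case (insert x I)
  then show ?case by (simp add: levi_trace_linear)
qed (simp_all add: levi_trace_def)

lemma levi_trace_swap: "levi_trace z (\<lambda>\<mu> \<nu>. levi_trace z (\<lambda>\<kappa> \<tau>. f \<mu> \<nu> \<kappa> \<tau>)) = levi_trace z (\<lambda>\<kappa> \<tau>. levi_trace z (\<lambda>\<mu> \<nu>. f \<mu> \<nu> \<kappa> \<tau>))"
proof -
  have "levi_trace z (\<lambda>\<mu> \<nu>. levi_trace z (\<lambda>\<kappa> \<tau>. f \<mu> \<nu> \<kappa> \<tau>))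
      = (\<Sum>\<kappa>\<in>UNIV. \<Sum>\<tau>\<in>UNIV. levi_trace z (\<lambda>\<mu> \<nu>. levi_upper \<rho> z \<kappa> \<tau> * f \<mu> \<nu> \<kappa> \<tau>))"
    by (subst (2) levi_trace_def) (simp only: levi_trace_sum)
  then show ?thesis by (simp only: levi_trace_linear) (simp only: levi_trace_def)
qed

lemma levi_trace_levi_left:
  assumes z: "z \<in> M" shows "levi_trace z (\<lambda>\<mu> \<nu>. h z \<alpha> \<nu> * g \<mu>) = g \<alpha>"
proof -
  have "levi_trace z (\<lambda>\<mu> \<nu>. h z \<alpha> \<nu> * g \<mu>) = (\<Sum>\<mu>\<in>UNIV. (\<Sum>\<nu>\<in>UNIV. levi_upper \<rho> z \<mu> \<nu> * h z \<alpha> \<nu>) * g \<mu>)"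
    by (simp add: levi_trace_def sum_distrib_right mult.assoc)
  then show ?thesis by (simp add: levi_upper_inverse[OF z] if_one_mult)
qed

lemma levi_trace_levi_right:
  assumes z: "z \<in> M" shows "levi_trace z (\<lambda>\<mu> \<nu>. g \<nu> * h z \<mu> \<beta>) = g \<beta>"
proof -
  have "levi_trace z (\<lambda>\<mu> \<nu>. g \<nu> * h z \<mu> \<beta>) = (\<Sum>\<nu>\<in>UNIV. (\<Sum>\<mu>\<in>UNIV. levi_upper \<rho> z \<mu> \<nu> * h z \<mu> \<beta>) * g \<nu>)"
    unfolding levi_trace_def sum_distrib_right by (subst sum.swap) (simp add: mult_ac)
  then show ?thesis by (simp add: levi_upper_inverse[OF z] if_one_mult)
qed

lemma levi_trace_levi: "z \<in> M \<Longrightarrow> levi_trace z (h z) = of_nat CARD('n)"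
  by (simp add: levi_trace_def levi_upper_inverse)

lemma levi_upper_expand:
  assumes z: "z \<in> M" and X: "X \<in> T10 \<rho> z"
  shows "X $ Inl (Some \<mu>) = (\<Sum>\<nu>\<in>UNIV. levi_upper \<rho> z \<mu> \<nu> * levi_form \<rho> z X (Zb \<nu> z))"
proof -
  define c where "c \<kappa> = X $ Inl (Some \<kappa>)" for \<kappa>
  have "levi_form \<rho> z X (Zb \<nu> z) = (\<Sum>\<kappa>\<in>UNIV. c \<kappa> * h z \<kappa> \<nu>)" for \<nu>
    by (subst T10_expand[OF M_W[OF z] X]) (simp add: levi_form_sum levi_form_scale c_def flip: levi_def)
  then have "(\<Sum>\<nu>\<in>UNIV. levi_upper \<rho> z \<mu> \<nu> * levi_form \<rho> z X (Zb \<nu> z))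
      = (\<Sum>\<nu>\<in>UNIV. \<Sum>\<kappa>\<in>UNIV. c \<kappa> * (levi_upper \<rho> z \<mu> \<nu> * h z \<kappa> \<nu>))"
    by (simp add: sum_distrib_left mult_ac)
  also have "\<dots> = (\<Sum>\<kappa>\<in>UNIV. c \<kappa> * (if \<kappa> = \<mu> then 1 else 0))"
    by (subst sum.swap) (simp add: levi_upper_inverse(1)[OF z] flip: sum_distrib_left)
  finally show ?thesis by (simp add: if_one_mult c_def)
qed

lemma levi_form_expand:
  assumes z: "z \<in> M" and X: "X \<in> T10 \<rho> z"
  shows "levi_form \<rho> z X Y
    = (\<Sum>\<mu>\<in>UNIV. \<Sum>\<nu>\<in>UNIV. levi_upper \<rho> z \<mu> \<nu> * levi_form \<rho> z X (Zb \<nu> z) * levi_form \<rho> z (Z \<mu> z) Y)"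
proof -
  have "levi_form \<rho> z X Y = (\<Sum>\<mu>\<in>UNIV. X $ Inl (Some \<mu>) * levi_form \<rho> z (Z \<mu> z) Y)"
  proof -
    define c where "c \<kappa> = X $ Inl (Some \<kappa>)" for \<kappa>
    show ?thesis unfolding c_def[symmetric]
      by (subst T10_expand[OF M_W[OF z] X]) (simp add: levi_form_sum levi_form_scale c_def)
  qed
  then show ?thesis unfolding levi_upper_expand[OF z X] by (simp add: sum_distrib_right)
qed

text \<open>The third derivatives of \<open>\<rho>\<close> with only the unbarred slots contracted with the frame.\<close>
definition A3 where "A3 \<alpha> \<gamma> z k = ct \<alpha> z (\<lambda>i. ct \<gamma> z (\<lambda>j. R3 i j k z))"

lemma t3_A3: "t3 \<alpha> \<gamma> \<sigma> z = ctb \<sigma> z (A3 \<alpha> \<gamma> z)"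
  by (simp add: t3_def A3_def[abs_def] ct_ctb_swap)

lemma D_holo_eq:
  assumes f: "smooth_on W f" and z: "z \<in> W"
  shows "D_holo \<rho> \<alpha> \<gamma> f z = ct \<alpha> z (\<lambda>i. ct \<gamma> z (\<lambda>j. wd i (wd j f) z))"
proof -
  have pq: "x * y / w\<^sup>2 = (x / w) * (y / w)" for x y w :: complex by (simp add: power2_eq_square)
  have "A - x * B - y * C + x * y * D = (A - y * C) - x * (B - y * D)" for A B C D x y :: complex
    by (simp add: algebra_simps)
  then show ?thesis
    unfolding D_holo_def Let_def ct_def slope_def wd_wd_commute[OF f z, of "Some \<alpha>" None] pq .
qed

lemma h_holo_eq: "z \<in> W \<Longrightarrow> h_holo \<rho> z \<alpha> \<gamma> = hh \<alpha> \<gamma> z"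
  by (simp add: h_holo_def D_holo_eq[OF smooth_R_W] hh_def)

lemma D_holo_dR: "z \<in> W \<Longrightarrow> D_holo \<rho> \<alpha> \<gamma> (wdb k R) z = A3 \<alpha> \<gamma> z k"
  by (simp add: D_holo_eq[OF smooth_on_wdb[OF open_W smooth_R_W]] A3_def)

lemma D_anti_dR:
  assumes z: "z \<in> W" shows "D_anti \<rho> \<beta> \<sigma> (wd j R) z = cnj (A3 \<beta> \<sigma> z j)"
proof -
  have s: "smooth_on W (\<lambda>x. cnj (wd j R x))" by (intro smooth_intros)
  have "wd l (\<lambda>x. cnj (wd j R x)) x = wd l (wdb j R) x" if "x \<in> W" for l x
    by (rule wd_congW[OF that s]) (rule cnj_wd_R)
  then have "wd i (wd l (\<lambda>x. cnj (wd j R x))) z = R3 i l j z" for i l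
    by (intro wd_congW[OF z] smooth_on_wd open_W s)
  then show ?thesis by (simp add: D_anti_def D_holo_eq[OF s z] A3_def)
qed

lemma fourth_order_eq: "fourth_order \<rho> \<alpha> \<beta> \<gamma> \<sigma> R z = t4 \<alpha> \<beta> \<gamma> \<sigma> z"
  by (simp add: fourth_order_def t4_def mult.assoc sum_frame sum_frameb flip: sum_distrib_left)

end

context webster_connection
begin

text \<open>The frame and the transverse field form a basis of the \<open>(1,0)\<close> vectors, because \<open>\<xi>\<close> differs from
  the tangential \<open>\<eta>\<close> by \<open>N\<close>.\<close>
lemma covector_zero:
  assumes z: "z \<in> M" and g: "\<And>\<kappa>. ct \<kappa> z g = 0" and x: "(\<Sum>j\<in>UNIV. xi z j * g j) = 0"
  shows "g c = 0"
proof -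
  have "g None / wd None R z = 0"
    using xi_contract[OF z, of g] g x by simp
  then have "g None = 0" using Rw_nz[OF M_W[OF z]] by simp
  then show ?thesis using g by (cases c) (auto simp: ct_def)
qed

text \<open>The difference of two solutions is a \<open>(1,0)\<close> vector tangent to \<open>M\<close> and orthogonal to all of the
  conjugate frame.\<close>
lemma transverse_unique:
  assumes t: "transverse_field \<rho> M \<xi> r" and z: "z \<in> M"
  shows "\<xi> z $ j = xi z j" "r z = rr z"
proof -
  note zW = M_W[OF z]
  have t1: "(\<Sum>j\<in>UNIV. wd j (wdb k R) z * \<xi> z $ j) = r z * wdb k R z" for k
    using t z unfolding transverse_field_def by blast
  have t2: "(\<Sum>j\<in>UNIV. wd j R z * \<xi> z $ j) = 1"
    using t z unfolding transverse_field_def by blast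
  define X :: "complex^('n option + 'n option)" where
    "X = (\<chi> A. case A of Inl j \<Rightarrow> \<xi> z $ j - xi z j | Inr j \<Rightarrow> 0)"
  have "X \<in> T10 \<rho> z"
    using t2 xi_dR[OF z] by (simp add: T10_iff X_def algebra_simps sum_subtractf)
  moreover have "levi_form \<rho> z X (Zb \<sigma> z) = 0" for \<sigma>
  proof -
    have "levi_form \<rho> z X (Zb \<sigma> z) = ctb \<sigma> z (\<lambda>k. \<Sum>j\<in>UNIV. X $ Inl j * wd j (wdb k R) z)"
      by (simp add: levi_form_frameb[OF zW] ctb_sum ctb_linear)
    also have "(\<lambda>k. \<Sum>j\<in>UNIV. X $ Inl j * wd j (wdb k R) z) = (\<lambda>k. (r z - rr z) * wdb k R z)"
      using t1 xi_R2[OF z] by (simp add: X_def algebra_simps sum_subtractf fun_eq_iff)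
    finally show ?thesis by (simp add: ctb_linear ctb_dR[OF zW])
  qed
  ultimately have "X = 0" by (rule T10_zero[OF z])
  then have "X $ Inl j = 0" for j by simp
  then show *: "\<xi> z $ j = xi z j" for j by (simp add: X_def)
  show "r z = rr z"
    using t1[of None] xi_R2[OF z, of None] Rwb_nz[OF zW] by (simp add: * mult.commute)
qed

lemma xi_norm2_eq:
  assumes "transverse_field \<rho> M \<xi> r" "z \<in> M" shows "xi_norm2 \<rho> \<xi> z = rr z"
  by (simp add: xi_norm2_def rr_def transverse_unique[OF assms])

text \<open>The inverse of the Levi form as a tensor of the ambient space.\<close>
definition levi_latin where
  "levi_latin z j k = (\<Sum>\<mu>\<in>UNIV. \<Sum>\<nu>\<in>UNIV. levi_upper \<rho> z \<mu> \<nu> * (Zb \<nu> z $ Inr k * Z \<mu> z $ Inl j))"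

lemma levi_latin_row:
  "(\<Sum>k\<in>UNIV. levi_latin z a k * f k)
    = (\<Sum>\<mu>\<in>UNIV. \<Sum>\<nu>\<in>UNIV. levi_upper \<rho> z \<mu> \<nu> * ctb \<nu> z f * Z \<mu> z $ Inl a)"
proof -
  have "(\<Sum>k\<in>UNIV. levi_latin z a k * f k) = (\<Sum>\<mu>\<in>UNIV. \<Sum>\<nu>\<in>UNIV. \<Sum>k\<in>UNIV. levi_upper \<rho> z \<mu> \<nu> * Z \<mu> z $ Inl a * (Zb \<nu> z $ Inr k * f k))"
    unfolding levi_latin_def sum_distrib_right
    by (subst sum.swap, rule sum.cong[OF refl], subst sum.swap) (simp add: mult_ac)
  then show ?thesis by (simp only: sum_distrib_left[symmetric] sum_frameb) (simp add: mult_ac)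
qed

lemma levi_latin_contract:
  "(\<Sum>j\<in>UNIV. \<Sum>k\<in>UNIV. levi_latin z j k * f j k)
    = (\<Sum>\<mu>\<in>UNIV. \<Sum>\<nu>\<in>UNIV. levi_upper \<rho> z \<mu> \<nu> * ct \<mu> z (\<lambda>j. ctb \<nu> z (f j)))"
proof -
  have "(\<Sum>j\<in>UNIV. \<Sum>k\<in>UNIV. levi_latin z j k * f j k)
      = (\<Sum>\<mu>\<in>UNIV. \<Sum>\<nu>\<in>UNIV. \<Sum>j\<in>UNIV. levi_upper \<rho> z \<mu> \<nu> * (Z \<mu> z $ Inl j * ctb \<nu> z (f j)))"
    unfolding levi_latin_row
    by (subst sum.swap, rule sum.cong[OF refl], subst sum.swap) (simp add: mult_ac)
  then show ?thesis by (simp only: sum_distrib_left[symmetric] sum_frame)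
qed

text \<open>As covectors in the index \<open>c\<close>, both sides agree on the frame and on the transverse field.\<close>
lemma levi_latin_completeness:
  assumes z: "z \<in> M"
  shows "(\<Sum>b\<in>UNIV. levi_latin z a b * wd c (wdb b R) z) + xi z a * wd c R z = (if c = a then 1 else 0)"
proof -
  note zW = M_W[OF z]
  let ?g = "\<lambda>c. (\<Sum>\<mu>\<in>UNIV. \<Sum>\<nu>\<in>UNIV. levi_upper \<rho> z \<mu> \<nu> * ctb \<nu> z (\<lambda>b. wd c (wdb b R) z) * Z \<mu> z $ Inl a)
        + xi z a * wd c R z - (if c = a then 1 else 0)"
  have "?g c = 0"
  proof (rule covector_zero[OF z, of ?g])
    fix \<kappa>
    have "ct \<kappa> z ?g = (\<Sum>\<mu>\<in>UNIV. (\<Sum>\<nu>\<in>UNIV. levi_upper \<rho> z \<mu> \<nu> * h z \<kappa> \<nu>) * Z \<mu> z $ Inl a)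
        - ct \<kappa> z (\<lambda>c. if c = a then 1 else 0)"
      by (simp add: ct_linear ct_sum ct_dR[OF zW] levi_eq[OF zW] sum_distrib_right)
    also have "\<dots> = 0"
      by (simp add: levi_upper_inverse[OF z] sum_delta_mult) (cases a; auto simp: ct_def)
    finally show "ct \<kappa> z ?g = 0" .
  next
    have "(\<Sum>c\<in>UNIV. xi z c * (\<Sum>\<mu>\<in>UNIV. \<Sum>\<nu>\<in>UNIV. levi_upper \<rho> z \<mu> \<nu> * ctb \<nu> z (\<lambda>b. wd c (wdb b R) z) * Z \<mu> z $ Inl a))
        = (\<Sum>\<mu>\<in>UNIV. \<Sum>\<nu>\<in>UNIV. levi_upper \<rho> z \<mu> \<nu> * Z \<mu> z $ Inl a * ctb \<nu> z (\<lambda>b. \<Sum>c\<in>UNIV. xi z c * wd c (wdb b R) z))"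
      unfolding ctb_sum ctb_linear sum_distrib_left
      by (subst sum.swap, rule sum.cong[OF refl], subst sum.swap) (simp add: mult_ac)
    also have "\<dots> = 0" by (simp add: xi_R2[OF z] ctb_linear ctb_dR[OF zW])
    finally show "(\<Sum>c\<in>UNIV. xi z c * ?g c) = 0"
      using xi_dR[OF z]
      by (simp add: right_diff_distrib distrib_left sum.distrib sum_subtractf if_one_mult mult.left_commute[of _ "xi z a"]
          flip: sum_distrib_left)
  qed
  then show ?thesis unfolding levi_latin_row by simp
qed

lemma levi_latin_dR: "z \<in> W \<Longrightarrow> (\<Sum>b\<in>UNIV. levi_latin z a b * wdb b R z) = 0"
  by (simp add: levi_latin_row ctb_dR)

text \<open>In the basis \<open>Z\<^sub>1, \<dots>, Z\<^sub>n, \<xi>\<close> the form \<open>\<psi>\<close> is block diagonal, with the Levi matrix and \<open>1\<close> on the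
  diagonal. Hence its inverse is that of the Levi form plus \<open>\<xi> \<otimes> \<xi>\<close>.\<close>
lemma h_latin_eq:
  assumes t: "transverse_field \<rho> M \<xi> r" and z: "z \<in> M"
  shows "h_latin \<rho> \<xi> r z j k = levi_latin z j k"
proof -
  note zW = M_W[OF z]
  have "upper (psi \<rho> r z) a b = levi_latin z a b + xi z a * cnj (xi z b)" for a b
  proof (rule upper_unique(2))
    fix a c
    have psi_xi: "(\<Sum>b\<in>UNIV. cnj (xi z b) * psi \<rho> r z $ c $ b) = wd c R z"
    proof -
      have "(\<Sum>b\<in>UNIV. cnj (xi z b) * psi \<rho> r z $ c $ b) = (\<Sum>b\<in>UNIV. cnj (xi z b) * wd c (wdb b R) z)
        + (1 - rr z) * wd c R z * cnj (\<Sum>b\<in>UNIV. xi z b * wd b R z)"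
        by (simp add: psi_def transverse_unique[OF t z] distrib_left sum.distrib sum_distrib_left mult_ac cnj_wd_R[OF zW])
      then show ?thesis by (simp add: cnj_xi_R2[OF z] xi_dR[OF z] algebra_simps)
    qed
    have psi_L: "(\<Sum>b\<in>UNIV. levi_latin z a b * psi \<rho> r z $ c $ b) = (\<Sum>b\<in>UNIV. levi_latin z a b * wd c (wdb b R) z)"
    proof -
      have "(\<Sum>b\<in>UNIV. levi_latin z a b * psi \<rho> r z $ c $ b) = (\<Sum>b\<in>UNIV. levi_latin z a b * wd c (wdb b R) z)
        + (1 - r z) * wd c R z * (\<Sum>b\<in>UNIV. levi_latin z a b * wdb b R z)"
        by (simp add: psi_def distrib_left sum.distrib sum_distrib_left mult_ac)
      then show ?thesis by (simp add: levi_latin_dR[OF zW])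
    qed
    have "(\<Sum>b\<in>UNIV. (levi_latin z a b + xi z a * cnj (xi z b)) * psi \<rho> r z $ c $ b)
        = (\<Sum>b\<in>UNIV. levi_latin z a b * psi \<rho> r z $ c $ b) + xi z a * (\<Sum>b\<in>UNIV. cnj (xi z b) * psi \<rho> r z $ c $ b)"
      by (simp add: distrib_right sum.distrib sum_distrib_left mult.assoc)
    also have "\<dots> = (if c = a then 1 else 0)"
      unfolding psi_xi psi_L by (rule levi_latin_completeness[OF z])
    finally show "(\<Sum>b\<in>UNIV. (levi_latin z a b + xi z a * cnj (xi z b)) * psi \<rho> r z $ c $ b) = (if c = a then 1 else 0)" .
  qed
  then show ?thesis by (simp add: h_latin_def transverse_unique[OF t z])
qed

subsection \<open>The curvature in terms of the inverse Levi form\<close>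

text \<open>Raising the index of \<open>q\<close> gives the components of \<open>\<eta>\<close>.\<close>
lemma eta_upper:
  assumes z: "z \<in> M"
  shows "(\<Sum>\<nu>\<in>UNIV. levi_upper \<rho> z \<mu> \<nu> * q \<nu> z) = xi z (Some \<mu>)"
    and "(\<Sum>\<mu>\<in>UNIV. levi_upper \<rho> z \<mu> \<nu> * cnj (q \<mu> z)) = cnj (xi z (Some \<nu>))"
proof -
  have q: "q \<nu> z = (\<Sum>\<kappa>\<in>UNIV. xi z (Some \<kappa>) * h z \<kappa> \<nu>)" for \<nu>
    by (subst levi_eta[OF z, symmetric]) (simp add: eta_def levi_form_sum levi_form_scale flip: levi_def)
  have "(\<Sum>\<nu>\<in>UNIV. levi_upper \<rho> z \<mu> \<nu> * q \<nu> z) = (\<Sum>\<kappa>\<in>UNIV. xi z (Some \<kappa>) * (\<Sum>\<nu>\<in>UNIV. levi_upper \<rho> z \<mu> \<nu> * h z \<kappa> \<nu>))"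
    unfolding q sum_distrib_left by (subst sum.swap) (simp add: mult_ac)
  then show "(\<Sum>\<nu>\<in>UNIV. levi_upper \<rho> z \<mu> \<nu> * q \<nu> z) = xi z (Some \<mu>)"
    by (simp add: levi_upper_inverse[OF z] if_one_mult)
  have "(\<Sum>\<mu>\<in>UNIV. levi_upper \<rho> z \<mu> \<nu> * cnj (q \<mu> z)) = (\<Sum>\<kappa>\<in>UNIV. cnj (xi z (Some \<kappa>)) * (\<Sum>\<mu>\<in>UNIV. levi_upper \<rho> z \<mu> \<nu> * h z \<mu> \<kappa>))"
    unfolding q cnj_sum complex_cnj_mult cnj_levi[OF M_W[OF z]] sum_distrib_left by (subst sum.swap) (simp add: mult_ac)
  then show "(\<Sum>\<mu>\<in>UNIV. levi_upper \<rho> z \<mu> \<nu> * cnj (q \<mu> z)) = cnj (xi z (Some \<nu>))"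
    by (simp add: levi_upper_inverse[OF z] if_one_mult)
qed

lemma xi_contract_cnj:
  assumes z: "z \<in> M"
  shows "(\<Sum>\<mu>\<in>UNIV. cnj (xi z (Some \<mu>)) * ctb \<mu> z f) = (\<Sum>j\<in>UNIV. cnj (xi z j) * f j) - f None / wdb None R z"
  using arg_cong[OF xi_contract[OF z, of "\<lambda>j. cnj (f j)"], of cnj]
  by (simp add: cnj_ct cnj_wd_R[OF M_W[OF z]])

text \<open>The Levi pairing of \<open>curvature_frame\<close> is expanded with the inverse Levi matrix. Contracting the
  third derivatives with \<open>\<eta> = \<xi> - N\<close> gives the terms with \<open>\<xi>\<close>, and the terms with \<open>N\<close> cancel those
  of \<open>curvature_frame\<close>.\<close>
lemma curvature_formula:
  assumes z: "z \<in> M"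
  shows "psh_curvature \<rho> nabla z \<alpha> \<beta> \<gamma> \<sigma> = - t4 \<alpha> \<beta> \<gamma> \<sigma> z
    + levi_trace z (\<lambda>\<mu> \<nu>. t3 \<alpha> \<gamma> \<nu> z * cnj (t3 \<beta> \<sigma> \<mu> z))
    + rr z * (h z \<alpha> \<beta> * h z \<gamma> \<sigma> + h z \<alpha> \<sigma> * h z \<gamma> \<beta>)
    + (\<Sum>k\<in>UNIV. cnj (xi z k) * A3 \<alpha> \<gamma> z k) * cnj (hh \<beta> \<sigma> z)
    + hh \<alpha> \<gamma> z * (\<Sum>j\<in>UNIV. xi z j * cnj (A3 \<beta> \<sigma> z j))
    - rr z * (hh \<alpha> \<gamma> z * cnj (hh \<beta> \<sigma> z))"
proof -
  note zW = M_W[OF z]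
  let ?V = "\<lambda>\<alpha> \<gamma>. nabla (Z \<alpha>) (Z \<gamma>) z"
  define u where "u = levi_upper \<rho> z"
  have V: "?V \<alpha> \<gamma> \<in> T10 \<rho> z" for \<alpha> \<gamma> by (rule nabla_T10[OF frame_vfields frame_vfields10 z])
  have V': "levi_form \<rho> z (Z \<mu> z) (vconj (?V \<beta> \<sigma>)) = cnj (t3 \<beta> \<sigma> \<mu> z) + cnj (hh \<beta> \<sigma> z) * cnj (q \<mu> z)" for \<mu>
    using levi_form_cnj[OF zW, of "?V \<beta> \<sigma>" "Zb \<mu> z"] V[of \<beta> \<sigma>]
    by (simp add: nabla_frame_frame[OF z] T10_iff) (simp add: frameb_def)
  have 1: "(\<Sum>\<mu>\<in>UNIV. \<Sum>\<nu>\<in>UNIV. u \<mu> \<nu> * q \<nu> z * f \<mu>) = (\<Sum>\<mu>\<in>UNIV. xi z (Some \<mu>) * f \<mu>)" for f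
    unfolding sum_distrib_right[symmetric] u_def eta_upper(1)[OF z] ..
  have 2: "(\<Sum>\<mu>\<in>UNIV. \<Sum>\<nu>\<in>UNIV. u \<mu> \<nu> * f \<nu> * cnj (q \<mu> z)) = (\<Sum>\<nu>\<in>UNIV. cnj (xi z (Some \<nu>)) * f \<nu>)" for f
  proof -
    have "(\<Sum>\<mu>\<in>UNIV. \<Sum>\<nu>\<in>UNIV. u \<mu> \<nu> * f \<nu> * cnj (q \<mu> z)) = (\<Sum>\<nu>\<in>UNIV. (\<Sum>\<mu>\<in>UNIV. u \<mu> \<nu> * cnj (q \<mu> z)) * f \<nu>)"
      unfolding sum_distrib_right by (subst sum.swap) (simp add: mult_ac)
    then show ?thesis unfolding u_def eta_upper(2)[OF z] .
  qed
  have qq: "(\<Sum>\<mu>\<in>UNIV. \<Sum>\<nu>\<in>UNIV. u \<mu> \<nu> * q \<nu> z * cnj (q \<mu> z)) = rNN z - rr z"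
  proof -
    have "levi_form \<rho> z (eta z) (vconj (eta z)) = (\<Sum>\<mu>\<in>UNIV. xi z (Some \<mu>) * levi_form \<rho> z (Z \<mu> z) (vconj (eta z)))"
      by (subst eta_def) (simp add: levi_form_sum levi_form_scale)
    then show ?thesis unfolding 1 levi_cnj_eta[OF z] levi_eta_eta[OF z] by simp
  qed
  have tB: "(\<Sum>\<mu>\<in>UNIV. \<Sum>\<nu>\<in>UNIV. u \<mu> \<nu> * q \<nu> z * cnj (t3 \<beta> \<sigma> \<mu> z)) = (\<Sum>j\<in>UNIV. xi z j * cnj (A3 \<beta> \<sigma> z j)) - cnj (t3Nb \<beta> \<sigma> z)"
    unfolding 1 t3_A3 cnj_ctb xi_contract[OF z] by (simp add: A3_def t3Nb_def cnj_wdb_R[OF zW])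
  have tA: "(\<Sum>\<mu>\<in>UNIV. \<Sum>\<nu>\<in>UNIV. u \<mu> \<nu> * t3 \<alpha> \<gamma> \<nu> z * cnj (q \<mu> z)) = (\<Sum>k\<in>UNIV. cnj (xi z k) * A3 \<alpha> \<gamma> z k) - t3Nb \<alpha> \<gamma> z"
    unfolding 2 t3_A3 xi_contract_cnj[OF z] by (simp add: A3_def t3Nb_def)
  have e: "v * (a + h * b) * (c + k * d) = v * a * c + h * (v * b * c) + k * (v * a * d) + h * k * (v * b * d)"
    for v a b c d h k :: complex by (simp add: algebra_simps)
  have 3: "levi_form \<rho> z (?V \<alpha> \<gamma>) (vconj (?V \<beta> \<sigma>))
      = (\<Sum>\<mu>\<in>UNIV. \<Sum>\<nu>\<in>UNIV. u \<mu> \<nu> * t3 \<alpha> \<gamma> \<nu> z * cnj (t3 \<beta> \<sigma> \<mu> z))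
      + hh \<alpha> \<gamma> z * ((\<Sum>j\<in>UNIV. xi z j * cnj (A3 \<beta> \<sigma> z j)) - cnj (t3Nb \<beta> \<sigma> z))
      + cnj (hh \<beta> \<sigma> z) * ((\<Sum>k\<in>UNIV. cnj (xi z k) * A3 \<alpha> \<gamma> z k) - t3Nb \<alpha> \<gamma> z)
      + hh \<alpha> \<gamma> z * cnj (hh \<beta> \<sigma> z) * (rNN z - rr z)"
    unfolding tA[symmetric] tB[symmetric] qq[symmetric]
    by (subst levi_form_expand[OF z V], unfold V' nabla_frame_frame[OF z] u_def[symmetric] e)
      (simp only: sum.distrib sum_distrib_left[symmetric])
  have S: "(\<Sum>\<mu>\<in>UNIV. \<Sum>\<nu>\<in>UNIV. u \<mu> \<nu> * t3 \<alpha> \<gamma> \<nu> z * cnj (t3 \<beta> \<sigma> \<mu> z))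
      = levi_trace z (\<lambda>\<mu> \<nu>. t3 \<alpha> \<gamma> \<nu> z * cnj (t3 \<beta> \<sigma> \<mu> z))"
    by (simp add: levi_trace_def u_def mult.assoc)
  have final: "- t + r * l + ch * tA + h * tB - h * ch * n + (S + h * (B - tB) + ch * (A - tA) + h * ch * (n - r))
      = - t + S + r * l + A * ch + h * B - r * (h * ch)" for t r l ch h tA tB n S A B :: complex
    by (simp add: algebra_simps)
  show ?thesis unfolding curvature_frame[OF z] 3 S by (rule final)
qed

end

section \<open>Second derivatives of the logarithm of a determinant\<close>

lemma smooth_onI:
  assumes "open S" "\<And>x. x \<in> S \<Longrightarrow> (f has_derivative F x) (at x)" "\<And>v. smooth_on S (\<lambda>x. F x v)"
  shows "smooth_on S f"
proof -
  have "Ck_on (Suc k) S f" for k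
    by (rule Ck_on_SucI[OF assms(1,2)]) (use assms(3) in \<open>auto simp: smooth_on_def\<close>)
  then show ?thesis unfolding smooth_on_def using Ck_on_Suc_imp by blast
qed

lemma wirt_sum: "wirt A (\<lambda>v. \<Sum>i\<in>I. F i v) = (\<Sum>i\<in>I. wirt A (F i))"
proof (induction I rule: infinite_finite_induct)
  case (insert x I)
  then show ?case by (simp add: wirt_add)
qed (cases A; simp)+

lemma pd_prod:
  assumes "\<And>i. i \<in> I \<Longrightarrow> f i differentiable at z"
  shows "pd A (\<lambda>x. \<Prod>i\<in>I. f i x) z = (\<Sum>i\<in>I. pd A (f i) z * (\<Prod>j\<in>I - {i}. f j z))"
proof -
  have D: "((\<lambda>x. \<Prod>i\<in>I. f i x) has_derivative
      (\<lambda>y. \<Sum>i\<in>I. frechet_derivative (f i) (at z) y * (\<Prod>j\<in>I - {i}. f j z))) (at z)"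
    by (rule has_derivative_prod) (rule frechet_derivative_worksI[OF assms])
  show ?thesis
    unfolding pd_has_derivative[OF D] wirt_sum wirt_scale
    unfolding pd_eq_wirt ..
qed

lemma smooth_on_det:
  fixes \<Phi> :: "'a::real_normed_vector \<Rightarrow> complex^'k^'k::finite"
  assumes "open S" "\<And>i j. smooth_on S (\<lambda>x. \<Phi> x $ i $ j)"
  shows "smooth_on S (\<lambda>x. det (\<Phi> x))"
  unfolding det_def by (intro smooth_on_sum smooth_on_mult smooth_on_prod smooth_on_const assms)

text \<open>Jacobi's formula. The derivative of the determinant is the sum over all rows of the
  determinants with that row differentiated; expressing the differentiated row through the rows
  of \<open>\<Phi>\<close> and using Cramer's rule, only a diagonal coefficient survives.\<close>
lemma pd_det:
  fixes \<Phi> :: "complex^'m::finite \<Rightarrow> complex^'k^'k::finite"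
  assumes d: "\<And>i j. (\<lambda>x. \<Phi> x $ i $ j) differentiable at z" and nz: "det (\<Phi> z) \<noteq> 0"
  shows "pd A (\<lambda>x. det (\<Phi> x)) z
    = det (\<Phi> z) * (\<Sum>i\<in>UNIV. \<Sum>j\<in>UNIV. upper (\<Phi> z) i j * pd A (\<lambda>x. \<Phi> x $ i $ j) z)"
proof -
  define D where "D i j = pd A (\<lambda>x. \<Phi> x $ i $ j) z" for i j
  let ?P = "{p. p permutes (UNIV :: 'k set)}"
  have fin: "finite ?P" by (simp add: finite_permutations)
  have dp: "(\<lambda>x. \<Prod>i\<in>UNIV. \<Phi> x $ i $ p i) differentiable at z" for p
    unfolding differentiable_def by (rule exI, rule has_derivative_prod, rule frechet_derivative_worksI[OF d])
  have "pd A (\<lambda>x. det (\<Phi> x)) z = (\<Sum>p\<in>?P. of_int (sign p) * (\<Sum>i\<in>UNIV. D i (p i) * (\<Prod>j\<in>UNIV - {i}. \<Phi> z $ j $ p j)))"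
    unfolding det_def
    by (subst pd_sum) (auto simp: fin dp differentiable_mult pd_mult pd_prod d D_def)
  also have "\<dots> = (\<Sum>i\<in>UNIV. \<Sum>p\<in>?P. of_int (sign p) * (D i (p i) * (\<Prod>j\<in>UNIV - {i}. \<Phi> z $ j $ p j)))"
    unfolding sum_distrib_left by (rule sum.swap)
  also have "\<dots> = (\<Sum>i\<in>UNIV. (\<Sum>j\<in>UNIV. upper (\<Phi> z) i j * D i j) * det (\<Phi> z))"
  proof (rule sum.cong[OF refl])
    fix i :: 'k
    let ?B = "(\<chi> r. if r = i then (\<chi> c. D i c) else row r (\<Phi> z)) :: complex^'k^'k"
    have "(\<Prod>j\<in>UNIV. ?B $ j $ p j) = D i (p i) * (\<Prod>j\<in>UNIV - {i}. \<Phi> z $ j $ p j)" for p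
      by (subst prod.remove[of _ i]) (auto simp: row_def intro!: prod.cong)
    then have 1: "(\<Sum>p\<in>?P. of_int (sign p) * (D i (p i) * (\<Prod>j\<in>UNIV - {i}. \<Phi> z $ j $ p j))) = det ?B"
      by (simp add: det_def)
    define x :: "complex^'k" where "x = (\<chi> r. \<Sum>c\<in>UNIV. upper (\<Phi> z) r c * D i c)"
    have inv: "invertible (\<Phi> z)" using nz by (simp add: invertible_det_nz)
    have rows: "(\<Sum>r\<in>UNIV. x $ r *s row r (\<Phi> z)) = (\<chi> c. D i c)"
    proof (rule vec_eq_iff[THEN iffD2], rule allI)
      fix b
      have "(\<Sum>r\<in>UNIV. x $ r *s row r (\<Phi> z)) $ b = (\<Sum>r\<in>UNIV. \<Sum>c\<in>UNIV. D i c * (upper (\<Phi> z) r c * \<Phi> z $ r $ b))"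
        by (simp add: x_def row_def sum_distrib_right sum_distrib_left mult_ac)
      also have "\<dots> = (\<Sum>c\<in>UNIV. D i c * (if c = b then 1 else 0))"
        by (subst sum.swap) (simp add: upper_inverse(2)[OF inv] flip: sum_distrib_left)
      finally show "(\<Sum>r\<in>UNIV. x $ r *s row r (\<Phi> z)) $ b = (\<chi> c. D i c) $ b" by (simp add: if_one_mult)
    qed
    have "det ?B = x $ i * det (\<Phi> z)"
      using cramer_lemma_transpose[of i x "\<Phi> z"] unfolding rows .
    then show "(\<Sum>p\<in>?P. of_int (sign p) * (D i (p i) * (\<Prod>j\<in>UNIV - {i}. \<Phi> z $ j $ p j)))
        = (\<Sum>j\<in>UNIV. upper (\<Phi> z) i j * D i j) * det (\<Phi> z)"
      by (simp add: 1 x_def)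
  qed
  finally show ?thesis unfolding D_def sum_distrib_right[symmetric] by (simp only: mult.commute)
qed

text \<open>By Cramer's rule.\<close>
lemma smooth_on_upper:
  fixes \<Phi> :: "'a::real_normed_vector \<Rightarrow> complex^'k^'k::finite"
  assumes S: "open S" and s: "\<And>i j. smooth_on S (\<lambda>x. \<Phi> x $ i $ j)" and nz: "\<And>x. x \<in> S \<Longrightarrow> det (\<Phi> x) \<noteq> 0"
  shows "smooth_on S (\<lambda>x. upper (\<Phi> x) a b)"
proof -
  have eq: "upper A a b = det (\<chi> i j. if j = b then (axis a 1 :: complex^'k) $ i else A $ i $ j) / det A"
    if "det A \<noteq> 0" for A :: "complex^'k^'k"
  proof -
    have "A *v (matrix_inv A *v axis a 1) = axis a 1"
      using matrix_inv_both[of A] that by (simp add: invertible_det_nz matrix_vector_mul_assoc)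
    then have "(matrix_inv A *v axis a 1) $ b = det (\<chi> i j. if j = b then (axis a 1 :: complex^'k) $ i else A $ i $ j) / det A"
      using cramer[OF that] by simp
    moreover have "(matrix_inv A *v axis a 1) $ b = matrix_inv A $ b $ a"
      by (simp add: matrix_vector_mult_def axis_def if_one_mult)
    ultimately show ?thesis by (simp add: upper_def)
  qed
  have "smooth_on S (\<lambda>x. (\<chi> i j. if j = b then (axis a 1 :: complex^'k) $ i else \<Phi> x $ i $ j) $ i $ j)" for i j
    using s by (cases "j = b") simp_all
  then have "smooth_on S (\<lambda>x. det (\<chi> i j. if j = b then (axis a 1 :: complex^'k) $ i else \<Phi> x $ i $ j) / det (\<Phi> x))"
    using nz by (intro smooth_on_divide smooth_on_det S s)
  then show ?thesis by (rule smooth_on_cong[OF S]) (simp add: eq nz)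
qed

text \<open>The familiar \<open>d(\<Phi>\<^sup>-\<^sup>1) = - \<Phi>\<^sup>-\<^sup>1 d\<Phi> \<Phi>\<^sup>-\<^sup>1\<close>.\<close>
lemma pd_upper:
  fixes \<Phi> :: "complex^'m::finite \<Rightarrow> complex^'k^'k::finite"
  assumes S: "open S" "z \<in> S" and s: "\<And>i j. smooth_on S (\<lambda>x. \<Phi> x $ i $ j)"
    and nz: "\<And>x. x \<in> S \<Longrightarrow> det (\<Phi> x) \<noteq> 0"
  shows "pd A (\<lambda>x. upper (\<Phi> x) a b) z
    = - (\<Sum>c\<in>UNIV. \<Sum>d\<in>UNIV. upper (\<Phi> z) a d * pd A (\<lambda>x. \<Phi> x $ c $ d) z * upper (\<Phi> z) c b)"
proof -
  define u where "u i j = upper (\<Phi> z) i j" for i j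
  define u' where "u' i j = pd A (\<lambda>x. upper (\<Phi> x) i j) z" for i j
  define D where "D i j = pd A (\<lambda>x. \<Phi> x $ i $ j) z" for i j
  have du: "(\<lambda>x. upper (\<Phi> x) i j) differentiable at z" for i j
    by (rule smooth_on_differentiable[OF smooth_on_upper[OF S(1) s nz] S(2)])
  have d\<Phi>: "(\<lambda>x. \<Phi> x $ i $ j) differentiable at z" for i j
    by (rule smooth_on_differentiable[OF s S(2)])
  have inv: "invertible (\<Phi> x)" if "x \<in> S" for x using nz[OF that] by (simp add: invertible_det_nz)
  have "(\<Sum>d\<in>UNIV. u' a d * \<Phi> z $ c $ d) = - (\<Sum>d\<in>UNIV. u a d * D c d)" for c
  proof -
    have "pd A (\<lambda>x. \<Sum>d\<in>UNIV. upper (\<Phi> x) a d * \<Phi> x $ c $ d) z = pd A (\<lambda>x. if c = a then 1 else 0) z"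
      by (rule pd_cong[OF S]) (auto simp: upper_inverse(1)[OF inv] intro!: differentiable_sum differentiable_mult du d\<Phi>)
    also have "\<dots> = 0" by (rule pd_const)
    also have "pd A (\<lambda>x. \<Sum>d\<in>UNIV. upper (\<Phi> x) a d * \<Phi> x $ c $ d) z = (\<Sum>d\<in>UNIV. u' a d * \<Phi> z $ c $ d) + (\<Sum>d\<in>UNIV. u a d * D c d)"
      by (simp add: pd_sum pd_mult differentiable_mult du d\<Phi> sum.distrib u_def u'_def D_def)
    finally show ?thesis by (simp add: eq_neg_iff_add_eq_0)
  qed
  then have "(\<Sum>c\<in>UNIV. (\<Sum>d\<in>UNIV. u' a d * \<Phi> z $ c $ d) * u c b) = - (\<Sum>c\<in>UNIV. (\<Sum>d\<in>UNIV. u a d * D c d) * u c b)"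
    by (simp add: sum_negf)
  also have "(\<Sum>c\<in>UNIV. (\<Sum>d\<in>UNIV. u' a d * \<Phi> z $ c $ d) * u c b) = (\<Sum>d\<in>UNIV. u' a d * (\<Sum>c\<in>UNIV. u c b * \<Phi> z $ c $ d))"
    unfolding sum_distrib_left sum_distrib_right by (subst sum.swap) (simp add: mult_ac)
  also have "\<dots> = u' a b"
    by (simp add: u_def upper_inverse(2)[OF inv[OF S(2)]] if_one_mult)
  finally show ?thesis by (simp add: u_def u'_def D_def sum_distrib_right)
qed

text \<open>For a function with real values the logarithm of the modulus has the same derivative as a
  logarithm, also where the function is negative.\<close>
lemma has_derivative_ln_cmod:
  fixes f :: "'a::real_normed_vector \<Rightarrow> complex"
  assumes S: "open S" "z \<in> S" and f: "smooth_on S f"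
    and real: "\<And>x. x \<in> S \<Longrightarrow> cnj (f x) = f x" and nz: "f z \<noteq> 0"
  shows "((\<lambda>x. complex_of_real (ln (cmod (f x)))) has_derivative (\<lambda>v. frechet_derivative f (at z) v / f z)) (at z)"
proof -
  define F where "F = frechet_derivative f (at z)"
  have F: "(f has_derivative F) (at z)"
    unfolding F_def by (rule frechet_derivative_worksI[OF smooth_on_differentiable[OF f S(2)]])
  have "((\<lambda>x. cnj (f x)) has_derivative (\<lambda>v. cnj (F v))) (at z)"
    by (rule bounded_linear.has_derivative[OF bounded_linear_cnj F])
  then have "(f has_derivative (\<lambda>v. cnj (F v))) (at z)"
    by (rule has_derivative_transform_within_open[OF _ S]) (rule real)
  then have "F = (\<lambda>v. cnj (F v))" using F has_derivative_unique by blast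
  then have F_real: "F v = complex_of_real (Re (F v))" for v
    by (metis Reals_cnj_iff of_real_Re)
  have f_real: "f z = complex_of_real (Re (f z))" using real[OF S(2)] by (metis Reals_cnj_iff of_real_Re)
  have "((\<lambda>x. complex_of_real (ln (cmod (f x)))) has_derivative (\<lambda>v. complex_of_real (F v \<bullet> sgn (f z) * inverse (cmod (f z))))) (at z)"
    by (intro bounded_linear.has_derivative[OF bounded_linear_of_real] has_derivative_ln
        has_derivative_compose[OF F, where g=norm] has_derivative_norm) (use nz in auto)
  moreover have "complex_of_real (F v \<bullet> sgn (f z) * inverse (cmod (f z))) = F v / f z" for v
  proof -
    define a b where "a = Re (F v)" and "b = Re (f z)"
    have "b \<noteq> 0" using nz f_real unfolding b_def by auto
    then have "(complex_of_real a \<bullet> sgn (complex_of_real b)) * inverse (cmod (complex_of_real b)) = a / b"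
      by (simp add: inner_complex_def sgn_if sgn_of_real field_simps)
    then have "complex_of_real ((complex_of_real a \<bullet> sgn (complex_of_real b)) * inverse (cmod (complex_of_real b)))
        = complex_of_real a / complex_of_real b" by simp
    then show ?thesis using F_real[of v] f_real by (simp add: a_def b_def)
  qed
  ultimately show ?thesis by (simp add: F_def)
qed

lemma smooth_on_ln_cmod:
  fixes f :: "'a::real_normed_vector \<Rightarrow> complex"
  assumes S: "open S" and f: "smooth_on S f"
    and real: "\<And>x. x \<in> S \<Longrightarrow> cnj (f x) = f x" and nz: "\<And>x. x \<in> S \<Longrightarrow> f x \<noteq> 0"
  shows "smooth_on S (\<lambda>x. complex_of_real (ln (cmod (f x))))"
  by (rule smooth_onI[OF S has_derivative_ln_cmod[OF S _ f real nz]])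
    (auto intro!: smooth_on_divide smooth_on_frechet S f nz)

text \<open>The derivative of \<open>log |det \<Phi>|\<close> is the trace of \<open>\<Phi>\<^sup>-\<^sup>1 d\<Phi>\<close> by Jacobi's formula, and the inverse is
  differentiated by \<open>pd_upper\<close>. The sign in the logarithm is that of the Levi--Fefferman
  determinant.\<close>
lemma pd_pd_ln_det:
  fixes \<Phi> :: "complex^'m::finite \<Rightarrow> complex^'k^'k::finite"
  assumes S: "open S" "z \<in> S" and s: "\<And>i j. smooth_on S (\<lambda>x. \<Phi> x $ i $ j)"
    and nz: "\<And>x. x \<in> S \<Longrightarrow> det (\<Phi> x) \<noteq> 0" and real: "\<And>x. x \<in> S \<Longrightarrow> cnj (det (\<Phi> x)) = det (\<Phi> x)"
  shows "pd A (pd B (\<lambda>x. complex_of_real (ln (cmod (- det (\<Phi> x)))))) z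
    = (\<Sum>i\<in>UNIV. \<Sum>j\<in>UNIV. upper (\<Phi> z) i j * pd A (pd B (\<lambda>x. \<Phi> x $ i $ j)) z)
    - (\<Sum>i\<in>UNIV. \<Sum>j\<in>UNIV. \<Sum>c\<in>UNIV. \<Sum>d\<in>UNIV. upper (\<Phi> z) i d * pd A (\<lambda>x. \<Phi> x $ c $ d) z * upper (\<Phi> z) c j * pd B (\<lambda>x. \<Phi> x $ i $ j) z)"
proof -
  let ?L = "\<lambda>x. complex_of_real (ln (cmod (det (\<Phi> x))))"
  have sd: "smooth_on S (\<lambda>x. det (\<Phi> x))" by (rule smooth_on_det[OF S(1) s])
  have su: "smooth_on S (\<lambda>x. upper (\<Phi> x) i j)" for i j by (rule smooth_on_upper[OF S(1) s nz])
  have sL: "smooth_on S ?L" by (rule smooth_on_ln_cmod[OF S(1) sd real nz])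
  have d\<Phi>: "(\<lambda>x. \<Phi> x $ i $ j) differentiable at x" if "x \<in> S" for i j x
    by (rule smooth_on_differentiable[OF s that])
  have 1: "pd B ?L x = (\<Sum>i\<in>UNIV. \<Sum>j\<in>UNIV. upper (\<Phi> x) i j * pd B (\<lambda>x. \<Phi> x $ i $ j) x)" if x: "x \<in> S" for x
  proof -
    have "pd B ?L x = wirt B (\<lambda>v. frechet_derivative (\<lambda>x. det (\<Phi> x)) (at x) v / det (\<Phi> x))"
      by (rule pd_has_derivative[OF has_derivative_ln_cmod[OF S(1) x sd real nz[OF x]]])
    then have "pd B ?L x = pd B (\<lambda>x. det (\<Phi> x)) x / det (\<Phi> x)"
      unfolding divide_inverse wirt_scale(2) pd_eq_wirt .
    then show ?thesis by (simp add: pd_det[OF d\<Phi>[OF x] nz[OF x]] nz[OF x])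
  qed
  have dd: "pd B (\<lambda>x. \<Phi> x $ i $ j) differentiable at z" "(\<lambda>x. upper (\<Phi> x) i j) differentiable at z" for i j
    by (rule smooth_on_differentiable[OF _ S(2)]; intro pd_smooth_on S s su)+
  have "pd A (pd B ?L) z = pd A (\<lambda>x. \<Sum>i\<in>UNIV. \<Sum>j\<in>UNIV. upper (\<Phi> x) i j * pd B (\<lambda>x. \<Phi> x $ i $ j) x) z"
    by (rule pd_cong[OF S 1 smooth_on_differentiable[OF pd_smooth_on[OF S(1) sL] S(2)]])
  also have "\<dots> = (\<Sum>i\<in>UNIV. \<Sum>j\<in>UNIV. pd A (\<lambda>x. upper (\<Phi> x) i j) z * pd B (\<lambda>x. \<Phi> x $ i $ j) z
      + upper (\<Phi> z) i j * pd A (pd B (\<lambda>x. \<Phi> x $ i $ j)) z)"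
    by (simp add: pd_sum pd_mult differentiable_sum differentiable_mult dd)
  finally show ?thesis
    by (simp add: pd_upper[OF S s nz] sum.distrib sum_subtractf sum_distrib_right sum_negf)
qed

section \<open>The Ricci tensor and the Levi--Fefferman determinant\<close>

context hypersurface
begin

text \<open>The bordered Hessian of \<open>\<rho>\<close>, whose determinant is \<open>- J(\<rho>)\<close>. The outer \<open>None\<close> is the index of the
  border.\<close>
fun Phi_entry :: "'n option option \<Rightarrow> 'n option option \<Rightarrow> complex^('n option) \<Rightarrow> complex" where
  "Phi_entry None None = R"
| "Phi_entry None (Some k) = wdb k R"
| "Phi_entry (Some j) None = wd j R"
| "Phi_entry (Some j) (Some k) = wd j (wdb k R)"

definition Phi :: "complex^('n option) \<Rightarrow> complex^('n option option)^('n option option)"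
  where "Phi x = (\<chi> a b. Phi_entry a b x)"

lemma Phi_nth [simp]: "Phi x $ a $ b = Phi_entry a b x"
  by (simp add: Phi_def)

lemma levi_fefferman_eq: "levi_fefferman \<rho> x = - det (Phi x)"
  unfolding levi_fefferman_def Phi_def
  by (intro arg_cong[where f=uminus] arg_cong[where f=det] Cart_lambda_cong) (auto split: option.split)

lemma smooth_Phi_entry: "smooth_on W (Phi_entry a b)"
  by (cases a; cases b) (auto intro!: smooth_intros)

lemma cnj_Phi_entry: "x \<in> W \<Longrightarrow> cnj (Phi_entry a b x) = Phi_entry b a x"
  by (cases a; cases b) (simp_all add: cnj_wd_R cnj_wdb_R cnj_R2)

text \<open>The bordered Hessian is Hermitian.\<close>
lemma cnj_det_Phi: assumes "x \<in> W" shows "cnj (det (Phi x)) = det (Phi x)"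
proof -
  have "cnj (det (Phi x)) = det (transpose (Phi x))"
    by (simp add: det_def transpose_def cnj_Phi_entry[OF assms])
  then show ?thesis by simp
qed

lemma D_mixed_eq:
  assumes S: "open S" "z \<in> S" "S \<subseteq> W" and f: "smooth_on S f"
  shows "D_mixed \<rho> \<alpha> \<beta> f z = ct \<alpha> z (\<lambda>j. ctb \<beta> z (\<lambda>k. wd j (wdb k f) z))"
proof -
  have zW: "z \<in> W" using S by auto
  have c: "wdb None (wd (Some \<alpha>) f) z = wd (Some \<alpha>) (wdb None f) z"
    using pd_commute[OF S(1) f S(2), of "Inr None" "Inl (Some \<alpha>)"] by simp
  have n: "complex_of_real ((cmod (wd None R z))\<^sup>2) = wd None R z * wdb None R z"
    by (simp only: complex_norm_square cnj_wd_R[OF zW])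
  have s: "cnj (slope \<beta> z) = wdb (Some \<beta>) R z / wdb None R z"
    by (simp add: slope_def cnj_wd_R[OF zW])
  have pq: "x * y / (v * w) = (x / v) * (y / w)" for x y v w :: complex by simp
  have "A - x * B - y * C + x * y * D = (A - y * C) - x * (B - y * D)" for A B C D x y :: complex
    by (simp add: algebra_simps)
  then show ?thesis
    unfolding ct_def ctb_def s
    unfolding D_mixed_def Let_def slope_def c n pq .
qed

lemma t4_sym:
  assumes z: "z \<in> W" shows "t4 \<mu> \<nu> \<gamma> \<sigma> z = t4 \<gamma> \<sigma> \<mu> \<nu> z"
proof -
  have c: "wd i (wdb m (wd j (wdb k R))) z = wd j (wdb k (wd i (wdb m R))) z" for i m j k
  proof -
    have "wd i (wdb m (wd j (wdb k R))) z = wd i (wd j (wdb m (wdb k R))) z"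
      by (rule wd_congW[OF z]) (auto intro!: smooth_intros wd_wdb_commute)
    also have "\<dots> = wd j (wd i (wdb m (wdb k R))) z"
      by (rule wd_wd_commute[OF _ z]) (intro smooth_intros)
    also have "\<dots> = wd j (wd i (wdb k (wdb m R))) z"
    proof (rule wd_congW[OF z])
      show "smooth_on W (wd i (wdb m (wdb k R)))" by (intro smooth_intros)
      show "wd i (wdb m (wdb k R)) x = wd i (wdb k (wdb m R)) x" if "x \<in> W" for x
        by (rule wd_congW[OF that]) (auto intro!: smooth_intros wdb_wdb_commute)
    qed
    also have "\<dots> = wd j (wdb k (wd i (wdb m R))) z"
      by (rule wd_congW[OF z]) (auto intro!: smooth_intros wd_wdb_commute[symmetric])
    finally show ?thesis .
  qed
  have swap: "ct \<mu> z (\<lambda>i. ctb \<nu> z (\<lambda>m. ct \<gamma> z (\<lambda>j. ctb \<sigma> z (\<lambda>k. f i m j k))))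
      = ct \<gamma> z (\<lambda>j. ctb \<sigma> z (\<lambda>k. ct \<mu> z (\<lambda>i. ctb \<nu> z (\<lambda>m. g j k i m))))"
    if "\<And>i m j k. f i m j k = g j k i m" for f g
    by (simp add: ct_def ctb_def algebra_simps that)
  show ?thesis
    unfolding t4_def by (rule swap) (rule c)
qed

lemma t3_sym: "z \<in> W \<Longrightarrow> t3 \<alpha> \<gamma> \<sigma> z = t3 \<gamma> \<alpha> \<sigma> z"
  unfolding t3_def by (subst ct_ct_swap) (simp add: R3_sym)

lemma A3_sym: "z \<in> W \<Longrightarrow> A3 \<alpha> \<gamma> z k = A3 \<gamma> \<alpha> z k"
  unfolding A3_def by (subst ct_ct_swap) (simp add: R3_sym)

end

context webster_connection
begin

text \<open>In the basis formed by the border vector, \<open>\<xi>\<close> and the frame, the bordered Hessian splits on \<open>M\<close>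
  into the Levi matrix and the block with rows \<open>(0, 1)\<close> and \<open>(1, |\<xi>|\<^sup>2)\<close>, whose inverse has rows
  \<open>(- |\<xi>|\<^sup>2, 1)\<close> and \<open>(1, 0)\<close>. This is the resulting inverse in coordinates.\<close>
definition Phi_inv where
  "Phi_inv z a b = (case a of
     None \<Rightarrow> (case b of None \<Rightarrow> - rr z | Some k \<Rightarrow> cnj (xi z k))
   | Some j \<Rightarrow> (case b of None \<Rightarrow> xi z j | Some k \<Rightarrow> levi_latin z j k))"

lemma sum_option_option: "(\<Sum>a\<in>UNIV. f a) = f None + (\<Sum>j\<in>UNIV. f (Some j))"
  for f :: "'n option option \<Rightarrow> complex"
  by (rule sum_option)

lemma Phi_inv_sum:
  "(\<Sum>a\<in>UNIV. \<Sum>b\<in>UNIV. Phi_inv z a b * f a b) = - rr z * f None None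
    + (\<Sum>k\<in>UNIV. cnj (xi z k) * f None (Some k)) + (\<Sum>j\<in>UNIV. xi z j * f (Some j) None)
    + levi_trace z (\<lambda>\<mu> \<nu>. ct \<mu> z (\<lambda>j. ctb \<nu> z (\<lambda>k. f (Some j) (Some k))))"
  unfolding sum_option_option levi_trace_def levi_latin_contract[symmetric]
  by (simp add: Phi_inv_def sum.distrib)

lemma upper_Phi:
  assumes z: "z \<in> M"
  shows "invertible (Phi z)" "upper (Phi z) a b = Phi_inv z a b"
proof -
  note zW = M_W[OF z]
  have R0: "R z = 0" using z M_eq by simp
  have "(\<Sum>k\<in>UNIV. cnj (xi z k) * wdb k R z) = cnj (\<Sum>k\<in>UNIV. xi z k * wd k R z)"
    by (simp add: cnj_wd_R[OF zW])
  then have 1: "(\<Sum>k\<in>UNIV. cnj (xi z k) * wdb k R z) = 1" by (simp add: xi_dR[OF z])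
  have "(\<Sum>b\<in>UNIV. Phi_inv z a b * Phi z $ c $ b) = (if c = a then 1 else 0)" for a c
    unfolding sum_option_option
    using 1 levi_latin_completeness[OF z]
    by (cases a; cases c) (simp_all add: Phi_inv_def R0 cnj_xi_R2[OF z] levi_latin_dR[OF zW] add.commute)
  then show "invertible (Phi z)" "upper (Phi z) a b = Phi_inv z a b"
    by (rule upper_unique)+
qed

text \<open>Both traces in \<open>pd_pd_ln_det\<close> are evaluated with \<open>Phi_inv_sum\<close>. In the second one many blocks
  vanish, since the first derivatives of \<open>\<rho>\<close> vanish on the frame and the complex Hessian of \<open>\<rho>\<close>
  pairs \<open>\<xi>\<close> with the conjugate frame to zero. The terms linear in \<open>\<xi>\<close> with mixed third derivatives, and the multiples of the Levi form,
  occur in both traces and cancel.\<close>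
lemma D_log:
  assumes z: "z \<in> M"
  shows "D_mixed \<rho> \<alpha> \<beta> logJ z
    = levi_trace z (\<lambda>\<mu> \<nu>. t4 \<alpha> \<beta> \<mu> \<nu> z) - levi_trace z (\<lambda>\<mu> \<nu>. levi_trace z (\<lambda>\<kappa> \<tau>. t3 \<alpha> \<kappa> \<nu> z * cnj (t3 \<beta> \<tau> \<mu> z)))
    + rr z * levi_trace z (\<lambda>\<kappa> \<tau>. hh \<alpha> \<kappa> z * cnj (hh \<beta> \<tau> z))
    - levi_trace z (\<lambda>\<kappa> \<tau>. (\<Sum>k\<in>UNIV. cnj (xi z k) * A3 \<alpha> \<kappa> z k) * cnj (hh \<beta> \<tau> z))
    - levi_trace z (\<lambda>\<kappa> \<tau>. hh \<alpha> \<kappa> z * (\<Sum>j\<in>UNIV. xi z j * cnj (A3 \<beta> \<tau> z j)))"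
proof -
  note zW = M_W[OF z]
  define V where "V = {x \<in> W. det (Phi x) \<noteq> 0}"
  have sPhi: "smooth_on W (\<lambda>x. Phi x $ a $ b)" for a b by (simp add: smooth_Phi_entry)
  have sdet: "smooth_on W (\<lambda>x. det (Phi x))" by (rule smooth_on_det[OF open_W sPhi])
  have V: "open V"
  proof -
    have "V = (\<lambda>x. det (Phi x)) -` (- {0}) \<inter> W" by (auto simp: V_def)
    then show ?thesis
      using continuous_on_open_vimage[OF open_W, of "\<lambda>x. det (Phi x)"] smooth_on_continuous[OF sdet] by auto
  qed
  have zV: "z \<in> V" using upper_Phi(1)[OF z] zW by (simp add: V_def invertible_det_nz)
  have VW: "V \<subseteq> W" by (auto simp: V_def)
  have sV: "smooth_on V (\<lambda>x. Phi x $ a $ b)" for a b by (rule smooth_on_subset[OF sPhi VW])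
  have L: "log_levi_fefferman \<rho> = (\<lambda>x. complex_of_real (ln (cmod (- det (Phi x)))))"
    by (simp add: fun_eq_iff log_levi_fefferman_def levi_fefferman_eq)
  have "smooth_on V (\<lambda>x. - det (Phi x))" by (rule smooth_on_minus[OF V smooth_on_subset[OF sdet VW]])
  then have "smooth_on V (\<lambda>x. complex_of_real (ln (cmod (- det (Phi x)))))"
    by (rule smooth_on_ln_cmod[OF V]) (simp_all add: V_def cnj_det_Phi)
  then have D: "D_mixed \<rho> \<alpha> \<beta> logJ z = ct \<alpha> z (\<lambda>j. ctb \<beta> z (\<lambda>k. wd j (wdb k logJ) z))"
    unfolding L by (rule D_mixed_eq[OF V zV VW])
  have dd: "wd j (wdb k logJ) z
      = (\<Sum>a\<in>UNIV. \<Sum>b\<in>UNIV. Phi_inv z a b * wd j (wdb k (Phi_entry a b)) z)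
      - (\<Sum>a\<in>UNIV. \<Sum>b\<in>UNIV. \<Sum>c\<in>UNIV. \<Sum>d\<in>UNIV. Phi_inv z a d * wd j (Phi_entry c d) z * Phi_inv z c b * wdb k (Phi_entry a b) z)" for j k
    using pd_pd_ln_det[OF V zV sV, of "Inl j" "Inr k"]
    by (simp add: L V_def cnj_det_Phi upper_Phi(2)[OF z])
  \<comment> \<open>Second and first derivatives of the bordered Hessian along \<open>Z\<^sub>\<alpha>\<close> and the conjugate of \<open>Z\<^sub>\<beta>\<close>, with
    the coefficients of these vectors frozen.\<close>
  define S where "S a b = ct \<alpha> z (\<lambda>j. ctb \<beta> z (\<lambda>k. wd j (wdb k (Phi_entry a b)) z))" for a b
  define P where "P a b = ct \<alpha> z (\<lambda>j. wd j (Phi_entry a b) z)" for a b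
  define Q where "Q a b = ctb \<beta> z (\<lambda>k. wdb k (Phi_entry a b) z)" for a b
  \<comment> \<open>The inner of the two contractions with the inverse.\<close>
  define X where "X a d = (\<Sum>c\<in>UNIV. \<Sum>b\<in>UNIV. Phi_inv z c b * (P c d * Q a b))" for a d
  have "D_mixed \<rho> \<alpha> \<beta> logJ z = (\<Sum>a\<in>UNIV. \<Sum>b\<in>UNIV. Phi_inv z a b * S a b)
      - (\<Sum>a\<in>UNIV. \<Sum>b\<in>UNIV. \<Sum>c\<in>UNIV. \<Sum>d\<in>UNIV. Phi_inv z a d * P c d * Phi_inv z c b * Q a b)"
    unfolding D dd by (simp only: ct_linear ctb_linear ct_sum ctb_sum S_def P_def Q_def)
  also have "(\<Sum>a\<in>UNIV. \<Sum>b\<in>UNIV. \<Sum>c\<in>UNIV. \<Sum>d\<in>UNIV. Phi_inv z a d * P c d * Phi_inv z c b * Q a b)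
      = (\<Sum>a\<in>UNIV. \<Sum>d\<in>UNIV. \<Sum>c\<in>UNIV. \<Sum>b\<in>UNIV. Phi_inv z a d * P c d * Phi_inv z c b * Q a b)"
    by (rule sum.cong[OF refl], subst sum.swap, subst (2) sum.swap, subst sum.swap, rule refl)
  also have "\<dots> = (\<Sum>a\<in>UNIV. \<Sum>d\<in>UNIV. Phi_inv z a d * X a d)"
    unfolding X_def sum_distrib_left by (simp add: mult_ac)
  finally have DX: "D_mixed \<rho> \<alpha> \<beta> logJ z
      = (\<Sum>a\<in>UNIV. \<Sum>b\<in>UNIV. Phi_inv z a b * S a b) - (\<Sum>a\<in>UNIV. \<Sum>d\<in>UNIV. Phi_inv z a d * X a d)" .
  let ?N = "None :: 'n option option"
  have X: "X a d = - rr z * (P ?N d * Q a ?N) + P ?N d * (\<Sum>k\<in>UNIV. cnj (xi z k) * Q a (Some k))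
      + (\<Sum>j\<in>UNIV. xi z j * P (Some j) d) * Q a ?N
      + levi_trace z (\<lambda>\<kappa> \<tau>. ct \<kappa> z (\<lambda>c. P (Some c) d) * ctb \<tau> z (\<lambda>b. Q a (Some b)))" for a d
    unfolding X_def Phi_inv_sum by (simp add: ct_linear ctb_linear sum_distrib_left sum_distrib_right mult_ac)
  have c3: "wdb k (wd i (wdb j R)) z = cnj (R3 k j i z)" for i j k
  proof -
    have "cnj (R3 k j i z) = wdb k (wdb j (wd i R)) z" by (rule cnj_R3[OF zW])
    also have "\<dots> = wdb k (wd i (wdb j R)) z"
      by (rule wdb_congW[OF zW]) (auto intro!: smooth_intros wd_wdb_commute)
    finally show ?thesis ..
  qed
  have PNN: "P ?N ?N = 0" and QNN: "Q ?N ?N = 0"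
    by (simp_all add: P_def Q_def ct_dR[OF zW] ctb_dR[OF zW])
  have Pxi: "(\<Sum>k\<in>UNIV. cnj (xi z k) * P ?N (Some k)) = 0"
  proof -
    have "(\<Sum>k\<in>UNIV. cnj (xi z k) * P ?N (Some k)) = ct \<alpha> z (\<lambda>j. \<Sum>k\<in>UNIV. cnj (xi z k) * wd j (wdb k R) z)"
      by (simp only: P_def ct_sum ct_linear Phi_entry.simps)
    then show ?thesis by (simp add: cnj_xi_R2[OF z] ct_linear ct_dR[OF zW])
  qed
  have Qxi: "(\<Sum>j\<in>UNIV. xi z j * Q (Some j) ?N) = 0"
  proof -
    have "(\<Sum>j\<in>UNIV. xi z j * Q (Some j) ?N) = ctb \<beta> z (\<lambda>k. \<Sum>j\<in>UNIV. xi z j * wd j (wdb k R) z)"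
      by (simp only: Q_def ctb_sum ctb_linear Phi_entry.simps wd_wdb_commute[OF smooth_R_W zW])
    then show ?thesis by (simp add: xi_R2[OF z] ctb_linear ctb_dR[OF zW])
  qed
  have PN: "ctb \<nu> z (\<lambda>k. P ?N (Some k)) = h z \<alpha> \<nu>" for \<nu>
    by (simp add: P_def levi_eq[OF zW] ct_ctb_swap)
  have QN: "ct \<mu> z (\<lambda>j. Q (Some j) ?N) = h z \<mu> \<beta>" for \<mu>
    by (simp add: Q_def levi_eq[OF zW] wd_wdb_commute[OF smooth_R_W zW])
  have P2: "ct \<kappa> z (\<lambda>j. P (Some j) ?N) = hh \<alpha> \<kappa> z" for \<kappa>
    by (simp add: P_def hh_def ct_ct_swap[of \<kappa>])
  have Q2: "ctb \<tau> z (\<lambda>k. Q ?N (Some k)) = cnj (hh \<beta> \<tau> z)" for \<tau>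
    by (simp add: Q_def cnj_hh[OF zW] ctb_ctb_swap[of \<tau>])
  have P3: "ct \<kappa> z (\<lambda>c. P (Some c) (Some k)) = A3 \<alpha> \<kappa> z k" for \<kappa> k
    by (simp add: P_def A3_def ct_ct_swap[of \<kappa>])
  have Q3: "ctb \<tau> z (\<lambda>b. Q (Some j) (Some b)) = cnj (A3 \<beta> \<tau> z j)" for \<tau> j
    by (simp add: Q_def A3_def cnj_ct c3 ctb_ctb_swap[of \<tau>])
  \<comment> \<open>The third derivatives contracted with \<open>\<xi>\<close> in a barred or unbarred slot, which occur in both
    traces.\<close>
  define g where "g \<mu> = ct \<mu> z (\<lambda>i. \<Sum>k\<in>UNIV. cnj (xi z k) * Q (Some i) (Some k))" for \<mu>
  define g' where "g' \<nu> = ctb \<nu> z (\<lambda>d. \<Sum>j\<in>UNIV. xi z j * P (Some j) (Some d))" for \<nu>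
  have S4: "ct \<mu> z (\<lambda>j. ctb \<nu> z (\<lambda>k. S (Some j) (Some k))) = t4 \<alpha> \<beta> \<mu> \<nu> z" for \<mu> \<nu>
    unfolding S_def t4_def by (simp add: ct_def ctb_def algebra_simps)
  have SN: "S ?N ?N = h z \<alpha> \<beta>"
    by (simp add: S_def levi_eq[OF zW])
  have S1: "(\<Sum>k\<in>UNIV. cnj (xi z k) * S ?N (Some k)) = g \<alpha>"
  proof -
    have "S ?N (Some k) = ct \<alpha> z (\<lambda>i. Q (Some i) (Some k))" for k
    proof -
      have "wd j (wdb m (wdb k R)) z = wdb m (wd j (wdb k R)) z" for j m
        by (rule wd_wdb_commute[OF _ zW, symmetric]) (intro smooth_intros)
      then show ?thesis by (simp add: S_def Q_def)
    qed
    then show ?thesis by (simp only: g_def ct_sum ct_linear)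
  qed
  have S2: "(\<Sum>j\<in>UNIV. xi z j * S (Some j) ?N) = g' \<beta>"
  proof -
    have "S (Some j) ?N = ctb \<beta> z (\<lambda>d. P (Some j) (Some d))" for j
    proof -
      have "wd i (wdb m (wd j R)) z = wd i (wd j (wdb m R)) z" for i m
        by (rule wd_congW[OF zW]) (auto intro!: smooth_intros wd_wdb_commute)
      then show ?thesis by (simp add: S_def P_def ct_ctb_swap)
    qed
    then show ?thesis by (simp only: g'_def ctb_sum ctb_linear)
  qed
  have KS: "(\<Sum>a\<in>UNIV. \<Sum>b\<in>UNIV. Phi_inv z a b * S a b) = - rr z * h z \<alpha> \<beta> + g \<alpha> + g' \<beta> + levi_trace z (\<lambda>\<mu> \<nu>. t4 \<alpha> \<beta> \<mu> \<nu> z)"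
    unfolding Phi_inv_sum S4 SN S1 S2 ..
  have X0: "X ?N ?N = levi_trace z (\<lambda>\<kappa> \<tau>. hh \<alpha> \<kappa> z * cnj (hh \<beta> \<tau> z))"
    unfolding X PNN QNN P2 Q2 by simp
  have X1: "(\<Sum>k\<in>UNIV. cnj (xi z k) * X ?N (Some k)) = levi_trace z (\<lambda>\<kappa> \<tau>. (\<Sum>k\<in>UNIV. cnj (xi z k) * A3 \<alpha> \<kappa> z k) * cnj (hh \<beta> \<tau> z))"
  proof -
    define Y where "Y = (\<Sum>k\<in>UNIV. cnj (xi z k) * Q ?N (Some k))"
    have "(\<Sum>k\<in>UNIV. cnj (xi z k) * X ?N (Some k)) = (\<Sum>k\<in>UNIV. cnj (xi z k) * P ?N (Some k)) * Y
        + (\<Sum>k\<in>UNIV. levi_trace z (\<lambda>\<kappa> \<tau>. cnj (xi z k) * (A3 \<alpha> \<kappa> z k * cnj (hh \<beta> \<tau> z))))"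
      unfolding X QNN P3 Q2 Y_def[symmetric] levi_trace_linear(3) by (simp add: distrib_left sum.distrib sum_distrib_right mult.assoc)
    then show ?thesis unfolding Pxi levi_trace_sum[symmetric] by (simp add: sum_distrib_right mult.assoc)
  qed
  have X2: "(\<Sum>j\<in>UNIV. xi z j * X (Some j) ?N) = levi_trace z (\<lambda>\<kappa> \<tau>. hh \<alpha> \<kappa> z * (\<Sum>j\<in>UNIV. xi z j * cnj (A3 \<beta> \<tau> z j)))"
  proof -
    define Y where "Y = (\<Sum>j\<in>UNIV. xi z j * P (Some j) ?N)"
    have "(\<Sum>j\<in>UNIV. xi z j * X (Some j) ?N) = Y * (\<Sum>j\<in>UNIV. xi z j * Q (Some j) ?N)
        + (\<Sum>j\<in>UNIV. levi_trace z (\<lambda>\<kappa> \<tau>. xi z j * (hh \<alpha> \<kappa> z * cnj (A3 \<beta> \<tau> z j))))"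
      unfolding X PNN P2 Q3 Y_def[symmetric] levi_trace_linear(3) by (simp add: distrib_left sum.distrib sum_distrib_left mult.left_commute)
    then show ?thesis unfolding Qxi levi_trace_sum[symmetric] by (simp add: sum_distrib_left mult.left_commute)
  qed
  have X3: "ct \<mu> z (\<lambda>i. ctb \<nu> z (\<lambda>d. X (Some i) (Some d))) = - rr z * (h z \<alpha> \<nu> * h z \<mu> \<beta>)
      + h z \<alpha> \<nu> * g \<mu> + g' \<nu> * h z \<mu> \<beta> + levi_trace z (\<lambda>\<kappa> \<tau>. t3 \<alpha> \<kappa> \<nu> z * cnj (t3 \<beta> \<tau> \<mu> z))" for \<mu> \<nu>
  proof -
    have ctr: "ct \<mu> z (\<lambda>i. levi_trace z (\<lambda>\<kappa> \<tau>. f i \<kappa> \<tau>)) = levi_trace z (\<lambda>\<kappa> \<tau>. ct \<mu> z (\<lambda>i. f i \<kappa> \<tau>))"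
      "ctb \<nu> z (\<lambda>i. levi_trace z (\<lambda>\<kappa> \<tau>. f i \<kappa> \<tau>)) = levi_trace z (\<lambda>\<kappa> \<tau>. ctb \<nu> z (\<lambda>i. f i \<kappa> \<tau>))" for f
      by (simp_all only: ct_def ctb_def levi_trace_linear)
    show ?thesis
      unfolding X P3 Q3
      by (simp only: ct_linear ctb_linear ctr PN QN g_def[symmetric] g'_def[symmetric] t3_A3 cnj_ctb)
  qed
  have "levi_trace z (\<lambda>\<mu> \<nu>. - rr z * (h z \<alpha> \<nu> * h z \<mu> \<beta>) + h z \<alpha> \<nu> * g \<mu> + g' \<nu> * h z \<mu> \<beta>
        + levi_trace z (\<lambda>\<kappa> \<tau>. t3 \<alpha> \<kappa> \<nu> z * cnj (t3 \<beta> \<tau> \<mu> z)))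
      = - rr z * h z \<alpha> \<beta> + g \<alpha> + g' \<beta> + levi_trace z (\<lambda>\<mu> \<nu>. levi_trace z (\<lambda>\<kappa> \<tau>. t3 \<alpha> \<kappa> \<nu> z * cnj (t3 \<beta> \<tau> \<mu> z)))"
    unfolding levi_trace_linear levi_trace_levi_left[OF z] levi_trace_levi_right[OF z] ..
  then have KX: "(\<Sum>a\<in>UNIV. \<Sum>d\<in>UNIV. Phi_inv z a d * X a d) = - rr z * levi_trace z (\<lambda>\<kappa> \<tau>. hh \<alpha> \<kappa> z * cnj (hh \<beta> \<tau> z))
      + levi_trace z (\<lambda>\<kappa> \<tau>. (\<Sum>k\<in>UNIV. cnj (xi z k) * A3 \<alpha> \<kappa> z k) * cnj (hh \<beta> \<tau> z))
      + levi_trace z (\<lambda>\<kappa> \<tau>. hh \<alpha> \<kappa> z * (\<Sum>j\<in>UNIV. xi z j * cnj (A3 \<beta> \<tau> z j)))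
      + (- rr z * h z \<alpha> \<beta> + g \<alpha> + g' \<beta> + levi_trace z (\<lambda>\<mu> \<nu>. levi_trace z (\<lambda>\<kappa> \<tau>. t3 \<alpha> \<kappa> \<nu> z * cnj (t3 \<beta> \<tau> \<mu> z))))"
    unfolding Phi_inv_sum X0 X1 X2 X3 by simp
  show ?thesis unfolding DX KS KX by simp
qed

text \<open>Up to the multiple of the Levi form, the trace of the curvature agrees term by term with the
  negative of \<open>D_log\<close>, by the symmetries of the derivatives of \<open>\<rho>\<close>. The two terms with \<open>|\<xi>|\<^sup>2\<close> and the
  Levi form contribute \<open>n\<close> and \<open>1\<close> to the factor \<open>n + 1\<close>.\<close>
lemma ricci_formula:
  assumes z: "z \<in> M"
  shows "psh_ricci \<rho> nabla z \<gamma> \<sigma>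
    = - D_mixed \<rho> \<gamma> \<sigma> logJ z + of_nat (CARD('n) + 1) * rr z * h z \<gamma> \<sigma>"
proof -
  note zW = M_W[OF z]
  have "psh_ricci \<rho> nabla z \<gamma> \<sigma> = levi_trace z (\<lambda>\<alpha> \<beta>. psh_curvature \<rho> nabla z \<alpha> \<beta> \<gamma> \<sigma>)"
    by (simp add: psh_ricci_def levi_trace_def)
  also have "\<dots> = - levi_trace z (\<lambda>\<alpha> \<beta>. t4 \<gamma> \<sigma> \<alpha> \<beta> z)
    + levi_trace z (\<lambda>\<alpha> \<beta>. levi_trace z (\<lambda>\<mu> \<nu>. t3 \<gamma> \<alpha> \<nu> z * cnj (t3 \<sigma> \<beta> \<mu> z)))
    + rr z * (levi_trace z (h z) * h z \<gamma> \<sigma> + levi_trace z (\<lambda>\<alpha> \<beta>. h z \<gamma> \<beta> * h z \<alpha> \<sigma>))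
    + levi_trace z (\<lambda>\<alpha> \<beta>. (\<Sum>k\<in>UNIV. cnj (xi z k) * A3 \<gamma> \<alpha> z k) * cnj (hh \<sigma> \<beta> z))
    + levi_trace z (\<lambda>\<alpha> \<beta>. hh \<gamma> \<alpha> z * (\<Sum>j\<in>UNIV. xi z j * cnj (A3 \<sigma> \<beta> z j)))
    - rr z * levi_trace z (\<lambda>\<alpha> \<beta>. hh \<gamma> \<alpha> z * cnj (hh \<sigma> \<beta> z))"
    unfolding curvature_formula[OF z] levi_trace_linear
    by (simp only: t4_sym[OF zW, of _ _ \<gamma> \<sigma>] t3_sym[OF zW, of _ \<gamma>] t3_sym[OF zW, of _ \<sigma>]
        A3_sym[OF zW, of _ \<gamma>] A3_sym[OF zW, of _ \<sigma>] hh_sym[OF zW, of _ \<gamma>] hh_sym[OF zW, of _ \<sigma>] mult.commute[of "h z _ \<sigma>"])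
  also have "levi_trace z (\<lambda>\<alpha> \<beta>. h z \<gamma> \<beta> * h z \<alpha> \<sigma>) = h z \<gamma> \<sigma>"
    by (rule levi_trace_levi_left[OF z])
  also have "levi_trace z (\<lambda>\<alpha> \<beta>. levi_trace z (\<lambda>\<mu> \<nu>. t3 \<gamma> \<alpha> \<nu> z * cnj (t3 \<sigma> \<beta> \<mu> z)))
      = levi_trace z (\<lambda>\<mu> \<nu>. levi_trace z (\<lambda>\<alpha> \<beta>. t3 \<gamma> \<alpha> \<nu> z * cnj (t3 \<sigma> \<beta> \<mu> z)))"
    by (rule levi_trace_swap)
  finally show ?thesis
    unfolding D_log[OF z] levi_trace_levi[OF z] by (simp add: algebra_simps)
qed

lemma scalar_formula:
  assumes z: "z \<in> M"
  shows "psh_scalar \<rho> nabla z = - levi_trace z (\<lambda>\<epsilon> \<delta>. D_mixed \<rho> \<epsilon> \<delta> logJ z)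
    + of_nat (CARD('n) + 1) * rr z * of_nat CARD('n)"
proof -
  have "psh_scalar \<rho> nabla z = levi_trace z (\<lambda>\<gamma> \<sigma>. psh_ricci \<rho> nabla z \<gamma> \<sigma>)"
    by (simp add: psh_scalar_def levi_trace_def)
  also have "\<dots> = - levi_trace z (\<lambda>\<epsilon> \<delta>. D_mixed \<rho> \<epsilon> \<delta> logJ z) + of_nat (CARD('n) + 1) * rr z * levi_trace z (h z)"
    unfolding ricci_formula[OF z] levi_trace_linear ..
  finally show ?thesis by (simp only: levi_trace_levi[OF z])
qed

text \<open>The multiples \<open>(n + 1) |\<xi>|\<^sup>2\<close> of the Levi form in the Ricci tensor contribute
  \<open>- 2 (n + 1) / (n + 2)\<close> and the scalar curvature contributes \<open>n / (n + 2)\<close>, together \<open>- 1\<close>, times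
  \<open>|\<xi>|\<^sup>2\<close>, which removes the corresponding term of the curvature.\<close>
lemma weyl_formula:
  assumes z: "z \<in> M"
  shows "chern_moser_weyl \<rho> nabla z \<alpha> \<beta> \<gamma> \<sigma> = psh_curvature \<rho> nabla z \<alpha> \<beta> \<gamma> \<sigma>
    - rr z * (h z \<alpha> \<beta> * h z \<gamma> \<sigma> + h z \<alpha> \<sigma> * h z \<gamma> \<beta>)
    + 1 / of_nat (CARD('n) + 2)
          * (h z \<gamma> \<sigma> * D_mixed \<rho> \<alpha> \<beta> logJ z
             + h z \<gamma> \<beta> * D_mixed \<rho> \<alpha> \<sigma> logJ z
             + h z \<alpha> \<beta> * D_mixed \<rho> \<gamma> \<sigma> logJ z
             + h z \<alpha> \<sigma> * D_mixed \<rho> \<gamma> \<beta> logJ z)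
        - 1 / of_nat ((CARD('n) + 1) * (CARD('n) + 2))
          * (h z \<alpha> \<beta> * h z \<gamma> \<sigma> + h z \<alpha> \<sigma> * h z \<gamma> \<beta>)
          * levi_trace z (\<lambda>\<epsilon> \<delta>. D_mixed \<rho> \<epsilon> \<delta> logJ z)"
proof -
  have alg: "C - ((- d1 + (N + 1) * r * h1) * h2 + (- d2 + (N + 1) * r * h3) * h4 + (- d3 + (N + 1) * r * h4) * h3
        + (- d4 + (N + 1) * r * h2) * h1) / (N + 2) + (- t + (N + 1) * r * N) * (h1 * h2 + h4 * h3) / ((N + 1) * (N + 2))
    = C - r * (h1 * h2 + h4 * h3) + 1 / (N + 2) * (h2 * d1 + h3 * d3 + h1 * d4 + h4 * d2)
      - 1 / ((N + 1) * (N + 2)) * (h1 * h2 + h4 * h3) * t"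
    if "N + 1 \<noteq> 0" "N + 2 \<noteq> 0" for C d1 d2 d3 d4 N r h1 h2 h3 h4 t :: complex
  proof -
    have "r * (h1 * h2 + h4 * h3) = r * (h1 * h2 + h4 * h3) * ((N + 1) * (N + 2)) / ((N + 1) * (N + 2))"
      using that by simp
    then show ?thesis using that by (simp add: divide_simps) (simp add: algebra_simps)
  qed
  have nz: "(of_nat CARD('n) :: complex) + 1 \<noteq> 0" "(of_nat CARD('n) :: complex) + 2 \<noteq> 0"
    using of_nat_neq_0[of "CARD('n)", where 'a=complex] of_nat_neq_0[of "CARD('n) + 1", where 'a=complex]
    by (simp_all add: add.commute add.assoc)
  show ?thesis
    unfolding chern_moser_weyl_def ricci_formula[OF z] scalar_formula[OF z] of_nat_mult of_nat_add of_nat_1 of_nat_numeral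
    by (rule alg[OF nz])
qed

lemma curvature_in_coordinates:
  assumes t: "transverse_field \<rho> M \<xi> r" and z: "z \<in> M"
  shows "psh_curvature \<rho> nabla z \<alpha> \<beta> \<gamma> \<sigma> =
        - fourth_order \<rho> \<alpha> \<beta> \<gamma> \<sigma> R z
        + (\<Sum>j\<in>UNIV. \<Sum>k\<in>UNIV. h_latin \<rho> \<xi> r z j k
             * D_holo \<rho> \<alpha> \<gamma> (wdb k R) z * D_anti \<rho> \<beta> \<sigma> (wd j R) z)
        + xi_norm2 \<rho> \<xi> z * (h z \<alpha> \<beta> * h z \<gamma> \<sigma> + h z \<alpha> \<sigma> * h z \<gamma> \<beta>)
        + h_anti \<rho> z \<beta> \<sigma> * (\<Sum>k\<in>UNIV. cnj (\<xi> z $ k) * D_holo \<rho> \<alpha> \<gamma> (wdb k R) z)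
        + h_holo \<rho> z \<alpha> \<gamma> * (\<Sum>j\<in>UNIV. \<xi> z $ j * D_anti \<rho> \<beta> \<sigma> (wd j R) z)
        - xi_norm2 \<rho> \<xi> z * h_holo \<rho> z \<alpha> \<gamma> * h_anti \<rho> z \<beta> \<sigma>"
proof -
  note zW = M_W[OF z]
  have "(\<Sum>j\<in>UNIV. \<Sum>k\<in>UNIV. h_latin \<rho> \<xi> r z j k * A3 \<alpha> \<gamma> z k * cnj (A3 \<beta> \<sigma> z j))
      = levi_trace z (\<lambda>\<mu> \<nu>. t3 \<alpha> \<gamma> \<nu> z * cnj (t3 \<beta> \<sigma> \<mu> z))"
    unfolding h_latin_eq[OF t z] mult.assoc levi_latin_contract
    by (simp add: levi_trace_def ctb_linear ct_linear t3_A3 cnj_ctb)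
  then show ?thesis
    by (simp add: curvature_formula[OF z] mult.assoc mult.commute[of "cnj (hh _ _ _)"] fourth_order_eq D_holo_dR[OF zW] D_anti_dR[OF zW] h_holo_eq[OF zW] h_anti_def
        transverse_unique[OF t z] xi_norm2_eq[OF t z])
qed

end

theorem theorem3p1:
  fixes \<rho> :: "complex^('n::finite option) \<Rightarrow> real"
    and U M :: "(complex^('n option)) set"
    and T :: "'n option field"
    and nabla :: "'n option field \<Rightarrow> 'n option field \<Rightarrow> 'n option field"
    and \<xi> :: "complex^('n option) \<Rightarrow> complex^('n option)"
    and r :: "complex^('n option) \<Rightarrow> complex"
  assumes "open U" and "smooth_on U \<rho>"
    and "M = {z \<in> U. \<rho> z = 0}"
    and "\<forall>z\<in>M. frechet_derivative \<rho> (at z) \<noteq> (\<lambda>v. 0)"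
    and "levi_nondegenerate \<rho> M"
    and "\<forall>z\<in>M. levi_fefferman \<rho> z \<noteq> 0"
    and "\<forall>z\<in>M. wd None (cplx \<rho>) z \<noteq> 0"
    and "reeb_field \<rho> M T"
    and "tanaka_webster \<rho> M T nabla"
    and "transverse_field \<rho> M \<xi> r"
  shows "\<forall>z\<in>M. \<forall>\<alpha> \<beta> \<gamma> \<sigma>.
      psh_curvature \<rho> nabla z \<alpha> \<beta> \<gamma> \<sigma> =
        - fourth_order \<rho> \<alpha> \<beta> \<gamma> \<sigma> (cplx \<rho>) z
        + (\<Sum>j\<in>UNIV. \<Sum>k\<in>UNIV. h_latin \<rho> \<xi> r z j k
             * D_holo \<rho> \<alpha> \<gamma> (wdb k (cplx \<rho>)) z * D_anti \<rho> \<beta> \<sigma> (wd j (cplx \<rho>)) z)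
        + xi_norm2 \<rho> \<xi> z * (levi \<rho> z \<alpha> \<beta> * levi \<rho> z \<gamma> \<sigma> + levi \<rho> z \<alpha> \<sigma> * levi \<rho> z \<gamma> \<beta>)
        + h_anti \<rho> z \<beta> \<sigma> * (\<Sum>k\<in>UNIV. cnj (\<xi> z $ k) * D_holo \<rho> \<alpha> \<gamma> (wdb k (cplx \<rho>)) z)
        + h_holo \<rho> z \<alpha> \<gamma> * (\<Sum>j\<in>UNIV. \<xi> z $ j * D_anti \<rho> \<beta> \<sigma> (wd j (cplx \<rho>)) z)
        - xi_norm2 \<rho> \<xi> z * h_holo \<rho> z \<alpha> \<gamma> * h_anti \<rho> z \<beta> \<sigma>
    \<and> chern_moser_weyl \<rho> nabla z \<alpha> \<beta> \<gamma> \<sigma> =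
        - fourth_order \<rho> \<alpha> \<beta> \<gamma> \<sigma> (cplx \<rho>) z
        + (\<Sum>j\<in>UNIV. \<Sum>k\<in>UNIV. h_latin \<rho> \<xi> r z j k
             * D_holo \<rho> \<alpha> \<gamma> (wdb k (cplx \<rho>)) z * D_anti \<rho> \<beta> \<sigma> (wd j (cplx \<rho>)) z)
        + h_anti \<rho> z \<beta> \<sigma> * (\<Sum>k\<in>UNIV. cnj (\<xi> z $ k) * D_holo \<rho> \<alpha> \<gamma> (wdb k (cplx \<rho>)) z)
        + h_holo \<rho> z \<alpha> \<gamma> * (\<Sum>j\<in>UNIV. \<xi> z $ j * D_anti \<rho> \<beta> \<sigma> (wd j (cplx \<rho>)) z)
        - xi_norm2 \<rho> \<xi> z * h_holo \<rho> z \<alpha> \<gamma> * h_anti \<rho> z \<beta> \<sigma>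
        + 1 / of_nat (CARD('n) + 2)
          * (levi \<rho> z \<gamma> \<sigma> * D_mixed \<rho> \<alpha> \<beta> (log_levi_fefferman \<rho>) z
             + levi \<rho> z \<gamma> \<beta> * D_mixed \<rho> \<alpha> \<sigma> (log_levi_fefferman \<rho>) z
             + levi \<rho> z \<alpha> \<beta> * D_mixed \<rho> \<gamma> \<sigma> (log_levi_fefferman \<rho>) z
             + levi \<rho> z \<alpha> \<sigma> * D_mixed \<rho> \<gamma> \<beta> (log_levi_fefferman \<rho>) z)
        - 1 / of_nat ((CARD('n) + 1) * (CARD('n) + 2))
          * (levi \<rho> z \<alpha> \<beta> * levi \<rho> z \<gamma> \<sigma> + levi \<rho> z \<alpha> \<sigma> * levi \<rho> z \<gamma> \<beta>)
          * (\<Sum>\<epsilon>\<in>UNIV. \<Sum>\<delta>\<in>UNIV. levi_upper \<rho> z \<epsilon> \<delta>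
               * D_mixed \<rho> \<epsilon> \<delta> (log_levi_fefferman \<rho>) z)"
proof -
  interpret webster_connection \<rho> U M T nabla
    using assms(1,2,3,5,7,8,9) by unfold_locales
  have cancel: "(f + a + x * l + b + c - d) - x * l + e - g = f + a + b + c - d + e - g"
    for f a x l b c d e g :: complex by simp
  show ?thesis
  proof (intro ballI allI conjI, goal_cases)
    case (1 z \<alpha> \<beta> \<gamma> \<sigma>)
    then show ?case by (rule curvature_in_coordinates[OF assms(10)])
  next
    case (2 z \<alpha> \<beta> \<gamma> \<sigma>)
    show ?case
      unfolding weyl_formula[OF 2] curvature_in_coordinates[OF assms(10) 2] xi_norm2_eq[OF assms(10) 2] levi_trace_def
      by (rule cancel)
  qed
qed

end
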